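(* Let $X$ be a compact connected $3$-manifold and let $(L,h,K)$ be a CMC Einstein flow on $X$ with a crushing singularity as $t\to0$, parametrized by the Hubble time $t=-\frac3H\in(0,t_0]$. Suppose that the scalar curvature of the spatial metrics satisfies $R\le0$. Given $\Lambda>1$, we have $$\lim_{s\to0}\left|L_s-\frac13\right| = \lim_{s\to0}\left||K_s|^2-\frac{9}{u^2}\right| = \lim_{s\to0}|R_s| = 0$$ in $L^1\left([\Lambda^{-1},\Lambda]\times X,\ du\,\operatorname{dvol}_0\right)$.
   Context: Einstein flow. An Einstein flow on an $n$-manifold $X$ (here $n=3$) over a time interval is a smooth family of positive functions $L(t)$ (lapse), Riemannian metrics $h(t)$ and symmetric covariant $2$-tensor fields $K(t)$ on $X$ such that, with $H = h^{ij}K_{ij}$, $K^0 = K-\frac{H}{n}h$, $R_{ij}$ and $R$ the Ricci tensor and scalar curvature of $h(t)$, one has the constraint equations $R - |K^0|^2 + (1-\frac1n)H^2 = 0$ and $\nabla_iK^i{}_j - \nabla_jH = 0$, and the evolution equations $\partial_t h_{ij} = -2LK_{ij}$ and $\partial_tK_{ij} = LHK_{ij} - 2Lh^{kl}K_{ik}K_{lj} - L_{;ij} + LR_{ij}$. Equivalently, the Lorentzian metric $g = -L^2dt^2+h(t)$ is Ricci-flat with $K(t)$ the second fundamental form of the time-$t$ slice. The flow is CMC if $H$ depends only on $t$. With a crushing singularity as $t\to0$, the mean curvature $H$ is negative, increasing in $t$, and $H\to-\infty$ as $t\to0$; one takes as time parameter the Hubble time $t = -\frac{n}{H}\in(0,t_0]$.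 Rescaling. For $s>0$, the rescaled flow has time variable $u$ (with $t=su$) and data $L_s(u)=L(su)$, $h_s(u)=s^{-2}h(su)$, $K_s(u)=s^{-1}K(su)$, scalar curvature $R_s(u)=s^2R(su)$; $|K_s|^2$ is computed with respect to $h_s$, so $|K_s|^2(u) = s^2|K|^2(su)$. Limiting measure. When $R\le0$, $\operatorname{dvol}_0 = \lim_{t\to0}t^{-1}\operatorname{dvol}_{h(t)}$; this limit exists as a measure on $X$ (since $t^{-1}\operatorname{dvol}_{h(t)}$ is pointwise nondecreasing in $t$) and it may be zero. *)

theory Defs
  imports "HOL-Analysis.Analysis"
begin

section \<open>Smooth maps between Euclidean spaces\<close>

text \<open>\<open>C_k k f S\<close> is meant for open \<open>S\<close>: all iterated partial derivatives of \<open>f\<close> up to order \<open>k\<close>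
  exist and are continuous on \<open>S\<close>.\<close>

primrec C_k :: "nat \<Rightarrow> ('a::euclidean_space \<Rightarrow> 'b::real_normed_vector) \<Rightarrow> 'a set \<Rightarrow> bool" where
  "C_k 0 f S \<longleftrightarrow> continuous_on S f"
| "C_k (Suc k) f S \<longleftrightarrow> (\<forall>x\<in>S. f differentiable (at x)) \<and>
     (\<forall>b\<in>Basis. C_k k (\<lambda>x. frechet_derivative f (at x) b) S)"

text \<open>Smoothness on an arbitrary set: local extendability to a smooth map on an open set. It is
  needed for time intervals such as \<open>{0<..t0}\<close> that contain an endpoint.\<close>

definition smooth_on :: "'a::euclidean_space set \<Rightarrow> ('a \<Rightarrow> 'b::real_normed_vector) \<Rightarrow> bool" where
  "smooth_on S f \<longleftrightarrow> (\<forall>x\<in>S. \<exists>U g. open U \<and> x \<in> U \<and> (\<forall>k. C_k k g U) \<and> (\<forall>y\<in>S \<inter> U. g y = f y))"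


section \<open>Smooth manifolds and tensor fields\<close>

text \<open>A chart is a pair of a domain and a coordinate map; the values of the coordinate map outside
  the domain are irrelevant. The manifold is the whole type \<open>'a\<close>, of dimension \<open>CARD('n)\<close>.\<close>

type_synonym ('a, 'n) chart = "'a set \<times> ('a \<Rightarrow> real^'n)"
type_synonym ('a, 'n) atlas = "('a, 'n) chart set"

abbreviation chart_dom :: "('a, 'n) chart \<Rightarrow> 'a set" where "chart_dom c \<equiv> fst c"
abbreviation coords :: "('a, 'n) chart \<Rightarrow> 'a \<Rightarrow> real^'n" where "coords c \<equiv> snd c"

definition param :: "('a, 'n) chart \<Rightarrow> real^'n \<Rightarrow> 'a" where
  "param c = inv_into (chart_dom c) (coords c)"

definition is_chart :: "('a::topological_space, 'n::finite) chart \<Rightarrow> bool" where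
  "is_chart c \<longleftrightarrow> open (chart_dom c) \<and> open (coords c ` chart_dom c) \<and>
     homeomorphism (chart_dom c) (coords c ` chart_dom c) (coords c) (param c)"

definition smooth_atlas :: "('a::topological_space, 'n::finite) atlas \<Rightarrow> bool" where
  "smooth_atlas A \<longleftrightarrow> (\<forall>c\<in>A. is_chart c) \<and> (\<Union>c\<in>A. chart_dom c) = UNIV \<and>
     (\<forall>c\<in>A. \<forall>d\<in>A. smooth_on (coords c ` (chart_dom c \<inter> chart_dom d)) (coords d \<circ> param c))"

text \<open>A covariant 2-tensor field is given by its component matrices in the charts of the atlas,
  subject to the transformation law below. Components in other charts, or at points outside the
  domain of the chart, are irrelevant.\<close>

type_synonym ('a, 'n) tensor2 = "('a, 'n) chart \<Rightarrow> 'a \<Rightarrow> real^'n^'n"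

definition tensor_field :: "('a, 'n::finite) atlas \<Rightarrow> ('a, 'n) tensor2 \<Rightarrow> bool" where
  "tensor_field A T \<longleftrightarrow> (\<forall>c\<in>A. \<forall>d\<in>A. \<forall>p\<in>chart_dom c \<inter> chart_dom d.
     let J = matrix (frechet_derivative (coords d \<circ> param c) (at (coords c p)))
     in T c p = transpose J ** T d p ** J)"

definition symmetric_tensor_field :: "('a, 'n::finite) atlas \<Rightarrow> ('a, 'n) tensor2 \<Rightarrow> bool" where
  "symmetric_tensor_field A T \<longleftrightarrow> tensor_field A T \<and>
     (\<forall>c\<in>A. \<forall>p\<in>chart_dom c. transpose (T c p) = T c p)"

definition riemannian_metric :: "('a, 'n::finite) atlas \<Rightarrow> ('a, 'n) tensor2 \<Rightarrow> bool" where
  "riemannian_metric A g \<longleftrightarrow> symmetric_tensor_field A g \<and>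
     (\<forall>c\<in>A. \<forall>p\<in>chart_dom c. \<forall>v. v \<noteq> 0 \<longrightarrow> v \<bullet> (g c p *v v) > 0)"

definition smooth_family_fun ::
    "('a, 'n::finite) atlas \<Rightarrow> real set \<Rightarrow> (real \<Rightarrow> 'a \<Rightarrow> real) \<Rightarrow> bool" where
  "smooth_family_fun A I f \<longleftrightarrow>
     (\<forall>c\<in>A. smooth_on (I \<times> coords c ` chart_dom c) (\<lambda>(t, y). f t (param c y)))"

definition smooth_family_tensor ::
    "('a, 'n::finite) atlas \<Rightarrow> real set \<Rightarrow> (real \<Rightarrow> ('a, 'n) tensor2) \<Rightarrow> bool" where
  "smooth_family_tensor A I T \<longleftrightarrow>
     (\<forall>c\<in>A. smooth_on (I \<times> coords c ` chart_dom c) (\<lambda>(t, y). T t c (param c y)))"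


section \<open>Riemannian geometry in a chart\<close>

text \<open>The partial derivative \<open>\<partial>\<^sub>i f\<close> with respect to the coordinates of the chart \<open>c\<close>, as a function
  on the domain of \<open>c\<close>.\<close>

definition partial_deriv :: "('a, 'n::finite) chart \<Rightarrow> 'n \<Rightarrow> ('a \<Rightarrow> real) \<Rightarrow> 'a \<Rightarrow> real" where
  "partial_deriv c i f p = frechet_derivative (f \<circ> param c) (at (coords c p)) (axis i 1)"

text \<open>\<open>christoffel g c k i j\<close> is \<open>\<Gamma>\<^sup>k\<^sub>i\<^sub>j\<close>.\<close>

definition christoffel ::
    "('a, 'n::finite) tensor2 \<Rightarrow> ('a, 'n) chart \<Rightarrow> 'n \<Rightarrow> 'n \<Rightarrow> 'n \<Rightarrow> 'a \<Rightarrow> real" where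
  "christoffel g c k i j p = 1/2 * (\<Sum>l\<in>UNIV. matrix_inv (g c p) $ k $ l *
     (partial_deriv c i (\<lambda>q. g c q $ j $ l) p + partial_deriv c j (\<lambda>q. g c q $ i $ l) p
      - partial_deriv c l (\<lambda>q. g c q $ i $ j) p))"

text \<open>Sign convention: the Ricci tensor of a round sphere is positive.\<close>

definition ricci :: "('a, 'n::finite) tensor2 \<Rightarrow> ('a, 'n) tensor2" where
  "ricci g c p = (\<chi> i j.
     (\<Sum>k\<in>UNIV. partial_deriv c k (christoffel g c k i j) p
              - partial_deriv c j (christoffel g c k i k) p)
     + (\<Sum>k\<in>UNIV. \<Sum>l\<in>UNIV. christoffel g c k k l p * christoffel g c l i j p
                        - christoffel g c k j l p * christoffel g c l i k p))"

definition hessian :: "('a, 'n::finite) tensor2 \<Rightarrow> ('a \<Rightarrow> real) \<Rightarrow> ('a, 'n) tensor2" where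
  "hessian g f c p = (\<chi> i j. partial_deriv c i (partial_deriv c j f) p
     - (\<Sum>k\<in>UNIV. christoffel g c k i j p * partial_deriv c k f p))"

text \<open>\<open>cov_deriv g T c k i j\<close> is \<open>\<nabla>\<^sub>k T\<^sub>i\<^sub>j\<close>.\<close>

definition cov_deriv ::
    "('a, 'n::finite) tensor2 \<Rightarrow> ('a, 'n) tensor2 \<Rightarrow> ('a, 'n) chart \<Rightarrow> 'n \<Rightarrow> 'n \<Rightarrow> 'n \<Rightarrow> 'a \<Rightarrow> real" where
  "cov_deriv g T c k i j p = partial_deriv c k (\<lambda>q. T c q $ i $ j) p
     - (\<Sum>l\<in>UNIV. christoffel g c l k i p * T c p $ l $ j)
     - (\<Sum>l\<in>UNIV. christoffel g c l k j p * T c p $ i $ l)"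

text \<open>\<open>\<nabla>\<^sub>i T\<^sup>i\<^sub>j = g\<^sup>i\<^sup>k \<nabla>\<^sub>i T\<^sub>k\<^sub>j\<close>\<close>

definition divergence ::
    "('a, 'n::finite) tensor2 \<Rightarrow> ('a, 'n) tensor2 \<Rightarrow> ('a, 'n) chart \<Rightarrow> 'n \<Rightarrow> 'a \<Rightarrow> real" where
  "divergence g T c j p =
     (\<Sum>i\<in>UNIV. \<Sum>k\<in>UNIV. matrix_inv (g c p) $ i $ k * cov_deriv g T c i k j p)"

text \<open>\<open>g\<^sup>i\<^sup>j T\<^sub>i\<^sub>j\<close> and \<open>|T|\<^sup>2 = g\<^sup>i\<^sup>k g\<^sup>j\<^sup>l T\<^sub>i\<^sub>j T\<^sub>k\<^sub>l\<close>, computed in the chart \<open>c\<close>.\<close>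

definition metric_trace ::
    "('a, 'n::finite) tensor2 \<Rightarrow> ('a, 'n) tensor2 \<Rightarrow> ('a, 'n) chart \<Rightarrow> 'a \<Rightarrow> real" where
  "metric_trace g T c p = (\<Sum>i\<in>UNIV. \<Sum>j\<in>UNIV. matrix_inv (g c p) $ i $ j * T c p $ i $ j)"

definition metric_norm_sq ::
    "('a, 'n::finite) tensor2 \<Rightarrow> ('a, 'n) tensor2 \<Rightarrow> ('a, 'n) chart \<Rightarrow> 'a \<Rightarrow> real" where
  "metric_norm_sq g T c p =
     (\<Sum>i\<in>UNIV. \<Sum>j\<in>UNIV. \<Sum>k\<in>UNIV. \<Sum>l\<in>UNIV.
        matrix_inv (g c p) $ i $ k * matrix_inv (g c p) $ j $ l * T c p $ i $ j * T c p $ k $ l)"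

definition trace_free_part ::
    "('a, 'n::finite) tensor2 \<Rightarrow> ('a, 'n) tensor2 \<Rightarrow> ('a, 'n) tensor2" where
  "trace_free_part g T c p = T c p - (metric_trace g T c p / real CARD('n)) *\<^sub>R g c p"


section \<open>Scalar invariants and the Riemannian measure\<close>

text \<open>The scalar invariants do not depend on the chart in which they are computed, so any chart of
  the atlas around the point may be used to define them as functions on the manifold.\<close>

definition chart_at :: "('a, 'n) atlas \<Rightarrow> 'a \<Rightarrow> ('a, 'n) chart" where
  "chart_at A p = (SOME c. c \<in> A \<and> p \<in> chart_dom c)"

definition scalar_curvature ::
    "('a, 'n::finite) atlas \<Rightarrow> ('a, 'n) tensor2 \<Rightarrow> 'a \<Rightarrow> real" where
  "scalar_curvature A g p = metric_trace g (ricci g) (chart_at A p) p"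

definition mean_curvature ::
    "('a, 'n::finite) atlas \<Rightarrow> ('a, 'n) tensor2 \<Rightarrow> ('a, 'n) tensor2 \<Rightarrow> 'a \<Rightarrow> real" where
  "mean_curvature A g K p = metric_trace g K (chart_at A p) p"

definition norm_sq ::
    "('a, 'n::finite) atlas \<Rightarrow> ('a, 'n) tensor2 \<Rightarrow> ('a, 'n) tensor2 \<Rightarrow> 'a \<Rightarrow> real" where
  "norm_sq A g T p = metric_norm_sq g T (chart_at A p) p"

text \<open>The Riemannian measure is the unique Borel measure with density \<open>\<surd>det g\<close> with respect to
  Lebesgue measure in every chart of the atlas.\<close>

definition is_riemannian_measure ::
    "('a::topological_space, 'n::finite) atlas \<Rightarrow> ('a, 'n) tensor2 \<Rightarrow> 'a measure \<Rightarrow> bool" where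
  "is_riemannian_measure A g M \<longleftrightarrow> sets M = sets borel \<and>
     (\<forall>c\<in>A. \<forall>B\<in>sets borel. B \<subseteq> chart_dom c \<longrightarrow>
        emeasure M B = (\<integral>\<^sup>+y\<in>coords c ` B. ennreal (sqrt (det (g c (param c y)))) \<partial>lborel))"

definition dvol ::
    "('a::topological_space, 'n::finite) atlas \<Rightarrow> ('a, 'n) tensor2 \<Rightarrow> 'a measure" where
  "dvol A g = (THE M. is_riemannian_measure A g M)"

text \<open>The setwise limit of a family of Borel measures (if the setwise limit fails to be a measure,
  \<open>measure_of\<close> yields the zero measure).\<close>

definition limit_measure :: "'b filter \<Rightarrow> ('b \<Rightarrow> 'a::topological_space measure) \<Rightarrow> 'a measure" where
  "limit_measure F M = measure_of UNIV (sets borel) (\<lambda>B. Lim F (\<lambda>t. emeasure (M t) B))"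


section \<open>Einstein flows\<close>

definition constraint_equations ::
    "('a, 'n::finite) atlas \<Rightarrow> ('a, 'n) tensor2 \<Rightarrow> ('a, 'n) tensor2 \<Rightarrow> bool" where
  "constraint_equations A h K \<longleftrightarrow> (\<forall>c\<in>A. \<forall>p\<in>chart_dom c.
     metric_trace h (ricci h) c p - metric_norm_sq h (trace_free_part h K) c p
       + (1 - 1 / real CARD('n)) * (metric_trace h K c p)\<^sup>2 = 0 \<and>
     (\<forall>j. divergence h K c j p - partial_deriv c j (metric_trace h K c) p = 0))"

text \<open>The time derivatives are taken within \<open>I\<close>, hence one-sided at an endpoint of \<open>I\<close>.\<close>

definition evolution_equations ::
    "('a, 'n::finite) atlas \<Rightarrow> real set \<Rightarrow> (real \<Rightarrow> 'a \<Rightarrow> real) \<Rightarrow>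
      (real \<Rightarrow> ('a, 'n) tensor2) \<Rightarrow> (real \<Rightarrow> ('a, 'n) tensor2) \<Rightarrow> bool" where
  "evolution_equations A I L h K \<longleftrightarrow> (\<forall>t\<in>I. \<forall>c\<in>A. \<forall>p\<in>chart_dom c. \<forall>i j.
     ((\<lambda>\<tau>. h \<tau> c p $ i $ j) has_real_derivative - 2 * L t p * K t c p $ i $ j) (at t within I) \<and>
     ((\<lambda>\<tau>. K \<tau> c p $ i $ j) has_real_derivative
        L t p * metric_trace (h t) (K t) c p * K t c p $ i $ j
        - 2 * L t p * (\<Sum>k\<in>UNIV. \<Sum>l\<in>UNIV.
            matrix_inv (h t c p) $ k $ l * K t c p $ i $ k * K t c p $ l $ j)
        - hessian (h t) (L t) c p $ i $ j
        + L t p * ricci (h t) c p $ i $ j) (at t within I))"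

definition einstein_flow ::
    "('a, 'n::finite) atlas \<Rightarrow> real set \<Rightarrow> (real \<Rightarrow> 'a \<Rightarrow> real) \<Rightarrow>
      (real \<Rightarrow> ('a, 'n) tensor2) \<Rightarrow> (real \<Rightarrow> ('a, 'n) tensor2) \<Rightarrow> bool" where
  "einstein_flow A I L h K \<longleftrightarrow>
     smooth_family_fun A I L \<and> (\<forall>t\<in>I. \<forall>p. L t p > 0) \<and>
     smooth_family_tensor A I h \<and> (\<forall>t\<in>I. riemannian_metric A (h t)) \<and>
     smooth_family_tensor A I K \<and> (\<forall>t\<in>I. symmetric_tensor_field A (K t)) \<and>
     (\<forall>t\<in>I. constraint_equations A (h t) (K t)) \<and>
     evolution_equations A I L h K"

definition CMC ::
    "('a, 'n::finite) atlas \<Rightarrow> real set \<Rightarrow>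
      (real \<Rightarrow> ('a, 'n) tensor2) \<Rightarrow> (real \<Rightarrow> ('a, 'n) tensor2) \<Rightarrow> bool" where
  "CMC A I h K \<longleftrightarrow>
     (\<forall>t\<in>I. \<forall>p q. mean_curvature A (h t) (K t) p = mean_curvature A (h t) (K t) q)"

text \<open>Meant for CMC flows, where pointwise divergence of the mean curvature is uniform divergence.\<close>

definition crushing_singularity ::
    "('a, 'n::finite) atlas \<Rightarrow> real set \<Rightarrow>
      (real \<Rightarrow> ('a, 'n) tensor2) \<Rightarrow> (real \<Rightarrow> ('a, 'n) tensor2) \<Rightarrow> bool" where
  "crushing_singularity A I h K \<longleftrightarrow> (\<forall>p.
     (\<forall>t\<in>I. mean_curvature A (h t) (K t) p < 0) \<and>
     strict_mono_on I (\<lambda>t. mean_curvature A (h t) (K t) p) \<and>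
     filterlim (\<lambda>t. mean_curvature A (h t) (K t) p) at_bot (at_right 0))"

definition hubble_time ::
    "('a, 'n::finite) atlas \<Rightarrow> real set \<Rightarrow>
      (real \<Rightarrow> ('a, 'n) tensor2) \<Rightarrow> (real \<Rightarrow> ('a, 'n) tensor2) \<Rightarrow> bool" where
  "hubble_time A I h K \<longleftrightarrow>
     (\<forall>t\<in>I. \<forall>p. t = - real CARD('n) / mean_curvature A (h t) (K t) p)"

definition dvol_0 ::
    "('a::topological_space, 'n::finite) atlas \<Rightarrow> (real \<Rightarrow> ('a, 'n) tensor2) \<Rightarrow> 'a measure" where
  "dvol_0 A h = limit_measure (at_right 0) (\<lambda>t. scale_measure (ennreal (1 / t)) (dvol A (h t)))"


section \<open>Rescaling and convergence\<close>

definition rescaled_lapse :: "(real \<Rightarrow> 'a \<Rightarrow> real) \<Rightarrow> real \<Rightarrow> real \<Rightarrow> 'a \<Rightarrow> real" where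
  "rescaled_lapse L s u = L (s * u)"

definition rescaled_metric ::
    "(real \<Rightarrow> ('a, 'n) tensor2) \<Rightarrow> real \<Rightarrow> real \<Rightarrow> ('a, 'n::finite) tensor2" where
  "rescaled_metric h s u = (\<lambda>c p. (1 / s\<^sup>2) *\<^sub>R h (s * u) c p)"

definition rescaled_second_form ::
    "(real \<Rightarrow> ('a, 'n) tensor2) \<Rightarrow> real \<Rightarrow> real \<Rightarrow> ('a, 'n::finite) tensor2" where
  "rescaled_second_form K s u = (\<lambda>c p. (1 / s) *\<^sub>R K (s * u) c p)"

definition tendsto_zero_L1 :: "'b measure \<Rightarrow> 'c filter \<Rightarrow> ('c \<Rightarrow> 'b \<Rightarrow> real) \<Rightarrow> bool" where
  "tendsto_zero_L1 M F f \<longleftrightarrow> (\<forall>\<^sub>F s in F. integrable M (f s)) \<and>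
     ((\<lambda>s. \<integral>z. \<bar>f s z\<bar> \<partial>M) \<longlongrightarrow> 0) F"

end

theory Submission
  imports Defs
begin

text \<open>Put \<open>\<mu>\<^sub>t = t\<^sup>-\<^sup>1 dvol\<^bsub>h(t)\<^esub>\<close>. The time derivative of the trace of \<open>K\<close> and the Hamiltonian constraint
  give the lapse equation \<open>\<Delta>L = L (9/t\<^sup>2 + R) - 3/t\<^sup>2\<close>. Since \<open>R \<le> 0\<close>, the maximum principle yields
  \<open>L \<ge> 1/3\<close>, so that \<open>\<partial>\<^sub>t \<mu>\<^sub>t = ((3L - 1)/t) \<mu>\<^sub>t\<close> is nonnegative and \<open>dvol\<^sub>0 \<le> \<mu>\<^sub>t\<close>. In the rescaled
  time \<open>t = s u\<close>, the integral of \<open>((3 L\<^sub>s - 1)/u) d\<mu>\<^bsub>su\<^esub> du\<close> over \<open>[\<Lambda>\<^sup>-\<^sup>1, \<Lambda>] \<times> X\<close> is the increment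
  \<open>\<mu>\<^bsub>s\<Lambda>\<^esub>(X) - \<mu>\<^bsub>s/\<Lambda>\<^esub>(X)\<close>, which tends to zero with \<open>s\<close> because the total volume \<open>\<mu>\<^sub>t(X)\<close> is finite
  and monotone. This bounds the first integral. Integrating the lapse equation over \<open>X\<close> removes
  \<open>\<Delta>L\<close> and bounds the integral of \<open>|R| \<le> 3 L |R|\<close> by that of \<open>9 (3L - 1)/t\<^sup>2\<close>, which is the same quantity
  after rescaling; finally \<open>|K\<^sub>s|\<^sup>2 - 9/u\<^sup>2 = R\<^sub>s\<close> by the Hamiltonian constraint.\<close>

section \<open>Partial derivatives\<close>

text \<open>The volume identity and the integrated lapse equation concern the slice measure at time
  \<open>s * u\<close>, while the claim concerns \<open>dvol_0\<close>. Every estimate is therefore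
  made against \<open>norm_vol (s * u)\<close>, and \<open>dvol_0\<close> is compared with it slice
  by slice. That comparison also covers the zero measure, the default of \<open>measure_of\<close>.
  The number 1/3 is the constant solution of the lapse equation for R = 0; for it the volume grows
  exactly like t. All three integrands are controlled by a constant times
  \<open>(3 * L (s * u) p - 1) / u\<close>: \<Lambda> for the lapse, 9 \<Lambda> for both curvature
  quantities. The bulk of the work is integration on a space known only through charts: the
  Riemannian measure is assembled from chart pieces, and a C1 partition of unity shows that
  Laplacians integrate to zero. Chart independence of Ricci tensor and Hessian is not proved as
  such: scalar curvature and Laplacian of the lapse are identified across charts through the
  Hamiltonian constraint and the lapse equation. Most statements on the flow use times in
  \<open>{0<..<t0}\<close>, where time derivatives are two-sided and products with chart domains are
  open.\<close>

lemma frechet_derivative_cong_ev: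
  assumes "\<forall>\<^sub>F y in nhds x. f y = g y"
  shows "frechet_derivative f (at x) = frechet_derivative g (at x)"
proof -
  obtain S where S: "open S" "x \<in> S" "\<And>y. y \<in> S \<Longrightarrow> f y = g y"
    using assms unfolding eventually_nhds by auto
  \<comment> \<open>\<open>frechet_derivative\<close> is a choice among the derivatives at a point;
    equal sets of derivatives give equal choices, also where these sets are empty.\<close>
  have "(f has_derivative D) (at x) \<longleftrightarrow> (g has_derivative D) (at x)" for D
    using has_derivative_transform_within_open[of f D x UNIV S g]
      has_derivative_transform_within_open[of g D x UNIV S f] S by auto
  then show ?thesis unfolding frechet_derivative_def by simp
qed

lemma differentiable_cong_ev:
  assumes "\<forall>\<^sub>F y in nhds x. f y = g y" "f differentiable (at x)"
  shows "g differentiable (at x)"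
proof -
  obtain S where S: "open S" "x \<in> S" "\<And>y. y \<in> S \<Longrightarrow> f y = g y"
    using assms unfolding eventually_nhds by auto
  show ?thesis
    using assms(2) S has_derivative_transform_within_open[of f _ x UNIV S g]
    unfolding differentiable_def by blast
qed

lemma eventually_nhds_in_openI: "open S \<Longrightarrow> x \<in> S \<Longrightarrow> (\<And>y. y \<in> S \<Longrightarrow> P y) \<Longrightarrow> \<forall>\<^sub>F y in nhds x. P y"
  by (auto simp: eventually_nhds)

section \<open>Locality, restriction and slices of \<open>C_k\<close> maps\<close>

lemma C_k_cong:
  assumes "open S" "\<And>x. x \<in> S \<Longrightarrow> f x = g x" "C_k k f S"
  shows "C_k k g S"
  using assms(2,3)
proof (induction k arbitrary: f g)
  case 0
  then show ?case using continuous_on_eq by auto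
next
  case (Suc k)
  have ev: "\<forall>\<^sub>F y in nhds x. f y = g y" if "x \<in> S" for x
    using that assms(1) Suc.prems by (intro eventually_nhds_in_openI) auto
  have "C_k k (\<lambda>x. frechet_derivative g (at x) b) S" if "b \<in> Basis" for b
  proof (rule Suc.IH)
    show "C_k k (\<lambda>x. frechet_derivative f (at x) b) S" using Suc.prems(2) that by simp
    show "frechet_derivative f (at x) b = frechet_derivative g (at x) b" if "x \<in> S" for x
      using frechet_derivative_cong_ev[OF ev[OF that]] by simp
  qed
  moreover have "g differentiable (at x)" if "x \<in> S" for x
    using differentiable_cong_ev[OF ev[OF that]] Suc.prems(2) that by simp
  ultimately show ?case by simp
qed

lemma C_k_local:
  assumes "\<And>x. x \<in> S \<Longrightarrow> \<exists>U. open U \<and> x \<in> U \<and> U \<subseteq> S \<and> C_k k f U"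
  shows "C_k k f S"
  using assms
proof (induction k arbitrary: f)
  case 0
  show ?case
  proof (clarsimp simp: continuous_on_eq_continuous_within)
    fix x assume "x \<in> S"
    then obtain U where "open U" "x \<in> U" "U \<subseteq> S" "C_k 0 f U" using 0 by blast
    then have "continuous (at x) f" by (auto simp: continuous_on_eq_continuous_at)
    then show "continuous (at x within S) f" by (rule continuous_at_imp_continuous_at_within)
  qed
next
  case (Suc k)
  have "C_k k (\<lambda>x. frechet_derivative f (at x) b) S" if "b \<in> Basis" for b
  proof (rule Suc.IH)
    fix x assume "x \<in> S"
    then obtain U where "open U" "x \<in> U" "U \<subseteq> S" "C_k (Suc k) f U" using Suc.prems by blast
    then show "\<exists>U. open U \<and> x \<in> U \<and> U \<subseteq> S \<and> C_k k (\<lambda>x. frechet_derivative f (at x) b) U"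
      using that by (intro exI[of _ U]) simp
  qed
  moreover have "f differentiable (at x)" if "x \<in> S" for x
    using Suc.prems[OF that] by auto
  ultimately show ?case by simp
qed

lemma C_k_subset: "C_k k f S \<Longrightarrow> T \<subseteq> S \<Longrightarrow> C_k k f T"
  by (induction k arbitrary: f) (auto intro: continuous_on_subset)

text \<open>The extension in \<open>smooth_on\<close> varies with the point; near each point of an
  open \<open>S\<close> it coincides with \<open>f\<close>, and \<open>C_k_local\<close> glues the
  pieces.\<close>

lemma smooth_on_open_imp_C_k:
  assumes "smooth_on S f" "open S"
  shows "C_k k f S"
proof (rule C_k_local)
  fix x assume "x \<in> S"
  then obtain U g where U: "open U" "x \<in> U" "C_k k g U" "\<And>y. y \<in> S \<inter> U \<Longrightarrow> g y = f y"
    using assms(1) unfolding smooth_on_def by meson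
  have "C_k k g (S \<inter> U)" using U(3) C_k_subset by blast
  then have "C_k k f (S \<inter> U)" by (rule C_k_cong[rotated 2]) (use U assms in auto)
  then show "\<exists>U. open U \<and> x \<in> U \<and> U \<subseteq> S \<and> C_k k f U"
    using U \<open>x \<in> S\<close> assms(2) by (intro exI[of _ "S \<inter> U"]) auto
qed

lemma smooth_on_imp_continuous_on:
  assumes "smooth_on S f"
  shows "continuous_on S f"
proof (clarsimp simp: continuous_on_eq_continuous_within)
  fix x assume "x \<in> S"
  then obtain U g where U: "open U" "x \<in> U" "C_k 0 g U" "\<And>y. y \<in> S \<inter> U \<Longrightarrow> g y = f y"
    using assms unfolding smooth_on_def by meson
  have "continuous (at x) g" using U by (simp add: continuous_on_eq_continuous_at)
  then have "continuous (at x within S) g" by (rule continuous_at_imp_continuous_at_within)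
  then have "(g \<longlongrightarrow> f x) (at x within S)"
    unfolding continuous_within using U \<open>x \<in> S\<close> by auto
  moreover have "\<forall>\<^sub>F y in at x within S. g y = f y"
    using U unfolding eventually_at_topological by blast
  ultimately show "continuous (at x within S) f"
    unfolding continuous_within using tendsto_cong by force
qed

text \<open>The derivative of the slice along \<open>b\<close> is the derivative of \<open>g\<close>
  along \<open>(0, b)\<close>, which is again a basis vector of the product, so the induction on
  \<open>k\<close> closes.\<close>

lemma C_k_slice:
  assumes "open U" "C_k k g U"
  shows "C_k k (\<lambda>y. g (t, y)) {y. (t, y) \<in> U}"
  using assms(2)
proof (induction k arbitrary: g)
  case 0
  then show ?case
    by (auto intro!: continuous_on_compose2[of U g] continuous_intros)
next
  case (Suc k)
  have op_slice: "open {y. (t, y) \<in> U}"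
    using continuous_open_vimage[of U "\<lambda>y. (t, y)"] assms(1)
    by (simp add: vimage_def continuous_on_Pair continuous_intros)
  have hd: "((\<lambda>y. g (t, y)) has_derivative (\<lambda>v. frechet_derivative g (at (t, y)) (0, v))) (at y)"
    if "(t, y) \<in> U" for y
  proof -
    have "(g has_derivative frechet_derivative g (at (t, y))) (at (t, y))"
      using Suc.prems that frechet_derivative_works by auto
    moreover have "((\<lambda>y. (t, y)) has_derivative (\<lambda>v. (0, v))) (at y)"
      by (auto intro!: derivative_eq_intros)
    ultimately show ?thesis
      using diff_chain_at[of "\<lambda>y. (t, y)" "\<lambda>v. (0, v)" y g] by (simp add: o_def)
  qed
  have op: "C_k k (\<lambda>y. frechet_derivative (\<lambda>y. g (t, y)) (at y) b) {y. (t, y) \<in> U}"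
    if "b \<in> Basis" for b
  proof -
    have "(0, b) \<in> Basis" using that by (auto simp: Basis_prod_def)
    then have *: "C_k k (\<lambda>x. frechet_derivative g (at x) (0, b)) U" using Suc.prems by auto
    have "C_k k (\<lambda>y. frechet_derivative g (at (t, y)) (0, b)) {y. (t, y) \<in> U}"
      using Suc.IH[OF *] .
    moreover have "frechet_derivative g (at (t, y)) (0, b) = frechet_derivative (\<lambda>y. g (t, y)) (at y) b"
      if "y \<in> {y. (t, y) \<in> U}" for y using frechet_derivative_at[OF hd[of y]] that by (metis mem_Collect_eq)
    ultimately show ?thesis
      by (rule C_k_cong[OF op_slice, rotated])
  qed
  moreover have "(\<lambda>y. g (t, y)) differentiable (at y)" if "(t, y) \<in> U" for y
    using hd[OF that] by (rule differentiableI)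
  ultimately show ?case by simp
qed

section \<open>Coordinate partial derivatives and rules for C1 functions\<close>

declare C_k.simps [simp del]

text \<open>Counterpart of \<open>partial_deriv\<close> for functions of the coordinates. All
  calculus is done with \<open>pd\<close> and carried to the manifold by
  \<open>partial_deriv_eq_pd\<close>.\<close>

definition pd :: "'n \<Rightarrow> (real^'n \<Rightarrow> real) \<Rightarrow> real^'n::finite \<Rightarrow> real" where
  "pd i f y = frechet_derivative f (at y) (axis i 1)"

lemma partial_deriv_eq_pd: "partial_deriv c i f p = pd i (f \<circ> param c) (coords c p)"
  by (simp add: partial_deriv_def pd_def)

lemma pd_cong_ev: "\<forall>\<^sub>F y in nhds x. f y = g y \<Longrightarrow> pd i f x = pd i g x"
  unfolding pd_def by (simp add: frechet_derivative_cong_ev)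

lemma pd_eqI: "(f has_derivative D) (at x) \<Longrightarrow> pd i f x = D (axis i 1)"
  unfolding pd_def using frechet_derivative_at by metis

lemma has_derivative_pd:
  fixes f :: "real^'n::finite \<Rightarrow> real"
  assumes "f differentiable (at x)"
  shows "(f has_derivative (\<lambda>v. \<Sum>i\<in>UNIV. v $ i * pd i f x)) (at x)"
proof -
  have d: "(f has_derivative frechet_derivative f (at x)) (at x)"
    using assms frechet_derivative_works by auto
  then have lin: "linear (frechet_derivative f (at x))" by (rule has_derivative_linear)
  have "frechet_derivative f (at x) v = (\<Sum>i\<in>UNIV. v $ i * pd i f x)" for v
  proof -
    have "v = (\<Sum>i\<in>UNIV. v $ i *\<^sub>R axis i 1)"
      by (simp add: vec_eq_iff axis_def if_distrib sum.delta cong: if_cong)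
    then have "frechet_derivative f (at x) v
        = (\<Sum>i\<in>UNIV. frechet_derivative f (at x) (v $ i *\<^sub>R axis i 1))"
      using linear_sum[OF lin] by metis
    then show ?thesis by (simp add: pd_def linear_cmul[OF lin])
  qed
  then show ?thesis using d by presburger
qed

lemma pd_const [simp]: "pd i (\<lambda>y. c) x = 0"
  by (simp add: pd_def)

lemma pd_mult:
  assumes "f differentiable (at x)" "g differentiable (at x)"
  shows "pd i (\<lambda>y. f y * g y) x = pd i f x * g x + f x * pd i g x"
  using pd_eqI[OF has_derivative_mult[OF assms[unfolded frechet_derivative_works]]]
  by (simp add: pd_def)

lemma pd_sum:
  assumes "\<And>j. j \<in> J \<Longrightarrow> f j differentiable (at x)"
  shows "pd i (\<lambda>y. \<Sum>j\<in>J. f j y) x = (\<Sum>j\<in>J. pd i (f j) x)"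
proof -
  have "((\<lambda>y. \<Sum>j\<in>J. f j y) has_derivative (\<lambda>v. \<Sum>j\<in>J. frechet_derivative (f j) (at x) v)) (at x)"
    using assms by (intro has_derivative_sum) (simp add: frechet_derivative_works[symmetric])
  from pd_eqI[OF this] show ?thesis by (simp add: pd_def)
qed

lemma pd_divide:
  assumes "f differentiable (at x)" "g differentiable (at x)" "g x \<noteq> 0"
  shows "pd i (\<lambda>y. f y / g y) x = (pd i f x * g x - f x * pd i g x) / (g x * g x)"
  using pd_eqI[OF has_derivative_divide'[OF assms(1,2)[unfolded frechet_derivative_works] assms(3)]]
  by (simp add: pd_def)

lemma Basis_cart_real: "(Basis :: (real^'n::finite) set) = range (\<lambda>i. axis i 1)"
  by (auto simp: Basis_vec_def)

lemma C_k_Suc_pd: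
  "C_k (Suc k) f S \<longleftrightarrow> (\<forall>x\<in>S. f differentiable (at x)) \<and> (\<forall>i. C_k k (pd i f) S)"
  by (auto simp: C_k.simps Basis_cart_real pd_def[abs_def])

lemma C_k_imp_continuous_on: "C_k k f S \<Longrightarrow> continuous_on S f"
  by (cases k) (auto simp: C_k.simps intro!: continuous_at_imp_continuous_on differentiable_imp_continuous_within)

lemma C1_D:
  assumes "C_k (Suc 0) f S"
  shows "x \<in> S \<Longrightarrow> f differentiable (at x)" "continuous_on S (pd i f)" "continuous_on S f"
  using assms C_k_imp_continuous_on[OF assms] unfolding C_k_Suc_pd by (auto simp: C_k.simps)

lemma C1_const: "C_k (Suc 0) (\<lambda>y::real^'n::finite. c::real) S"
  by (auto simp: C_k_Suc_pd C_k.simps)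

lemma C1_mult:
  fixes f g :: "real^'n::finite \<Rightarrow> real"
  assumes "C_k (Suc 0) f S" "C_k (Suc 0) g S"
  shows "C_k (Suc 0) (\<lambda>y. f y * g y) S"
proof -
  note [continuous_intros] = C1_D[OF assms(1)] C1_D[OF assms(2)]
  have "continuous_on S (\<lambda>x. pd i f x * g x + f x * pd i g x)" for i
    by (intro continuous_intros)
  then have "continuous_on S (pd i (\<lambda>y. f y * g y))" for i
    by (rule continuous_on_eq) (simp add: pd_mult C1_D(1)[OF assms(1)] C1_D(1)[OF assms(2)])
  then show ?thesis
    using assms by (simp add: C_k_Suc_pd C_k.simps differentiable_mult)
qed

lemma C1_sum:
  fixes f :: "'j \<Rightarrow> real^'n::finite \<Rightarrow> real"
  assumes "finite J" "\<And>j. j \<in> J \<Longrightarrow> C_k (Suc 0) (f j) S"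
  shows "C_k (Suc 0) (\<lambda>y. \<Sum>j\<in>J. f j y) S"
proof -
  have "continuous_on S (\<lambda>x. \<Sum>j\<in>J. pd i (f j) x)" for i
    by (intro continuous_on_sum C1_D(2)[OF assms(2)])
  then have "continuous_on S (pd i (\<lambda>y. \<Sum>j\<in>J. f j y))" for i
    by (rule continuous_on_eq) (simp add: pd_sum C1_D(1)[OF assms(2)])
  then show ?thesis
    using assms C1_D(1)[OF assms(2)] by (simp add: C_k_Suc_pd C_k.simps differentiable_sum)
qed

lemma C1_divide:
  fixes f g :: "real^'n::finite \<Rightarrow> real"
  assumes "C_k (Suc 0) f S" "C_k (Suc 0) g S" "\<And>x. x \<in> S \<Longrightarrow> g x \<noteq> 0"
  shows "C_k (Suc 0) (\<lambda>y. f y / g y) S"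
proof -
  note [continuous_intros] = C1_D[OF assms(1)] C1_D[OF assms(2)]
  have "continuous_on S (\<lambda>x. (pd i f x * g x - f x * pd i g x) / (g x * g x))" for i
    by (intro continuous_intros) (use assms(3) in auto)
  then have "continuous_on S (pd i (\<lambda>y. f y / g y))" for i
    by (rule continuous_on_eq)
      (simp add: pd_divide C1_D(1)[OF assms(1)] C1_D(1)[OF assms(2)] assms(3))
  then show ?thesis
    using assms by (simp add: C_k_Suc_pd C_k.simps differentiable_divide)
qed

lemma C1_component:
  fixes f :: "real^'n::finite \<Rightarrow> 'b::euclidean_space"
  assumes "C_k (Suc 0) f S" "bounded_linear l"
  shows "C_k (Suc 0) (\<lambda>y. l (f y) :: real) S"
proof -
  have d: "((\<lambda>y. l (f y)) has_derivative (\<lambda>v. l (frechet_derivative f (at x) v))) (at x)"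
    if "x \<in> S" for x
    using assms that by (intro bounded_linear.has_derivative[OF assms(2)])
      (simp add: frechet_derivative_works C_k.simps)
  have "continuous_on S (\<lambda>x. l (frechet_derivative f (at x) (axis i 1)))" for i
    using assms by (intro bounded_linear.continuous_on[OF assms(2)]) (simp add: C_k.simps Basis_cart_real)
  then have "continuous_on S (pd i (\<lambda>y. l (f y)))" for i
    by (rule continuous_on_eq) (simp add: pd_eqI[OF d])
  moreover have "(\<lambda>y. l (f y)) differentiable (at x)" if "x \<in> S" for x
    using d[OF that] by (rule differentiableI)
  ultimately show ?thesis by (simp add: C_k_Suc_pd C_k.simps)
qed

section \<open>Determinants and inverses of matrices depending on a parameter\<close>

lemma matrix_inv_works:
  fixes M :: "real^'n::finite^'n"
  assumes "det M \<noteq> 0"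
  shows "M ** matrix_inv M = mat 1" "matrix_inv M ** M = mat 1"
proof -
  have "\<exists>N. M ** N = mat 1 \<and> N ** M = mat 1"
    using assms invertible_det_nz unfolding invertible_def by blast
  from someI_ex[OF this] show "M ** matrix_inv M = mat 1" "matrix_inv M ** M = mat 1"
    unfolding matrix_inv_def by auto
qed

lemma matrix_inv_unique:
  fixes M N :: "real^'n::finite^'n"
  assumes "M ** N = mat 1"
  shows "matrix_inv M = N"
proof -
  have "det M * det N = 1" using assms det_mul[of M N] by simp
  then have "det M \<noteq> 0" by auto
  from matrix_inv_works(2)[OF this] have "matrix_inv M ** M ** N = N" by simp
  then show ?thesis using assms by (simp flip: matrix_mul_assoc)
qed

lemma matrix_diff_ldistrib: "A ** (B - C) = A ** B - A ** (C :: real^'n^'m)"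
  by (vector matrix_matrix_mult_def sum_subtractf[symmetric] right_diff_distrib)

lemma matrix_diff_rdistrib: "(B - C) ** A = B ** A - C ** (A :: real^'n^'m)"
  by (vector matrix_matrix_mult_def sum_subtractf[symmetric] left_diff_distrib)

text \<open>Jacobi's formula. Differentiating the Leibniz expansion replaces one row at a time by
  its derivative, and Cramer's rule evaluates each of the resulting determinants.\<close>

lemma has_derivative_det:
  fixes m :: "'b::real_normed_vector \<Rightarrow> real^'n::finite^'n"
  assumes D: "\<And>i j. ((\<lambda>x. m x $ i $ j) has_derivative D i j) (at x within S)"
    and nz: "det (m x) \<noteq> 0"
  shows "((\<lambda>x. det (m x)) has_derivative
    (\<lambda>v. det (m x) * (\<Sum>i\<in>UNIV. \<Sum>j\<in>UNIV. matrix_inv (m x) $ j $ i * D i j v))) (at x within S)"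
proof -
  let ?M = "matrix_inv (m x)"
  let ?P = "{p. p permutes (UNIV :: 'n set)}"
  have inv: "?M ** m x = mat 1" by (rule matrix_inv_works(2)[OF nz])
  have row: "det (\<chi> i. if i = k then (\<chi> j. D k j v) else m x $ i)
      = (\<Sum>j\<in>UNIV. D k j v * ?M $ j $ k) * det (m x)" for k v
  proof -
    \<comment> \<open>\<open>w\<close> holds the coefficients of the differentiated row in the basis
      formed by the rows of \<open>m x\<close>; Cramer's rule picks out the
      \<open>k\<close>-th.\<close>
    define w where "w = (\<chi> j. D k j v) v* ?M"
    have "(\<Sum>i\<in>UNIV. w $ i *s row i (m x)) = w v* m x"
      by (simp add: vec_eq_iff vector_matrix_mult_def row_def mult.commute)
    also have "\<dots> = (\<chi> j. D k j v)"
      by (simp add: w_def vector_matrix_mul_assoc inv)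
    finally have eq: "(\<Sum>i\<in>UNIV. w $ i *s row i (m x)) = (\<chi> j. D k j v)" .
    have "row i (m x) = m x $ i" for i by (simp add: row_def)
    then have "det (\<chi> i. if i = k then (\<chi> j. D k j v) else m x $ i) = w $ k * det (m x)"
      using cramer_lemma_transpose[of k w "m x", unfolded eq] by presburger
    then show ?thesis by (simp add: w_def vector_matrix_mult_def mult.commute)
  qed
  have "((\<lambda>x. \<Sum>p\<in>?P. of_int (sign p) * (\<Prod>i\<in>UNIV. m x $ i $ p i)) has_derivative
      (\<lambda>v. \<Sum>p\<in>?P. of_int (sign p) *
        (\<Sum>k\<in>UNIV. D k (p k) v * (\<Prod>i\<in>UNIV - {k}. m x $ i $ p i)))) (at x within S)"
    by (intro has_derivative_sum has_derivative_mult_right has_derivative_prod D)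
  moreover have "(\<Sum>p\<in>?P. of_int (sign p) *
        (\<Sum>k\<in>UNIV. D k (p k) v * (\<Prod>i\<in>UNIV - {k}. m x $ i $ p i)))
      = (\<Sum>k\<in>UNIV. det (\<chi> i. if i = k then (\<chi> j. D k j v) else m x $ i))" for v
  proof -
    have "(\<Prod>i\<in>UNIV. (\<chi> i. if i = k then (\<chi> j. D k j v) else m x $ i) $ i $ p i)
        = D k (p k) v * (\<Prod>i\<in>UNIV - {k}. m x $ i $ p i)" for k and p :: "'n \<Rightarrow> 'n"
      by (subst prod.remove[of UNIV k]) (auto intro!: prod.cong)
    then have "det (\<chi> i. if i = k then (\<chi> j. D k j v) else m x $ i) =
        (\<Sum>p\<in>?P. of_int (sign p) * (D k (p k) v * (\<Prod>i\<in>UNIV - {k}. m x $ i $ p i)))" for k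
      unfolding det_def by presburger
    then show ?thesis
      by (simp add: sum_distrib_left) (rule sum.swap)
  qed
  moreover have "(\<Sum>k\<in>UNIV. det (\<chi> i. if i = k then (\<chi> j. D k j v) else m x $ i))
      = det (m x) * (\<Sum>i\<in>UNIV. \<Sum>j\<in>UNIV. ?M $ j $ i * D i j v)" for v
    by (simp add: row sum_distrib_left mult_ac)
  moreover have "(\<lambda>x. det (m x)) = (\<lambda>x. \<Sum>p\<in>?P. of_int (sign p) * (\<Prod>i\<in>UNIV. m x $ i $ p i))"
    by (simp add: det_def)
  ultimately show ?thesis by (simp only:)
qed

text \<open>Quotients of determinants turn continuity and C1 dependence of the inverse on its
  entries into statements about polynomials.\<close>

lemma matrix_inv_cramer:
  fixes M :: "real^'n::finite^'n"
  assumes "det M \<noteq> 0"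
  shows "matrix_inv M $ k $ l = det (\<chi> i j. if j = k then axis l 1 $ i else M $ i $ j) / det M"
proof -
  have "M ** matrix_inv M = mat 1" by (rule matrix_inv_works(1)[OF assms])
  then have "M *v (matrix_inv M *v axis l 1) = axis l 1"
    by (simp add: matrix_vector_mul_assoc)
  then have "matrix_inv M *v axis l 1
      = (\<chi> k. det (\<chi> i j. if j = k then axis l 1 $ i else M $ i $ j) / det M)"
    using cramer[OF assms] by blast
  then have "(matrix_inv M *v axis l 1) $ k
      = det (\<chi> i j. if j = k then axis l 1 $ i else M $ i $ j) / det M"
    by (simp only: vec_lambda_beta)
  then show ?thesis by (simp add: matrix_vector_mult_basis column_def)
qed

lemma tendsto_det:
  fixes m :: "'b \<Rightarrow> real^'n::finite^'n"
  assumes "\<And>i j. ((\<lambda>x. m x $ i $ j) \<longlongrightarrow> a $ i $ j) F"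
  shows "((\<lambda>x. det (m x)) \<longlongrightarrow> det a) F"
  unfolding det_def by (intro tendsto_intros assms)

lemma tendsto_matrix_inv:
  fixes m :: "'b \<Rightarrow> real^'n::finite^'n"
  assumes m: "\<And>i j. ((\<lambda>x. m x $ i $ j) \<longlongrightarrow> a $ i $ j) F" and nz: "det a \<noteq> 0"
  shows "((\<lambda>x. matrix_inv (m x) $ k $ l) \<longlongrightarrow> matrix_inv a $ k $ l) F"
proof -
  have d: "((\<lambda>x. det (m x)) \<longlongrightarrow> det a) F" by (rule tendsto_det[OF m])
  then have ev: "\<forall>\<^sub>F x in F. det (m x) \<noteq> 0" using nz tendsto_imp_eventually_ne by blast
  have "((\<lambda>x. det (\<chi> i j. if j = k then axis l 1 $ i else m x $ i $ j) / det (m x)) \<longlongrightarrow>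
     det (\<chi> i j. if j = k then axis l 1 $ i else a $ i $ j) / det a) F"
    by (intro tendsto_divide d nz tendsto_det) (auto intro: m)
  moreover have "\<forall>\<^sub>F x in F. det (\<chi> i j. if j = k then axis l 1 $ i else m x $ i $ j) / det (m x)
      = matrix_inv (m x) $ k $ l"
    using ev by eventually_elim (simp add: matrix_inv_cramer)
  ultimately show ?thesis
    using tendsto_cong matrix_inv_cramer[OF nz] by force
qed

lemma continuous_on_det:
  fixes m :: "'b::topological_space \<Rightarrow> real^'n::finite^'n"
  assumes "\<And>i j. continuous_on S (\<lambda>x. m x $ i $ j)"
  shows "continuous_on S (\<lambda>x. det (m x))"
  using assms unfolding continuous_on_def by (auto intro: tendsto_det)

lemma continuous_on_matrix_inv:
  fixes m :: "'b::topological_space \<Rightarrow> real^'n::finite^'n"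
  assumes "\<And>i j. continuous_on S (\<lambda>x. m x $ i $ j)" "\<And>x. x \<in> S \<Longrightarrow> det (m x) \<noteq> 0"
  shows "continuous_on S (\<lambda>x. matrix_inv (m x) $ k $ l)"
  using assms unfolding continuous_on_def by (auto intro: tendsto_matrix_inv)

text \<open>A product rule in which \<open>c\<close> is merely continuous at \<open>x\<close>. Split
  \<open>c y * g y\<close> as \<open>c x * g y + (c y - c x) * g y\<close>: the second term is o(|y
  - x|), since \<open>g\<close> vanishes at \<open>x\<close> and grows at most linearly
  there.\<close>

lemma has_derivative_mult_vanishing:
  fixes c g :: "'b::real_normed_vector \<Rightarrow> real"
  assumes c: "(c \<longlongrightarrow> c x) (at x within S)" and g: "(g has_derivative D) (at x within S)" and "g x = 0"
  shows "((\<lambda>y. c y * g y) has_derivative (\<lambda>v. c x * D v)) (at x within S)"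
proof -
  have "((\<lambda>y. c x * g y) has_derivative (\<lambda>v. c x * D v)) (at x within S)"
    by (intro has_derivative_mult_right g)
  moreover have "((\<lambda>y. (c y - c x) * g y) has_derivative (\<lambda>v. 0)) (at x within S)"
  proof -
    have bl: "bounded_linear D" using g has_derivative_bounded_linear by blast
    obtain B where B: "\<And>v. norm (D v) \<le> norm v * B" using bounded_linear.bounded[OF bl] by blast
    have q: "((\<lambda>y. norm (g y - g x - D (y - x)) / norm (y - x)) \<longlongrightarrow> 0) (at x within S)"
      using g unfolding has_derivative_iff_norm by auto
    have "((\<lambda>y. \<bar>c y - c x\<bar> * (norm (g y - g x - D (y - x)) / norm (y - x) + \<bar>B\<bar>)) \<longlongrightarrow> \<bar>c x - c x\<bar> * (0 + \<bar>B\<bar>)) (at x within S)"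
      by (intro tendsto_intros c q)
    then have lim: "((\<lambda>y. \<bar>c y - c x\<bar> * (norm (g y - g x - D (y - x)) / norm (y - x) + \<bar>B\<bar>)) \<longlongrightarrow> 0) (at x within S)"
      by simp
    have "\<forall>\<^sub>F y in at x within S. norm (norm ((c y - c x) * g y - (c x - c x) * g x - 0) / norm (y - x))
        \<le> \<bar>c y - c x\<bar> * (norm (g y - g x - D (y - x)) / norm (y - x) + \<bar>B\<bar>)"
    proof (rule eventually_at_filter[THEN iffD2], intro always_eventually allI impI)
      fix y assume "y \<noteq> x"
      then have n: "norm (y - x) > 0" by simp
      have "\<bar>g y\<bar> \<le> norm (g y - g x - D (y - x)) + norm (D (y - x))"
        using assms(3) by simp
      also have "\<dots> \<le> norm (g y - g x - D (y - x)) + norm (y - x) * \<bar>B\<bar>"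
        using B[of "y - x"] mult_left_mono[OF abs_ge_self[of B] norm_ge_zero[of "y - x"]] by linarith
      finally have "\<bar>g y\<bar> / norm (y - x) \<le> (norm (g y - g x - D (y - x)) + norm (y - x) * \<bar>B\<bar>) / norm (y - x)"
        by (rule divide_right_mono) simp
      also have "\<dots> = norm (g y - g x - D (y - x)) / norm (y - x) + \<bar>B\<bar>"
        using n by (simp add: add_divide_distrib)
      finally have "\<bar>c y - c x\<bar> * (\<bar>g y\<bar> / norm (y - x)) \<le> \<bar>c y - c x\<bar> * (norm (g y - g x - D (y - x)) / norm (y - x) + \<bar>B\<bar>)"
        by (rule mult_left_mono) simp
      then show "norm (norm ((c y - c x) * g y - (c x - c x) * g x - 0) / norm (y - x))
        \<le> \<bar>c y - c x\<bar> * (norm (g y - g x - D (y - x)) / norm (y - x) + \<bar>B\<bar>)"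
        by (simp add: abs_mult)
    qed
    from Lim_null_comparison[OF this lim] show ?thesis
      unfolding has_derivative_iff_norm by auto
  qed
  ultimately have "((\<lambda>y. c x * g y + (c y - c x) * g y) has_derivative (\<lambda>v. c x * D v + 0)) (at x within S)"
    by (rule has_derivative_add)
  then show ?thesis by (simp add: algebra_simps)
qed

text \<open>The resolvent identity, arranged so that the factor \<open>Y - X\<close>, which vanishes
  at the base point, stands alone between the two inverses.\<close>

lemma matrix_inv_diff:
  fixes X Y :: "real^'n::finite^'n"
  assumes "det X \<noteq> 0" "det Y \<noteq> 0"
  shows "matrix_inv Y = matrix_inv X - matrix_inv Y ** (Y - X) ** matrix_inv X"
proof -
  have "matrix_inv Y ** (Y - X) ** matrix_inv X
      = (matrix_inv Y ** Y) ** matrix_inv X - matrix_inv Y ** (X ** matrix_inv X)"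
    by (simp add: matrix_diff_ldistrib matrix_diff_rdistrib matrix_mul_assoc)
  then show ?thesis using assms by (simp add: matrix_inv_works)
qed

text \<open>In the resolvent identity the entries of \<open>m y - m x\<close> vanish at
  \<open>x\<close>, so \<open>has_derivative_mult_vanishing\<close> applies with the inverse at
  \<open>y\<close> known only to be continuous.\<close>

lemma has_derivative_matrix_inv:
  fixes m :: "'b::real_normed_vector \<Rightarrow> real^'n::finite^'n"
  assumes D: "\<And>i j. ((\<lambda>x. m x $ i $ j) has_derivative D i j) (at x within S)"
    and nz: "det (m x) \<noteq> 0" and x: "x \<in> S"
  shows "((\<lambda>x. matrix_inv (m x) $ a $ b) has_derivative
    (\<lambda>v. - (\<Sum>k\<in>UNIV. \<Sum>l\<in>UNIV. matrix_inv (m x) $ a $ k * D k l v * matrix_inv (m x) $ l $ b)))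
    (at x within S)"
proof -
  let ?X = "matrix_inv (m x)"
  have lim: "((\<lambda>x. m x $ i $ j) \<longlongrightarrow> m x $ i $ j) (at x within S)" for i j
    using has_derivative_continuous[OF D[of i j]] by (simp add: continuous_within)
  have "((\<lambda>y. (m y $ k $ l - m x $ k $ l) * ?X $ l $ b) has_derivative
      (\<lambda>v. (D k l v - 0) * ?X $ l $ b)) (at x within S)" for k l
    by (rule has_derivative_mult_left[OF has_derivative_diff[OF D has_derivative_const]])
  then have *: "((\<lambda>y. matrix_inv (m y) $ a $ k * ((m y $ k $ l - m x $ k $ l) * ?X $ l $ b)) has_derivative
      (\<lambda>v. ?X $ a $ k * ((D k l v - 0) * ?X $ l $ b))) (at x within S)" for k l
    using tendsto_matrix_inv[OF lim nz] by (intro has_derivative_mult_vanishing) auto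
  have "((\<lambda>y. ?X $ a $ b - (\<Sum>l\<in>UNIV. \<Sum>k\<in>UNIV.
        matrix_inv (m y) $ a $ k * ((m y $ k $ l - m x $ k $ l) * ?X $ l $ b))) has_derivative
      (\<lambda>v. 0 - (\<Sum>l\<in>UNIV. \<Sum>k\<in>UNIV. ?X $ a $ k * ((D k l v - 0) * ?X $ l $ b)))) (at x within S)"
    by (intro has_derivative_diff has_derivative_const has_derivative_sum *)
  moreover have "\<forall>\<^sub>F y in at x within S. ?X $ a $ b - (\<Sum>l\<in>UNIV. \<Sum>k\<in>UNIV.
        matrix_inv (m y) $ a $ k * ((m y $ k $ l - m x $ k $ l) * ?X $ l $ b)) = matrix_inv (m y) $ a $ b"
  proof -
    have "\<forall>\<^sub>F y in at x within S. det (m y) \<noteq> 0"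
      using tendsto_imp_eventually_ne[OF tendsto_det[OF lim] nz] .
    then show ?thesis
    proof eventually_elim
      case (elim y)
      from matrix_inv_diff[OF nz elim]
      have "matrix_inv (m y) $ a $ b = (?X - matrix_inv (m y) ** (m y - m x) ** ?X) $ a $ b" by simp
      then show ?case
        by (simp add: matrix_matrix_mult_def sum_distrib_right mult.assoc)
    qed
  qed
  ultimately have "((\<lambda>x. matrix_inv (m x) $ a $ b) has_derivative
      (\<lambda>v. 0 - (\<Sum>l\<in>UNIV. \<Sum>k\<in>UNIV. ?X $ a $ k * ((D k l v - 0) * ?X $ l $ b)))) (at x within S)"
    by (rule has_derivative_transform_eventually) (use x in simp_all)
  then show ?thesis
    by (simp add: mult.assoc) (subst (asm) sum.swap, simp)
qed


section \<open>Traces and congruence of bilinear forms\<close>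

lemma quadratic_form_sum: "v \<bullet> (N *v v) = (\<Sum>i\<in>UNIV. \<Sum>j\<in>UNIV. N $ i $ j * (v $ i * v $ j))"
  for N :: "real^'n::finite^'n"
  by (simp add: inner_vec_def matrix_vector_mult_def sum_distrib_left mult_ac)

lemma quadratic_form_add_axis:
  fixes N :: "real^'n::finite^'n"
  assumes "transpose N = N"
  shows "(v + t *\<^sub>R axis k 1) \<bullet> (N *v (v + t *\<^sub>R axis k 1))
    = v \<bullet> (N *v v) + 2 * t * (N *v v) $ k + t\<^sup>2 * N $ k $ k"
proof -
  have "v \<bullet> (N *v axis k 1) = (N *v v) $ k"
  proof -
    have "v \<bullet> (N *v axis k 1) = (transpose N *v v) \<bullet> axis k 1"
      by (simp add: dot_lmul_matrix vector_transpose_matrix)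
    then show ?thesis by (simp add: assms inner_axis)
  qed
  moreover have "axis k 1 \<bullet> (N *v w) = (N *v w) $ k" for w
    by (simp add: inner_axis')
  moreover have "(N *v axis k 1) $ k = N $ k $ k"
    by (simp add: matrix_vector_mult_basis column_def)
  ultimately show ?thesis
    by (simp add: matrix_vector_right_distrib matrix_vector_mult_scaleR inner_add_left inner_add_right
        power2_eq_square algebra_simps)
qed

text \<open>By splitting off the rank one matrices of a Cholesky decomposition of \<open>N\<close> one index at a time.\<close>

lemma sum_mult_psd_nonneg_aux:
  fixes N H :: "real^'n::finite^'n"
  assumes "finite S" "transpose N = N" "\<And>v. 0 \<le> v \<bullet> (N *v v)" "\<And>v. 0 \<le> v \<bullet> (H *v v)"
    and "\<And>i j. i \<notin> S \<Longrightarrow> N $ i $ j = 0"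
  shows "0 \<le> (\<Sum>i\<in>UNIV. \<Sum>j\<in>UNIV. N $ i $ j * H $ i $ j)"
  using assms(1-3,5)
proof (induction S arbitrary: N rule: finite_induct)
  case empty
  then show ?case by simp
next
  case (insert k S)
  have sym: "N $ i $ j = N $ j $ i" for i j
    using insert.prems(1) by (metis transpose_def vec_lambda_beta)
  define a where "a = N $ k $ k"
  have quad: "0 \<le> v \<bullet> (N *v v) + 2 * t * (N *v v) $ k + t\<^sup>2 * a" for v t
    using insert.prems(2)[of "v + t *\<^sub>R axis k 1"]
    unfolding quadratic_form_add_axis[OF insert.prems(1)] a_def .
  have "a \<ge> 0" using quad[of 0 1] by simp
  show ?case
  proof (cases "a = 0")
    case True
    \<comment> \<open>With \<open>a = 0\<close> the expression in \<open>quad\<close> is affine in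
      \<open>t\<close>. A nonzero slope would make it negative; the multiplier below is solved for
      the value \<open>- 1\<close>.\<close>
    have "N $ k $ i = 0" for i
    proof (rule ccontr)
      assume nz: "N $ k $ i \<noteq> 0"
      let ?q = "axis i 1 \<bullet> (N *v axis i 1)"
      have col: "(N *v axis i 1) $ k = N $ k $ i" by (simp add: matrix_vector_mult_basis column_def)
      have "0 \<le> ?q + 2 * (- (?q + 1) / (2 * N $ k $ i)) * N $ k $ i"
        using quad[of "axis i 1" "- (?q + 1) / (2 * N $ k $ i)"] True col by simp
      also have "\<dots> = - 1" using nz by (simp add: field_simps)
      finally show False by simp
    qed
    then show ?thesis using insert.prems insert.IH[of N] by (metis insert_iff)
  next
    case False
    then have a: "a > 0" using \<open>a \<ge> 0\<close> by simp
    \<comment> \<open>The Schur complement of the entry \<open>a\<close>: subtracting the rank one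
      matrix built from row \<open>k\<close> clears that row, and the matrix removed contributes a
      nonnegative value of the form \<open>H\<close>.\<close>
    define N' where "N' = (\<chi> i j. N $ i $ j - N $ k $ i * N $ k $ j / a)"
    have "transpose N' = N'" by (simp add: N'_def transpose_def vec_eq_iff sym mult.commute)
    moreover have "0 \<le> v \<bullet> (N' *v v)" for v
    proof -
      have "v \<bullet> (N' *v v) = v \<bullet> (N *v v) - ((N *v v) $ k)\<^sup>2 / a"
        unfolding quadratic_form_sum power2_eq_square
        unfolding N'_def matrix_vector_mult_def vec_lambda_beta
          sum_product sum_divide_distrib sum_subtractf[symmetric]
        by (intro sum.cong refl) (simp add: field_simps)
      \<comment> \<open>This is the expression in \<open>quad\<close> at its minimising multiplier
        \<open>- (N *v v) $ k / a\<close>.\<close>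
      also have "\<dots> = v \<bullet> (N *v v) + 2 * (- (N *v v) $ k / a) * (N *v v) $ k + (- (N *v v) $ k / a)\<^sup>2 * a"
        using a by (simp add: power2_eq_square field_simps)
      finally show ?thesis using quad by presburger
    qed
    moreover have "N' $ i $ j = 0" if "i \<notin> S" for i j
      using that insert.prems(3)[of i j] insert.prems(3)[of i k] sym[of k i] a
      by (cases "i = k") (simp_all add: N'_def a_def)
    ultimately have "0 \<le> (\<Sum>i\<in>UNIV. \<Sum>j\<in>UNIV. N' $ i $ j * H $ i $ j)"
      by (rule insert.IH)
    moreover have "(\<Sum>i\<in>UNIV. \<Sum>j\<in>UNIV. N $ i $ j * H $ i $ j)
        = (\<Sum>i\<in>UNIV. \<Sum>j\<in>UNIV. N' $ i $ j * H $ i $ j) + (N $ k \<bullet> (H *v (N $ k))) / a"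
      unfolding quadratic_form_sum N'_def vec_lambda_beta sum_divide_distrib sum.distrib[symmetric]
      by (intro sum.cong refl) (simp add: field_simps)
    moreover have "0 \<le> (N $ k \<bullet> (H *v (N $ k))) / a" using assms(4) a by simp
    ultimately show ?thesis by simp
  qed
qed

text \<open>Serves the minimum principle, with the inverse metric as \<open>N\<close> and the matrix
  of second derivatives at a minimum as \<open>H\<close>.\<close>

lemma sum_mult_psd_nonneg:
  fixes N H :: "real^'n::finite^'n"
  assumes "transpose N = N" "\<And>v. 0 \<le> v \<bullet> (N *v v)" "\<And>v. 0 \<le> v \<bullet> (H *v v)"
  shows "0 \<le> (\<Sum>i\<in>UNIV. \<Sum>j\<in>UNIV. N $ i $ j * H $ i $ j)"
  using sum_mult_psd_nonneg_aux[of UNIV N H] assms by simp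

lemma pos_def_imp_det_nonzero:
  fixes G :: "real^'n::finite^'n"
  assumes "\<And>v. v \<noteq> 0 \<Longrightarrow> v \<bullet> (G *v v) > 0"
  shows "det G \<noteq> 0"
proof
  assume "det G = 0"
  then obtain v where "v \<noteq> 0" "G *v v = 0"
    using invertible_det_nz[of G] matrix_left_invertible_ker[of G] invertible_left_inverse by blast
  then show False using assms[of v] by simp
qed

lemma transpose_matrix_inv:
  fixes G :: "real^'n::finite^'n"
  assumes "det G \<noteq> 0"
  shows "transpose (matrix_inv G) = matrix_inv (transpose G)"
proof -
  have "transpose G ** transpose (matrix_inv G) = mat 1"
    using matrix_inv_works(2)[OF assms] by (metis matrix_transpose_mul transpose_mat)
  then show ?thesis by (rule matrix_inv_unique[symmetric])
qed

lemma pos_def_matrix_inv: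
  fixes G :: "real^'n::finite^'n"
  assumes pos: "\<And>v. v \<noteq> 0 \<Longrightarrow> v \<bullet> (G *v v) > 0" and sym: "transpose G = G"
  shows "0 \<le> v \<bullet> (matrix_inv G *v v)"
proof -
  have nz: "det G \<noteq> 0" using pos_def_imp_det_nonzero[OF pos] .
  define w where "w = matrix_inv G *v v"
  have "v = G *v w" by (simp add: w_def matrix_vector_mul_assoc matrix_inv_works[OF nz])
  then have "v \<bullet> (matrix_inv G *v v) = w \<bullet> (G *v w)"
    by (metis inner_commute w_def)
  then show ?thesis using pos[of w] by (cases "w = 0") auto
qed

text \<open>The segment from the identity to \<open>G\<close> consists of positive definite
  matrices, so the determinant has no zero on it and keeps the sign it has at the identity.\<close>

lemma pos_def_imp_det_pos:
  fixes G :: "real^'n::finite^'n"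
  assumes pos: "\<And>v. v \<noteq> 0 \<Longrightarrow> v \<bullet> (G *v v) > 0"
  shows "det G > 0"
proof (rule ccontr)
  assume "\<not> det G > 0"
  let ?f = "\<lambda>t::real. det (\<chi> i j. (1 - t) * mat 1 $ i $ j + t * G $ i $ j)"
  have "continuous_on {0..1} ?f"
    by (intro continuous_on_det) (auto intro!: continuous_intros)
  moreover have "?f 0 = 1" using det_I[where ?'a=real and ?'n='n] by (simp add: vec_lambda_eta)
  moreover have "?f 1 \<le> 0" using \<open>\<not> det G > 0\<close> by (simp add: vec_lambda_eta)
  ultimately obtain t where t: "0 \<le> t" "t \<le> 1" "?f t = 0"
    using IVT2'[of ?f 1 0 0] by auto
  have "v \<bullet> ((\<chi> i j. (1 - t) * mat 1 $ i $ j + t * G $ i $ j) *v v) > 0" if "v \<noteq> 0" for v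
  proof -
    have "(\<chi> i j. (1 - t) * mat 1 $ i $ j + t * G $ i $ j) *v v = (1 - t) *\<^sub>R (mat 1 *v v) + t *\<^sub>R (G *v v)"
      by (simp add: vec_eq_iff matrix_vector_mult_def sum.distrib sum_distrib_left distrib_right mult.assoc)
    then have "v \<bullet> ((\<chi> i j. (1 - t) * mat 1 $ i $ j + t * G $ i $ j) *v v)
        = (1 - t) * (v \<bullet> v) + t * (v \<bullet> (G *v v))"
      by (simp add: inner_add_right)
    moreover have "v \<bullet> v > 0" "v \<bullet> (G *v v) > 0" using that pos by auto
    ultimately show ?thesis
      using t by (cases "t = 0") (auto intro!: add_nonneg_pos mult_pos_pos)
  qed
  from pos_def_imp_det_nonzero[OF this] t(3) show False by simp
qed

lemma matrix_inv_congruence: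
  fixes G J :: "real^'n::finite^'n"
  assumes G: "det G \<noteq> 0" and J: "det J \<noteq> 0"
  shows "matrix_inv (transpose J ** G ** J) = matrix_inv J ** matrix_inv G ** transpose (matrix_inv J)"
proof (rule matrix_inv_unique)
  have "transpose J ** G ** J ** (matrix_inv J ** matrix_inv G ** transpose (matrix_inv J))
      = transpose J ** (G ** (J ** matrix_inv J) ** matrix_inv G) ** transpose (matrix_inv J)"
    by (simp only: matrix_mul_assoc)
  also have "\<dots> = transpose J ** transpose (matrix_inv J)"
    by (simp add: matrix_inv_works G J)
  also have "\<dots> = transpose (matrix_inv J ** J)"
    by (rule matrix_transpose_mul[symmetric])
  finally show "transpose J ** G ** J ** (matrix_inv J ** matrix_inv G ** transpose (matrix_inv J)) = mat 1"
    by (simp add: matrix_inv_works J transpose_mat)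
qed

text \<open>Written as traces of matrix products, the scalar invariants are unchanged under
  congruence because the Jacobians cancel cyclically.\<close>

lemma metric_trace_eq_trace:
  "metric_trace g T c p = trace (matrix_inv (g c p) ** transpose (T c p))"
  by (simp add: metric_trace_def trace_def matrix_matrix_mult_def transpose_def)

lemma metric_norm_sq_eq_trace:
  "metric_norm_sq g T c p = trace (transpose (T c p) ** matrix_inv (g c p) ** T c p ** transpose (matrix_inv (g c p)))"
proof -
  let ?N = "matrix_inv (g c p)" and ?T = "T c p"
  have "trace (transpose ?T ** ?N ** ?T ** transpose ?N)
      = (\<Sum>j\<in>UNIV. \<Sum>l\<in>UNIV. \<Sum>k\<in>UNIV. \<Sum>i\<in>UNIV. ?N $ i $ k * ?N $ j $ l * ?T $ i $ j * ?T $ k $ l)"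
    by (simp add: trace_def matrix_matrix_mult_def transpose_def sum_distrib_left sum_distrib_right mult_ac)
  also have "\<dots> = (\<Sum>j\<in>UNIV. \<Sum>i\<in>UNIV. \<Sum>k\<in>UNIV. \<Sum>l\<in>UNIV. ?N $ i $ k * ?N $ j $ l * ?T $ i $ j * ?T $ k $ l)"
    by (subst (2) sum.swap, subst (3) sum.swap, subst (2) sum.swap) simp
  finally show ?thesis
    unfolding metric_norm_sq_def by (subst sum.swap) simp
qed

lemma trace_congruence:
  fixes G J T :: "real^'n::finite^'n"
  assumes G: "det G \<noteq> 0" and J: "det J \<noteq> 0"
  shows "trace (matrix_inv (transpose J ** G ** J) ** transpose (transpose J ** T ** J))
    = trace (matrix_inv G ** transpose T)"
proof -
  have "matrix_inv (transpose J ** G ** J) ** transpose (transpose J ** T ** J)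
     = matrix_inv J ** matrix_inv G ** transpose (J ** matrix_inv J) ** transpose T ** J"
    by (simp add: matrix_inv_congruence[OF assms] matrix_transpose_mul matrix_mul_assoc)
  also have "\<dots> = matrix_inv J ** (matrix_inv G ** transpose T ** J)"
    by (simp add: matrix_inv_works J transpose_mat matrix_mul_assoc)
  finally show ?thesis
    by (simp add: trace_mul_sym[of "matrix_inv J"] matrix_inv_works J flip: matrix_mul_assoc)
qed

lemma norm_sq_congruence:
  fixes G J T :: "real^'n::finite^'n"
  assumes G: "det G \<noteq> 0" and J: "det J \<noteq> 0"
  defines "G' \<equiv> transpose J ** G ** J" and "T' \<equiv> transpose J ** T ** J"
  shows "trace (transpose T' ** matrix_inv G' ** T' ** transpose (matrix_inv G'))
    = trace (transpose T ** matrix_inv G ** T ** transpose (matrix_inv G))"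
proof -
  have "transpose T' ** matrix_inv G' ** T' ** transpose (matrix_inv G')
     = transpose J ** transpose T ** (J ** matrix_inv J) ** matrix_inv G ** transpose (J ** matrix_inv J)
       ** T ** (J ** matrix_inv J) ** transpose (matrix_inv G) ** transpose (matrix_inv J)"
    by (simp add: G'_def T'_def matrix_inv_congruence[OF G J] matrix_transpose_mul matrix_mul_assoc)
  also have "\<dots> = transpose J ** (transpose T ** matrix_inv G ** T ** transpose (matrix_inv G) ** transpose (matrix_inv J))"
    by (simp add: matrix_inv_works J transpose_mat matrix_mul_assoc)
  finally have "trace (transpose T' ** matrix_inv G' ** T' ** transpose (matrix_inv G'))
    = trace (transpose T ** matrix_inv G ** T ** transpose (matrix_inv G) ** transpose (matrix_inv J) ** transpose J)"
    using trace_mul_sym[of "transpose J"] by simp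
  also have "\<dots> = trace (transpose T ** matrix_inv G ** T ** transpose (matrix_inv G) ** (transpose (matrix_inv J) ** transpose J))"
    by (simp only: matrix_mul_assoc)
  also have "transpose (matrix_inv J) ** transpose J = mat 1"
    by (simp only: matrix_inv_works[OF J] transpose_mat flip: matrix_transpose_mul)
  finally show ?thesis by simp
qed

text \<open>With a = H/n the cross terms contribute -2aH and the pure trace a^2 n, in total -H^2/n.
  The Hamiltonian constraint thereby becomes R = |K|^2 - H^2.\<close>

lemma metric_norm_sq_trace_free_part:
  fixes g T :: "('a, 'n::finite) tensor2"
  assumes G: "det (g c p) \<noteq> 0" and Gs: "transpose (g c p) = g c p" and Ts: "transpose (T c p) = T c p"
  shows "metric_norm_sq g (trace_free_part g T) c p
    = metric_norm_sq g T c p - (metric_trace g T c p)\<^sup>2 / real CARD('n)"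
proof -
  let ?G = "g c p" and ?N = "matrix_inv (g c p)" and ?T = "T c p"
  define a where "a = metric_trace g T c p / real CARD('n)"
  have Ns: "transpose ?N = ?N" using transpose_matrix_inv[OF G] Gs by simp
  have sc: "(x *\<^sub>R A) ** B = x *\<^sub>R (A ** B)" "A ** (x *\<^sub>R B) = x *\<^sub>R (A ** B)" for x and A B :: "real^'n^'n"
    by (simp_all add: vec_eq_iff matrix_matrix_mult_def sum_distrib_left mult_ac)
  have tr: "trace (x *\<^sub>R A) = x * trace A" for x and A :: "real^'n^'n"
    by (simp add: trace_def sum_distrib_left)
  have t0: "trace (?T ** ?N) = metric_trace g T c p"
    unfolding metric_trace_eq_trace Ts by (rule trace_mul_sym)
  have tf: "trace_free_part g T c p = ?T - a *\<^sub>R ?G"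
    by (simp add: trace_free_part_def a_def)
  have ts: "transpose (?T - a *\<^sub>R ?G) = ?T - a *\<^sub>R ?G"
    using Ts Gs by (simp add: transpose_def vec_eq_iff)
  have "(?T - a *\<^sub>R ?G) ** ?N = ?T ** ?N - a *\<^sub>R mat 1"
    by (simp add: matrix_diff_rdistrib sc matrix_inv_works G)
  then have "(?T - a *\<^sub>R ?G) ** ?N ** (?T - a *\<^sub>R ?G) ** ?N = (?T ** ?N - a *\<^sub>R mat 1) ** (?T ** ?N - a *\<^sub>R mat 1)"
    by (simp flip: matrix_mul_assoc)
  also have "\<dots> = ?T ** ?N ** ?T ** ?N - a *\<^sub>R (?T ** ?N) - (a *\<^sub>R (?T ** ?N) - a *\<^sub>R a *\<^sub>R mat 1)"
    by (simp add: matrix_diff_rdistrib matrix_diff_ldistrib sc matrix_mul_assoc scaleR_right_diff_distrib)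
  finally have eq: "(?T - a *\<^sub>R ?G) ** ?N ** (?T - a *\<^sub>R ?G) ** ?N
    = ?T ** ?N ** ?T ** ?N - a *\<^sub>R (?T ** ?N) - (a *\<^sub>R (?T ** ?N) - a *\<^sub>R a *\<^sub>R mat 1)" .
  have "metric_norm_sq g (trace_free_part g T) c p
      = trace (?T ** ?N ** ?T ** ?N) - a * metric_trace g T c p
        - (a * metric_trace g T c p - a * (a * real CARD('n)))"
    unfolding metric_norm_sq_eq_trace tf ts Ns eq trace_sub tr t0 trace_I by simp
  moreover have "metric_norm_sq g T c p = trace (?T ** ?N ** ?T ** ?N)"
    unfolding metric_norm_sq_eq_trace Ts Ns ..
  ultimately have "metric_norm_sq g (trace_free_part g T) c p
      = metric_norm_sq g T c p - 2 * a * metric_trace g T c p + a * a * real CARD('n)"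
    by simp
  then show ?thesis by (simp add: a_def field_simps power2_eq_square)
qed

section \<open>Charts\<close>

abbreviation chart_img :: "('a, 'n::finite) chart \<Rightarrow> (real^'n) set" where
  "chart_img c \<equiv> coords c ` chart_dom c"

definition chart_jacobian :: "('a, 'n::finite) chart \<Rightarrow> ('a, 'n) chart \<Rightarrow> 'a \<Rightarrow> real^'n^'n" where
  "chart_jacobian c d p = matrix (frechet_derivative (coords d \<circ> param c) (at (coords c p)))"

text \<open>The sort \<open>wellorder\<close> on the index type is demanded by the change of
  variables theorem for \<open>real^'n\<close>.\<close>

locale manifold =
  fixes A :: "('a::{t2_space, second_countable_topology}, 'n::{finite, wellorder}) atlas"
  assumes atlas: "smooth_atlas A"
begin

lemma is_chart: "c \<in> A \<Longrightarrow> is_chart c"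
  using atlas unfolding smooth_atlas_def by blast

lemma open_dom: "c \<in> A \<Longrightarrow> open (chart_dom c)"
  using is_chart unfolding is_chart_def by blast

lemma open_img: "c \<in> A \<Longrightarrow> open (chart_img c)"
  using is_chart unfolding is_chart_def by blast

lemma chart_homeomorphism: "c \<in> A \<Longrightarrow> homeomorphism (chart_dom c) (chart_img c) (coords c) (param c)"
  using is_chart unfolding is_chart_def by blast

lemma param_coords [simp]: "c \<in> A \<Longrightarrow> p \<in> chart_dom c \<Longrightarrow> param c (coords c p) = p"
  using chart_homeomorphism unfolding homeomorphism_def by blast

lemma coords_param [simp]: "c \<in> A \<Longrightarrow> y \<in> chart_img c \<Longrightarrow> coords c (param c y) = y"
  using chart_homeomorphism unfolding homeomorphism_def by blast

lemma param_in_dom: "c \<in> A \<Longrightarrow> y \<in> chart_img c \<Longrightarrow> param c y \<in> chart_dom c"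
  using chart_homeomorphism unfolding homeomorphism_def by blast

lemma continuous_on_coords: "c \<in> A \<Longrightarrow> continuous_on (chart_dom c) (coords c)"
  using chart_homeomorphism unfolding homeomorphism_def by blast

lemma continuous_on_param: "c \<in> A \<Longrightarrow> continuous_on (chart_img c) (param c)"
  using chart_homeomorphism unfolding homeomorphism_def by blast

lemma chart_exists: "\<exists>c\<in>A. p \<in> chart_dom c"
  using atlas unfolding smooth_atlas_def by blast

lemma chart_at: "chart_at A p \<in> A" "p \<in> chart_dom (chart_at A p)"
  using someI_ex[of "\<lambda>c. c \<in> A \<and> p \<in> chart_dom c"] chart_exists[of p]
  unfolding chart_at_def by blast+

text \<open>Turns images under \<open>coords c\<close> into preimages under \<open>param c\<close>,
  whose openness and measurability come from continuity on the chart image.\<close>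

lemma coords_image_eq:
  "c \<in> A \<Longrightarrow> S \<subseteq> chart_dom c \<Longrightarrow> coords c ` S = chart_img c \<inter> param c -` S"
  by (auto simp: image_iff subset_iff)

lemma open_coords_image:
  assumes "c \<in> A" "open S" "S \<subseteq> chart_dom c"
  shows "open (coords c ` S)"
  unfolding coords_image_eq[OF assms(1,3)]
  by (intro continuous_open_preimage continuous_on_param open_img assms)

lemma coords_image_borel:
  assumes "c \<in> A" "S \<in> sets borel" "S \<subseteq> chart_dom c"
  shows "coords c ` S \<in> sets borel"
proof -
  have "param c \<in> borel_measurable (restrict_space borel (chart_img c))"
    using assms by (intro borel_measurable_continuous_on_restrict continuous_on_param)
  from measurable_sets[OF this assms(2)]
  have "param c -` S \<inter> chart_img c \<in> sets (restrict_space borel (chart_img c))"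
    by (simp add: space_restrict_space)
  then show ?thesis
    using open_img[OF assms(1)] unfolding coords_image_eq[OF assms(1,3)]
    by (auto simp: sets_restrict_space_iff Int_commute)
qed

lemma inj_on_coords: "c \<in> A \<Longrightarrow> inj_on (coords c) (chart_dom c)"
  by (metis inj_on_inverseI param_coords)

lemma coords_image_disjoint:
  assumes "c \<in> A" "S \<inter> T = {}" "S \<subseteq> chart_dom c" "T \<subseteq> chart_dom c"
  shows "coords c ` S \<inter> coords c ` T = {}"
  using inj_on_image_Int[OF inj_on_coords[OF assms(1)] assms(3,4)] assms(2) by simp

lemma transition_C_k:
  assumes "c \<in> A" "d \<in> A"
  shows "C_k k (coords d \<circ> param c) (coords c ` (chart_dom c \<inter> chart_dom d))"
  using atlas assms unfolding smooth_atlas_def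
  by (intro smooth_on_open_imp_C_k open_coords_image) (auto intro: open_dom)

lemma transition_has_derivative:
  assumes "c \<in> A" "d \<in> A" "p \<in> chart_dom c" "p \<in> chart_dom d"
  shows "((coords d \<circ> param c) has_derivative (*v) (chart_jacobian c d p)) (at (coords c p))"
proof -
  have "(coords d \<circ> param c) differentiable (at (coords c p))"
    using transition_C_k[OF assms(1,2), of 1] assms by (auto simp: C_k.simps)
  then have *: "((coords d \<circ> param c) has_derivative frechet_derivative (coords d \<circ> param c) (at (coords c p)))
     (at (coords c p))"
    by (simp add: frechet_derivative_works)
  then have "linear (frechet_derivative (coords d \<circ> param c) (at (coords c p)))"
    by (rule has_derivative_linear)
  then have "(*v) (chart_jacobian c d p) = frechet_derivative (coords d \<circ> param c) (at (coords c p))"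
    unfolding chart_jacobian_def by (simp add: matrix_works fun_eq_iff)
  then show ?thesis using * by simp
qed

lemma tensor_field_transform:
  assumes "tensor_field A T" "c \<in> A" "d \<in> A" "p \<in> chart_dom c" "p \<in> chart_dom d"
  shows "T c p = transpose (chart_jacobian c d p) ** T d p ** chart_jacobian c d p"
  using assms unfolding tensor_field_def chart_jacobian_def Let_def by blast

lemma eventually_param_in:
  assumes "c \<in> A" "p \<in> chart_dom c" "open S" "p \<in> S"
  shows "\<forall>\<^sub>F y in nhds (coords c p). y \<in> chart_img c \<and> param c y \<in> S"
proof (rule eventually_nhds_in_openI)
  show "open (chart_img c \<inter> param c -` S)"
    by (intro continuous_open_preimage continuous_on_param open_img assms)
qed (use assms in auto)

text \<open>The chain rule for
  \<open>(f \<circ> param d) \<circ> (coords d \<circ> param c)\<close>, which agrees with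
  \<open>f \<circ> param c\<close> only near the point because charts overlap only there.\<close>

lemma pd_transform:
  assumes "c \<in> A" "d \<in> A" "p \<in> chart_dom c" "p \<in> chart_dom d"
    and "(f \<circ> param d) differentiable (at (coords d p))"
  shows "((f \<circ> param c) has_derivative
      (\<lambda>v. \<Sum>j\<in>UNIV. (chart_jacobian c d p *v v) $ j * pd j (f \<circ> param d) (coords d p))) (at (coords c p))"
    and "pd i (f \<circ> param c) (coords c p)
      = (\<Sum>j\<in>UNIV. chart_jacobian c d p $ j $ i * pd j (f \<circ> param d) (coords d p))"
proof -
  have "(f \<circ> param d has_derivative (\<lambda>v. \<Sum>j\<in>UNIV. v $ j * pd j (f \<circ> param d) (coords d p)))
      (at ((coords d \<circ> param c) (coords c p)))"
    using has_derivative_pd[OF assms(5)] assms by simp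
  from diff_chain_at[OF transition_has_derivative[OF assms(1-4)] this]
  have *: "((f \<circ> param d) \<circ> (coords d \<circ> param c) has_derivative
      (\<lambda>v. \<Sum>j\<in>UNIV. (chart_jacobian c d p *v v) $ j * pd j (f \<circ> param d) (coords d p))) (at (coords c p))"
    by (simp add: o_def)
  have "\<forall>\<^sub>F y in nhds (coords c p). ((f \<circ> param d) \<circ> (coords d \<circ> param c)) y = (f \<circ> param c) y"
    using eventually_param_in[OF assms(1,3) open_dom[OF assms(2)] assms(4)]
    by eventually_elim (simp add: assms)
  then obtain S where S: "open S" "coords c p \<in> S"
      "\<And>y. y \<in> S \<Longrightarrow> ((f \<circ> param d) \<circ> (coords d \<circ> param c)) y = (f \<circ> param c) y"
    unfolding eventually_nhds by auto
  show 1: "((f \<circ> param c) has_derivative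
      (\<lambda>v. \<Sum>j\<in>UNIV. (chart_jacobian c d p *v v) $ j * pd j (f \<circ> param d) (coords d p))) (at (coords c p))"
    by (rule has_derivative_transform_within_open[OF * S(1,2)]) (rule S(3))
  show "pd i (f \<circ> param c) (coords c p)
      = (\<Sum>j\<in>UNIV. chart_jacobian c d p $ j $ i * pd j (f \<circ> param d) (coords d p))"
    using pd_eqI[OF 1] by (simp add: matrix_vector_mult_basis column_def)
qed

end

section \<open>Change of variables for nonnegative functions\<close>

lemma set_nn_integral_absolutely_integrable:
  fixes f :: "'b::euclidean_space \<Rightarrow> real"
  assumes "f absolutely_integrable_on S" "\<And>x. x \<in> S \<Longrightarrow> 0 \<le> f x"
  shows "(\<integral>\<^sup>+x\<in>S. ennreal (f x) \<partial>lborel) = ennreal (integral S f)"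
  using assms by (intro nn_integral_has_integral_lebesgue')
    (auto intro: integrable_integral set_lebesgue_integral_eq_integral(1))

lemma set_nn_integral_finite_imp_absolutely_integrable:
  fixes f :: "'b::euclidean_space \<Rightarrow> real"
  assumes "(\<lambda>x. indicator S x * f x) \<in> borel_measurable borel" "\<And>x. x \<in> S \<Longrightarrow> 0 \<le> f x"
    and "(\<integral>\<^sup>+x\<in>S. ennreal (f x) \<partial>lborel) < \<infinity>"
  shows "f absolutely_integrable_on S"
proof -
  have "(\<integral>\<^sup>+x. ennreal (norm (indicator S x * f x)) \<partial>lborel) = (\<integral>\<^sup>+x\<in>S. ennreal (f x) \<partial>lborel)"
    using assms(2) by (intro nn_integral_cong) (auto simp: indicator_def)
  then have "integrable lborel (\<lambda>x. indicator S x * f x)"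
    using assms by (intro integrableI_bounded) auto
  then show ?thesis
    unfolding set_integrable_def using integrable_completion[of "\<lambda>x. indicator S x * f x" lborel]
    by (simp add: borel_measurable_integrable)
qed

text \<open>The change of variables theorem is stated for functions with values in
  \<open>real^'n\<close>; real functions pass through it as vectors of length one.\<close>

lemma absolutely_integrable_vec1:
  "(\<lambda>x. f x *\<^sub>R (1 :: real^1)) absolutely_integrable_on S \<longleftrightarrow> (f :: 'b::euclidean_space \<Rightarrow> real) absolutely_integrable_on S"
proof
  assume "(\<lambda>x. f x *\<^sub>R (1 :: real^1)) absolutely_integrable_on S"
  from absolutely_integrable_linear[OF this bounded_linear_vec_nth[of 1]]
  show "f absolutely_integrable_on S" by (simp add: o_def)
next
  assume "f absolutely_integrable_on S"
  from absolutely_integrable_linear[OF this bounded_linear_scaleR_left[of "1 :: real^1"]]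
  show "(\<lambda>x. f x *\<^sub>R (1 :: real^1)) absolutely_integrable_on S" by (simp add: o_def)
qed

text \<open>The theorem for absolutely integrable functions also transfers integrability in both
  directions, so either both sides are finite and equal or both are infinite. \<open>F\<close> is
  named separately so that its measurability can be supplied directly.\<close>

lemma nn_integral_change_of_variables:
  fixes \<tau> :: "real^'n::{finite, wellorder} \<Rightarrow> real^'n::_"
  assumes S: "S \<in> sets borel"
    and der: "\<And>x. x \<in> S \<Longrightarrow> (\<tau> has_derivative \<tau>' x) (at x)"
    and inj: "inj_on \<tau> S"
    and nonneg: "\<And>y. y \<in> \<tau> ` S \<Longrightarrow> 0 \<le> f y"
    and F: "\<And>x. x \<in> S \<Longrightarrow> F x = \<bar>det (matrix (\<tau>' x))\<bar> * f (\<tau> x)"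
    and mf: "(\<lambda>y. indicator (\<tau> ` S) y * f y) \<in> borel_measurable borel"
    and mF: "(\<lambda>x. indicator S x * F x) \<in> borel_measurable borel"
  shows "(\<integral>\<^sup>+x\<in>S. ennreal (F x) \<partial>lborel) = (\<integral>\<^sup>+y\<in>\<tau> ` S. ennreal (f y) \<partial>lborel)"
proof -
  have F0: "0 \<le> F x" if "x \<in> S" for x using F[OF that] nonneg that by simp
  have *: "(\<lambda>x. \<bar>det (matrix (\<tau>' x))\<bar> *\<^sub>R (f (\<tau> x) *\<^sub>R (1::real^1))) absolutely_integrable_on S \<and>
           integral S (\<lambda>x. \<bar>det (matrix (\<tau>' x))\<bar> *\<^sub>R (f (\<tau> x) *\<^sub>R (1::real^1))) = b
     \<longleftrightarrow> (\<lambda>y. f y *\<^sub>R (1::real^1)) absolutely_integrable_on (\<tau> ` S) \<and> integral (\<tau> ` S) (\<lambda>y. f y *\<^sub>R (1::real^1)) = b" for b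
    using S by (intro has_absolute_integral_change_of_variables[where f = "\<lambda>y. f y *\<^sub>R (1::real^1)"] inj)
      (auto intro: has_derivative_at_withinI der)
  have **: "(\<lambda>x. F x *\<^sub>R (1::real^1)) absolutely_integrable_on S \<and> integral S (\<lambda>x. F x *\<^sub>R (1::real^1)) = b
     \<longleftrightarrow> (\<lambda>y. f y *\<^sub>R (1::real^1)) absolutely_integrable_on (\<tau> ` S) \<and> integral (\<tau> ` S) (\<lambda>y. f y *\<^sub>R (1::real^1)) = b" for b
  proof -
    have "(\<lambda>x. F x *\<^sub>R (1::real^1)) absolutely_integrable_on S \<longleftrightarrow>
        (\<lambda>x. \<bar>det (matrix (\<tau>' x))\<bar> *\<^sub>R (f (\<tau> x) *\<^sub>R (1::real^1))) absolutely_integrable_on S"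
      by (intro set_integrable_cong) (auto simp: F)
    moreover have "integral S (\<lambda>x. F x *\<^sub>R (1::real^1))
        = integral S (\<lambda>x. \<bar>det (matrix (\<tau>' x))\<bar> *\<^sub>R (f (\<tau> x) *\<^sub>R (1::real^1)))"
      by (intro integral_cong) (auto simp: F)
    ultimately show ?thesis using * by simp
  qed
  show ?thesis
  proof (cases "F absolutely_integrable_on S")
    case True
    then have f: "f absolutely_integrable_on (\<tau> ` S)"
      and eq: "integral S (\<lambda>x. F x *\<^sub>R (1::real^1)) = integral (\<tau> ` S) (\<lambda>y. f y *\<^sub>R (1::real^1))"
      using ** absolutely_integrable_vec1 by blast+
    have vec: "integral T (\<lambda>x. h x *\<^sub>R (1::real^1)) = integral T h *\<^sub>R 1"
      if "h absolutely_integrable_on T" for h :: "real^'n::_ \<Rightarrow> real" and T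
      using integral_linear[OF set_lebesgue_integral_eq_integral(1)[OF that] bounded_linear_scaleR_left[of "1 :: real^1"]]
      by (simp add: o_def)
    have "integral S F = integral (\<tau> ` S) f"
      using eq vec[OF True] vec[OF f] by (simp add: vec_eq_iff)
    then show ?thesis
      using set_nn_integral_absolutely_integrable[OF True F0] set_nn_integral_absolutely_integrable[OF f nonneg] by simp
  next
    case False
    then have "\<not> f absolutely_integrable_on (\<tau> ` S)" using ** absolutely_integrable_vec1 by blast
    then have "(\<integral>\<^sup>+y\<in>\<tau> ` S. ennreal (f y) \<partial>lborel) = \<infinity>"
      using set_nn_integral_finite_imp_absolutely_integrable[OF mf nonneg] by (auto simp: less_top[symmetric])
    moreover have "(\<integral>\<^sup>+x\<in>S. ennreal (F x) \<partial>lborel) = \<infinity>"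
      using False set_nn_integral_finite_imp_absolutely_integrable[OF mF F0] by (auto simp: less_top[symmetric])
    ultimately show ?thesis by simp
  qed
qed


section \<open>The Riemannian measure\<close>

definition vol_density :: "('a, 'n::finite) tensor2 \<Rightarrow> ('a, 'n) chart \<Rightarrow> real^'n \<Rightarrow> real" where
  "vol_density g c y = sqrt (det (g c (param c y)))"

locale compact_manifold = manifold A
  for A :: "('a::{t2_space, second_countable_topology}, 'n::{finite, wellorder}) atlas" +
  assumes compact_UNIV: "compact (UNIV :: 'a set)"
begin

text \<open>A finite subcover by chart domains, made disjoint by removing the earlier ones. Each
  piece lies in one chart, so global measures and integrals become finite sums of chart
  expressions.\<close>

lemma finite_borel_partition:
  obtains m :: nat and cs B where "\<And>i. i < m \<Longrightarrow> cs i \<in> A" "\<And>i. i < m \<Longrightarrow> B i \<in> sets borel"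
    "\<And>i. i < m \<Longrightarrow> B i \<subseteq> chart_dom (cs i)" "disjoint_family_on B {..<m}" "(\<Union>i<m. B i) = UNIV"
proof -
  have "UNIV \<subseteq> (\<Union>c\<in>A. chart_dom c)" using chart_exists by blast
  from compactE_image[OF compact_UNIV open_dom this]
  obtain C where C: "C \<subseteq> A" "finite C" "UNIV \<subseteq> (\<Union>c\<in>C. chart_dom c)" by metis
  obtain m :: nat and cs where cs: "C = cs ` {i. i < m}" "inj_on cs {i. i < m}"
    using finite_imp_nat_seg_image_inj_on[OF C(2)] by metis
  define B where "B i = chart_dom (cs i) - (\<Union>j<i. chart_dom (cs j))" for i
  show ?thesis
  proof (rule that[of m cs B])
    show csA: "cs i \<in> A" if "i < m" for i using cs C that by auto
    show "B i \<in> sets borel" if "i < m" for i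
      unfolding B_def using that csA open_dom by (intro sets.Diff sets.finite_UN) auto
    show "B i \<subseteq> chart_dom (cs i)" for i unfolding B_def by auto
    show "disjoint_family_on B {..<m}"
      unfolding disjoint_family_on_def B_def by (auto simp: neq_iff)
    show "(\<Union>i<m. B i) = UNIV"
    proof -
      have "\<exists>i<m. p \<in> B i" for p
      proof -
        have ex: "\<exists>i. i < m \<and> p \<in> chart_dom (cs i)" using C(3) cs by blast
        define i where "i = (LEAST i. i < m \<and> p \<in> chart_dom (cs i))"
        have "i < m \<and> p \<in> chart_dom (cs i)" unfolding i_def by (rule LeastI_ex[OF ex])
        moreover have "p \<notin> chart_dom (cs j)" if "j < i" for j
          using not_less_Least[of j "\<lambda>i. i < m \<and> p \<in> chart_dom (cs i)"] that calculation unfolding i_def by auto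
        ultimately show ?thesis unfolding B_def by auto
      qed
      then show ?thesis by blast
    qed
  qed
qed

end

text \<open>Models a single time slice. One derivative of the metric gives the Christoffel symbols
  and the divergence theorem; second derivatives enter through the equations of the flow.\<close>

locale riemannian_manifold = compact_manifold A
  for A :: "('a::{t2_space, second_countable_topology}, 'n::{finite, wellorder}) atlas" +
  fixes g :: "('a, 'n) tensor2"
  assumes metric: "riemannian_metric A g"
    and metric_C1: "\<And>c i j. c \<in> A \<Longrightarrow> C_k (Suc 0) (\<lambda>y. g c (param c y) $ i $ j) (chart_img c)"
begin

lemma metric_pos: "c \<in> A \<Longrightarrow> p \<in> chart_dom c \<Longrightarrow> v \<noteq> 0 \<Longrightarrow> v \<bullet> (g c p *v v) > 0"
  using metric unfolding riemannian_metric_def by blast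

lemma metric_symmetric: "c \<in> A \<Longrightarrow> p \<in> chart_dom c \<Longrightarrow> transpose (g c p) = g c p"
  using metric unfolding riemannian_metric_def symmetric_tensor_field_def by blast

lemma metric_tensor_field: "tensor_field A g"
  using metric unfolding riemannian_metric_def symmetric_tensor_field_def by blast

lemma metric_det_pos: "c \<in> A \<Longrightarrow> p \<in> chart_dom c \<Longrightarrow> det (g c p) > 0"
  using metric_pos by (intro pos_def_imp_det_pos)

lemma metric_det_nonzero: "c \<in> A \<Longrightarrow> p \<in> chart_dom c \<Longrightarrow> det (g c p) \<noteq> 0"
  using metric_det_pos by fastforce

lemma metric_det_transform:
  assumes "c \<in> A" "d \<in> A" "p \<in> chart_dom c" "p \<in> chart_dom d"
  shows "det (g c p) = (det (chart_jacobian c d p))\<^sup>2 * det (g d p)"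
  unfolding tensor_field_transform[OF metric_tensor_field assms]
  by (simp add: det_mul det_transpose power2_eq_square)

text \<open>Invertibility is read off from \<open>metric_det_transform\<close>: the determinant of
  the metric in \<open>c\<close> is nonzero and has the squared Jacobian determinant as a
  factor.\<close>

lemma chart_jacobian_det_nonzero:
  assumes "c \<in> A" "d \<in> A" "p \<in> chart_dom c" "p \<in> chart_dom d"
  shows "det (chart_jacobian c d p) \<noteq> 0"
  using metric_det_transform[OF assms] metric_det_nonzero[OF assms(1,3)] by auto

lemma metric_trace_chart_independent:
  assumes "tensor_field A T" "c \<in> A" "d \<in> A" "p \<in> chart_dom c" "p \<in> chart_dom d"
  shows "metric_trace g T c p = metric_trace g T d p"
  unfolding metric_trace_eq_trace tensor_field_transform[OF metric_tensor_field assms(2-5)]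
    tensor_field_transform[OF assms]
  by (rule trace_congruence[OF metric_det_nonzero[OF assms(3,5)] chart_jacobian_det_nonzero[OF assms(2-5)]])

lemma metric_norm_sq_chart_independent:
  assumes "tensor_field A T" "c \<in> A" "d \<in> A" "p \<in> chart_dom c" "p \<in> chart_dom d"
  shows "metric_norm_sq g T c p = metric_norm_sq g T d p"
  unfolding metric_norm_sq_eq_trace tensor_field_transform[OF metric_tensor_field assms(2-5)]
    tensor_field_transform[OF assms]
  by (rule norm_sq_congruence[OF metric_det_nonzero[OF assms(3,5)] chart_jacobian_det_nonzero[OF assms(2-5)]])

lemma vol_density_pos: "c \<in> A \<Longrightarrow> y \<in> chart_img c \<Longrightarrow> vol_density g c y > 0"
  unfolding vol_density_def using metric_det_pos param_in_dom by simp

lemma continuous_on_vol_density: "c \<in> A \<Longrightarrow> continuous_on (chart_img c) (vol_density g c)"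
  unfolding vol_density_def by (intro continuous_intros continuous_on_det C1_D(3)[OF metric_C1])

lemma vol_density_measurable [measurable]:
  "c \<in> A \<Longrightarrow> (\<lambda>y. indicator (chart_img c) y * vol_density g c y) \<in> borel_measurable borel"
  using borel_measurable_continuous_on_indicator[OF borel_open[OF open_img] continuous_on_vol_density] by simp

text \<open>The Riemannian measure of a chart domain, seen in coordinate space. The indicator
  removes the points where \<open>param c\<close> has no meaning.\<close>

definition chart_measure where
  "chart_measure c = density lborel (\<lambda>y. ennreal (indicator (chart_img c) y * vol_density g c y))"

lemma sets_chart_measure [simp]: "sets (chart_measure c) = sets borel"
  by (simp add: chart_measure_def)

lemma emeasure_chart_measure:
  assumes "c \<in> A" "T \<in> sets borel" "T \<subseteq> chart_img c"
  shows "emeasure (chart_measure c) T = (\<integral>\<^sup>+y\<in>T. ennreal (vol_density g c y) \<partial>lborel)"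
  unfolding chart_measure_def using assms
  by (subst emeasure_density) (auto intro!: nn_integral_cong split: split_indicator)

text \<open>Taking roots in \<open>metric_det_transform\<close> yields the factor |det J|, exactly
  the one in the change of variables formula for the transition map.\<close>

lemma chart_measure_transform:
  assumes "c \<in> A" "d \<in> A" "S \<in> sets borel" "S \<subseteq> chart_dom c" "S \<subseteq> chart_dom d"
  shows "emeasure (chart_measure c) (coords c ` S) = emeasure (chart_measure d) (coords d ` S)"
proof -
  let ?\<tau> = "coords d \<circ> param c"
  have im: "?\<tau> ` coords c ` S = coords d ` S"
    using assms by (force simp: image_iff subset_iff)
  have S: "coords c ` S \<in> sets borel" "coords d ` S \<in> sets borel"
    using assms coords_image_borel by blast+
  have sub: "coords c ` S \<subseteq> chart_img c" "coords d ` S \<subseteq> chart_img d" using assms by auto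
  have mble: "(\<lambda>y. indicator (coords e ` S) y * vol_density g e y) \<in> borel_measurable borel"
    if "e \<in> A" "coords e ` S \<in> sets borel" "coords e ` S \<subseteq> chart_img e" for e
  proof -
    have "(\<lambda>y. indicator (coords e ` S) y * (indicator (chart_img e) y * vol_density g e y)) \<in> borel_measurable borel"
      using that by (intro borel_measurable_times borel_measurable_indicator vol_density_measurable)
    moreover have "(\<lambda>y. indicator (coords e ` S) y * (indicator (chart_img e) y * vol_density g e y))
        = (\<lambda>y. indicator (coords e ` S) y * vol_density g e y)"
      using that(3) by (auto simp: fun_eq_iff indicator_def)
    ultimately show ?thesis by simp
  qed
  have "(\<integral>\<^sup>+y\<in>coords c ` S. ennreal (vol_density g c y) \<partial>lborel)
      = (\<integral>\<^sup>+y\<in>?\<tau> ` coords c ` S. ennreal (vol_density g d y) \<partial>lborel)"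
  proof (rule nn_integral_change_of_variables[where \<tau>' = "\<lambda>y. (*v) (chart_jacobian c d (param c y))"])
    fix y assume "y \<in> coords c ` S"
    then obtain p where p: "p \<in> S" "y = coords c p" by blast
    then have p': "p \<in> chart_dom c" "p \<in> chart_dom d" using assms by auto
    show "(?\<tau> has_derivative (*v) (chart_jacobian c d (param c y))) (at y)"
      using transition_has_derivative[OF assms(1,2) p'] p p' assms by simp
    show "vol_density g c y = \<bar>det (matrix ((*v) (chart_jacobian c d (param c y))))\<bar> * vol_density g d (?\<tau> y)"
      using metric_det_transform[OF assms(1,2) p'] p p' assms
      by (simp add: vol_density_def real_sqrt_mult)
  next
    show "inj_on ?\<tau> (coords c ` S)"
    proof (rule inj_onI)
      fix y z assume "y \<in> coords c ` S" "z \<in> coords c ` S" "?\<tau> y = ?\<tau> z"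
      then obtain p q where "p \<in> S" "q \<in> S" "y = coords c p" "z = coords c q" "coords d p = coords d q"
        using assms by (auto simp: subset_iff)
      moreover have "p = q" using calculation assms by (metis param_coords subsetD)
      ultimately show "y = z" by simp
    qed
    show "0 \<le> vol_density g d y" if "y \<in> ?\<tau> ` coords c ` S" for y
      using that sub vol_density_pos[OF assms(2), of y] unfolding im by fastforce
    show "coords c ` S \<in> sets borel" by (rule S(1))
    show "(\<lambda>y. indicator (?\<tau> ` coords c ` S) y * vol_density g d y) \<in> borel_measurable borel"
      unfolding im by (rule mble[OF assms(2) S(2) sub(2)])
    show "(\<lambda>y. indicator (coords c ` S) y * vol_density g c y) \<in> borel_measurable borel"
      by (rule mble[OF assms(1) S(1) sub(1)])
  qed
  then show ?thesis
    using emeasure_chart_measure[OF assms(1) S(1) sub(1)] emeasure_chart_measure[OF assms(2) S(2) sub(2)] im by simp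
qed

lemma is_riemannian_measure_iff:
  "is_riemannian_measure A g M \<longleftrightarrow> sets M = sets borel \<and>
    (\<forall>c\<in>A. \<forall>S\<in>sets borel. S \<subseteq> chart_dom c \<longrightarrow> emeasure M S = emeasure (chart_measure c) (coords c ` S))"
proof -
  have "emeasure (chart_measure c) (coords c ` S)
      = (\<integral>\<^sup>+y\<in>coords c ` S. ennreal (sqrt (det (g c (param c y)))) \<partial>lborel)"
    if "c \<in> A" "S \<in> sets borel" "S \<subseteq> chart_dom c" for c S
    using emeasure_chart_measure[OF that(1) coords_image_borel[OF that]] that(3)
    by (simp add: vol_density_def image_mono)
  then show ?thesis unfolding is_riemannian_measure_def by auto
qed

lemma riemannian_measure_unique:
  assumes "is_riemannian_measure A g M" "is_riemannian_measure A g N"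
  shows "M = N"
proof (rule measure_eqI)
  show "sets M = sets N" using assms by (simp add: is_riemannian_measure_iff)
  fix S assume "S \<in> sets M"
  then have S: "S \<in> sets borel" using assms by (simp add: is_riemannian_measure_iff)
  obtain m :: nat and cs B where P: "\<And>i. i < m \<Longrightarrow> cs i \<in> A" "\<And>i. i < m \<Longrightarrow> B i \<in> sets borel"
    "\<And>i. i < m \<Longrightarrow> B i \<subseteq> chart_dom (cs i)" "disjoint_family_on B {..<m}" "(\<Union>i<m. B i) = UNIV"
    using finite_borel_partition by blast
  have "emeasure N' S = (\<Sum>i<m. emeasure (chart_measure (cs i)) (coords (cs i) ` (S \<inter> B i)))"
    if "is_riemannian_measure A g N'" for N'
  proof -
    have "emeasure N' (\<Union>i<m. S \<inter> B i) = (\<Sum>i<m. emeasure N' (S \<inter> B i))"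
      using that S P(2,4) by (intro sum_emeasure[symmetric])
        (auto simp: is_riemannian_measure_iff disjoint_family_on_def)
    moreover have "(\<Union>i<m. S \<inter> B i) = S" using P(5) by blast
    moreover have "emeasure N' (S \<inter> B i) = emeasure (chart_measure (cs i)) (coords (cs i) ` (S \<inter> B i))"
      if "i < m" for i
      using \<open>is_riemannian_measure A g N'\<close> S P(1-3)[OF that] unfolding is_riemannian_measure_iff by blast
    ultimately show ?thesis by simp
  qed
  then show "emeasure M S = emeasure N S" using assms by simp
qed

text \<open>The chart measures are summed over a Borel partition;
  \<open>chart_measure_transform\<close> makes the sum agree with every chart. With uniqueness this
  gives meaning to the \<open>THE\<close> in \<open>dvol\<close>.\<close>

lemma riemannian_measure_exists: "\<exists>M. is_riemannian_measure A g M"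
proof -
  obtain m :: nat and cs B where P: "\<And>i. i < m \<Longrightarrow> cs i \<in> A" "\<And>i. i < m \<Longrightarrow> B i \<in> sets borel"
    "\<And>i. i < m \<Longrightarrow> B i \<subseteq> chart_dom (cs i)" "disjoint_family_on B {..<m}" "(\<Union>i<m. B i) = UNIV"
    using finite_borel_partition by blast
  define \<mu> where "\<mu> S = (\<Sum>i<m. emeasure (chart_measure (cs i)) (coords (cs i) ` (S \<inter> B i)))" for S
  have im: "coords (cs i) ` (S \<inter> B i) \<in> sets (chart_measure (cs i))" if "i < m" "S \<in> sets borel" for i S
    using coords_image_borel[OF P(1)[OF that(1)], of "S \<inter> B i"] P(2,3)[OF that(1)] that(2) by auto
  have "countably_additive (sets borel) \<mu>"
  proof (rule countably_additiveI)
    fix S :: "nat \<Rightarrow> 'a set" assume S: "range S \<subseteq> sets borel" "disjoint_family S"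
    have "(\<Sum>n. emeasure (chart_measure (cs i)) (coords (cs i) ` (S n \<inter> B i)))
        = emeasure (chart_measure (cs i)) (coords (cs i) ` ((\<Union>n. S n) \<inter> B i))" if "i < m" for i
    proof -
      have "disjoint_family (\<lambda>n. coords (cs i) ` (S n \<inter> B i))"
        unfolding disjoint_family_on_def
      proof (intro ballI impI)
        fix a b :: nat assume "a \<noteq> b"
        then have "S a \<inter> S b = {}" using S(2) by (auto simp: disjoint_family_on_def)
        then show "coords (cs i) ` (S a \<inter> B i) \<inter> coords (cs i) ` (S b \<inter> B i) = {}"
          using P(3)[OF that] by (intro coords_image_disjoint P(1)[OF that]) auto
      qed
      moreover have "coords (cs i) ` ((\<Union>n. S n) \<inter> B i) = (\<Union>n. coords (cs i) ` (S n \<inter> B i))" by blast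
      moreover have "range (\<lambda>n. coords (cs i) ` (S n \<inter> B i)) \<subseteq> sets (chart_measure (cs i))"
        using im[OF that] S(1) by blast
      ultimately show ?thesis
        using suminf_emeasure[of "\<lambda>n. coords (cs i) ` (S n \<inter> B i)" "chart_measure (cs i)"] by simp
    qed
    then show "(\<Sum>n. \<mu> (S n)) = \<mu> (\<Union> (range S))"
      unfolding \<mu>_def by (subst suminf_sum) auto
  qed
  then have M: "emeasure (measure_of UNIV (sets borel) \<mu>) S = \<mu> S" if "S \<in> sets borel" for S
    using that sets.sigma_algebra_axioms[of borel] by (intro emeasure_measure_of_sigma)
      (auto simp: positive_def \<mu>_def)
  have "\<mu> S = emeasure (chart_measure c) (coords c ` S)"
    if c: "c \<in> A" "S \<in> sets borel" "S \<subseteq> chart_dom c" for c S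
  proof -
    have "\<mu> S = (\<Sum>i<m. emeasure (chart_measure c) (coords c ` (S \<inter> B i)))"
      unfolding \<mu>_def
    proof (rule sum.cong)
      fix i assume "i \<in> {..<m}"
      then show "emeasure (chart_measure (cs i)) (coords (cs i) ` (S \<inter> B i))
          = emeasure (chart_measure c) (coords c ` (S \<inter> B i))"
        using c P(1-3)[of i] by (intro chart_measure_transform) auto
    qed simp
    also have "\<dots> = emeasure (chart_measure c) (\<Union>i<m. coords c ` (S \<inter> B i))"
    proof (rule sum_emeasure)
      show "(\<lambda>i. coords c ` (S \<inter> B i)) ` {..<m} \<subseteq> sets (chart_measure c)"
        using c P(2) by (auto intro!: coords_image_borel)
      show "disjoint_family_on (\<lambda>i. coords c ` (S \<inter> B i)) {..<m}"
        unfolding disjoint_family_on_def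
      proof (intro ballI impI)
        fix a b assume "a \<in> {..<m}" "b \<in> {..<m}" "a \<noteq> b"
        then have "B a \<inter> B b = {}" using P(4) by (auto simp: disjoint_family_on_def)
        then show "coords c ` (S \<inter> B a) \<inter> coords c ` (S \<inter> B b) = {}"
          using c(3) by (intro coords_image_disjoint c(1)) auto
      qed
    qed simp
    also have "(\<Union>i<m. coords c ` (S \<inter> B i)) = coords c ` S" using P(5) by blast
    finally show ?thesis .
  qed
  then have "is_riemannian_measure A g (measure_of UNIV (sets borel) \<mu>)"
    unfolding is_riemannian_measure_iff using M sets.sigma_sets_eq[of borel] by simp
  then show ?thesis by blast
qed

lemma is_riemannian_measure_dvol: "is_riemannian_measure A g (dvol A g)"
proof -
  obtain M where M: "is_riemannian_measure A g M" using riemannian_measure_exists by blast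
  then have "dvol A g = M"
    unfolding dvol_def by (rule the_equality) (rule riemannian_measure_unique[OF _ M])
  with M show ?thesis by simp
qed

lemma sets_dvol [simp, measurable_cong]: "sets (dvol A g) = sets borel"
  using is_riemannian_measure_dvol by (simp add: is_riemannian_measure_iff)

lemma space_dvol [simp]: "space (dvol A g) = UNIV"
  unfolding sets_eq_imp_space_eq[OF sets_dvol] by (rule space_borel)

lemma emeasure_dvol:
  "c \<in> A \<Longrightarrow> S \<in> sets borel \<Longrightarrow> S \<subseteq> chart_dom c \<Longrightarrow>
    emeasure (dvol A g) S = emeasure (chart_measure c) (coords c ` S)"
  using is_riemannian_measure_dvol by (simp add: is_riemannian_measure_iff)

text \<open>The volume density is continuous, hence integrable over a closed coordinate ball;
  finitely many such balls cover the compact space.\<close>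

lemma finite_measure_dvol: "finite_measure (dvol A g)"
proof
  have "\<exists>U. open U \<and> p \<in> U \<and> emeasure (dvol A g) U < \<infinity>" for p
  proof -
    obtain c where c: "c \<in> A" "p \<in> chart_dom c" using chart_exists by blast
    then obtain r where r: "r > 0" "cball (coords c p) r \<subseteq> chart_img c"
      using open_img[OF c(1)] by (meson image_eqI open_contains_cball)
    define U where "U = chart_dom c \<inter> coords c -` ball (coords c p) r"
    have "open U" unfolding U_def
      by (intro continuous_open_preimage continuous_on_coords open_dom c) auto
    moreover have "p \<in> U" using c r by (simp add: U_def)
    moreover have "emeasure (dvol A g) U < \<infinity>"
    proof -
      have "coords c ` U \<in> sets borel"
        using \<open>open U\<close> c(1) by (intro coords_image_borel) (auto simp: U_def)
      have "emeasure (dvol A g) U = emeasure (chart_measure c) (coords c ` U)"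
        using \<open>open U\<close> c(1) by (intro emeasure_dvol) (auto simp: U_def)
      also have "\<dots> \<le> emeasure (chart_measure c) (cball (coords c p) r)"
        by (intro emeasure_mono) (auto simp: U_def)
      also have "\<dots> = (\<integral>\<^sup>+y\<in>cball (coords c p) r. ennreal (vol_density g c y) \<partial>lborel)"
        using r by (intro emeasure_chart_measure c) auto
      also have "\<dots> = (\<integral>\<^sup>+y. ennreal (norm (indicator (cball (coords c p) r) y *\<^sub>R vol_density g c y)) \<partial>lborel)"
        using r vol_density_pos[OF c(1)] by (intro nn_integral_cong) (force simp: indicator_def)
      also have "\<dots> < \<infinity>"
      proof -
        have "integrable lborel (\<lambda>y. indicator (cball (coords c p) r) y *\<^sub>R vol_density g c y)"
          using continuous_on_subset[OF continuous_on_vol_density[OF c(1)] r(2)]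
          by (intro borel_integrable_compact) auto
        then show ?thesis by (simp add: integrable_iff_bounded)
      qed
      finally show ?thesis .
    qed
    ultimately show ?thesis by blast
  qed
  then obtain U where U: "\<And>p. open (U p)" "\<And>p. p \<in> U p" "\<And>p. emeasure (dvol A g) (U p) < \<infinity>" by metis
  obtain F where F: "finite F" "UNIV \<subseteq> (\<Union>p\<in>F. U p)"
    using compactE_image[OF compact_UNIV, of UNIV U] U(1,2) by (metis UNIV_I UN_I subsetI)
  have "emeasure (dvol A g) UNIV \<le> emeasure (dvol A g) (\<Union>p\<in>F. U p)"
    using F U(1) by (intro emeasure_mono) (auto intro!: sets.finite_UN)
  also have "\<dots> \<le> (\<Sum>p\<in>F. emeasure (dvol A g) (U p))"
    using F U(1) by (intro emeasure_subadditive_finite) auto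
  also have "\<dots> < \<infinity>" using U(3) F(1) by (simp add: less_top[symmetric])
  finally show "emeasure (dvol A g) (space (dvol A g)) \<noteq> \<infinity>" by simp
qed

text \<open>Outside the image of the chart the values of \<open>param c\<close> are junk, hence the case distinction.\<close>

lemma density_dvol_eq_distr:
  fixes p0 :: 'a
  assumes c: "c \<in> A"
  defines "par \<equiv> (\<lambda>y. if y \<in> chart_img c then param c y else p0)"
  shows "par \<in> borel_measurable borel"
    and "density (dvol A g) (indicator (chart_dom c)) = distr (chart_measure c) borel par"
proof -
  have [measurable]: "chart_img c \<in> sets borel" "chart_dom c \<in> sets borel"
    using open_img[OF c] open_dom[OF c] by auto
  show m: "par \<in> borel_measurable borel"
    unfolding par_def using continuous_on_param[OF c]
    by (intro measurable_If_restrict_space_iff[THEN iffD2])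
      (auto intro!: borel_measurable_continuous_on_restrict simp: Collect_mem_eq)
  show "density (dvol A g) (indicator (chart_dom c)) = distr (chart_measure c) borel par"
  proof (rule measure_eqI)
    fix S assume "S \<in> sets (density (dvol A g) (indicator (chart_dom c)))"
    then have S[measurable]: "S \<in> sets borel" by simp
    have "emeasure (density (dvol A g) (indicator (chart_dom c))) S
        = (\<integral>\<^sup>+p. indicator (chart_dom c) p * indicator S p \<partial>dvol A g)"
      by (rule emeasure_density) auto
    also have "\<dots> = (\<integral>\<^sup>+p. indicator (chart_dom c \<inter> S) p \<partial>dvol A g)"
      by (intro nn_integral_cong) (auto split: split_indicator)
    also have "\<dots> = emeasure (dvol A g) (chart_dom c \<inter> S)"
      by (subst nn_integral_indicator) auto
    also have "\<dots> = emeasure (chart_measure c) (coords c ` (chart_dom c \<inter> S))"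
      by (rule emeasure_dvol[OF c]) auto
    also have "\<dots> = emeasure (chart_measure c) (par -` S)"
    proof -
      have *: "coords c ` (chart_dom c \<inter> S) = chart_img c \<inter> par -` S"
        unfolding coords_image_eq[OF c Int_lower1] par_def using param_in_dom[OF c] by auto
      have pS: "par -` S \<in> sets borel" using measurable_sets[OF m S] by simp
      have e: "emeasure (chart_measure c) T
          = (\<integral>\<^sup>+y. ennreal (indicator (chart_img c) y * vol_density g c y) * indicator T y \<partial>lborel)"
        if "T \<in> sets borel" for T
        unfolding chart_measure_def using that c by (intro emeasure_density) auto
      have pS': "chart_img c \<inter> par -` S \<in> sets borel" using pS by auto
      show ?thesis unfolding * e[OF pS] e[OF pS']
        by (intro nn_integral_cong) (auto split: split_indicator)
    qed
    also have "\<dots> = emeasure (distr (chart_measure c) borel par) S"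
    proof -
      have "par \<in> measurable (chart_measure c) borel" using m by (simp add: chart_measure_def)
      from emeasure_distr[OF this S] show ?thesis by (simp add: chart_measure_def)
    qed
    finally show "emeasure (density (dvol A g) (indicator (chart_dom c))) S = emeasure (distr (chart_measure c) borel par) S" .
  qed simp
qed

lemma nn_integral_chart:
  assumes c: "c \<in> A" and [measurable]: "f \<in> borel_measurable borel" and S: "S \<in> sets borel" "S \<subseteq> chart_dom c"
  shows "(\<integral>\<^sup>+p\<in>S. f p \<partial>dvol A g)
    = (\<integral>\<^sup>+y\<in>coords c ` S. f (param c y) * ennreal (vol_density g c y) \<partial>lborel)"
proof -
  note [measurable] = S(1)
  have [measurable]: "chart_img c \<in> sets borel" "chart_dom c \<in> sets borel"
    using open_img[OF c] open_dom[OF c] by auto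
  define par where "par y = (if y \<in> chart_img c then param c y else undefined)" for y
  have m[measurable]: "par \<in> borel_measurable borel"
    and eq: "density (dvol A g) (indicator (chart_dom c)) = distr (chart_measure c) borel par"
    using density_dvol_eq_distr[OF c, of undefined] unfolding par_def by auto
  have m'[measurable]: "par \<in> measurable (chart_measure c) borel" using m by (simp add: chart_measure_def)
  have "(\<integral>\<^sup>+p\<in>S. f p \<partial>dvol A g) = (\<integral>\<^sup>+p. indicator (chart_dom c) p * (f p * indicator S p) \<partial>dvol A g)"
    using S(2) by (intro nn_integral_cong) (auto split: split_indicator)
  also have "\<dots> = (\<integral>\<^sup>+p. f p * indicator S p \<partial>density (dvol A g) (indicator (chart_dom c)))"
    by (subst nn_integral_density) auto
  also have "\<dots> = (\<integral>\<^sup>+y. f (par y) * indicator S (par y) \<partial>chart_measure c)"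
    unfolding eq by (subst nn_integral_distr) auto
  also have "\<dots> = (\<integral>\<^sup>+y. ennreal (indicator (chart_img c) y * vol_density g c y) * (f (par y) * indicator S (par y)) \<partial>lborel)"
    unfolding chart_measure_def using c by (subst nn_integral_density) auto
  also have "\<dots> = (\<integral>\<^sup>+y\<in>coords c ` S. f (param c y) * ennreal (vol_density g c y) \<partial>lborel)"
    unfolding coords_image_eq[OF c S(2)]
    by (intro nn_integral_cong) (auto simp: par_def mult_ac split: split_indicator)
  finally show ?thesis .
qed

lemma integral_chart:
  assumes c: "c \<in> A" and [measurable]: "w \<in> borel_measurable borel" and w: "\<And>p. p \<notin> chart_dom c \<Longrightarrow> w p = 0"
  shows "(\<integral>p. w p \<partial>dvol A g)
    = (\<integral>y. indicator (chart_img c) y * (vol_density g c y * w (param c y)) \<partial>lborel)" (is ?I)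
    and "integrable (dvol A g) w \<longleftrightarrow>
      integrable lborel (\<lambda>y. indicator (chart_img c) y * (vol_density g c y * w (param c y)))" (is ?J)
proof -
  have [measurable]: "chart_img c \<in> sets borel" "chart_dom c \<in> sets borel"
    using open_img[OF c] open_dom[OF c] by auto
  define par where "par y = (if y \<in> chart_img c then param c y else undefined)" for y
  have m[measurable]: "par \<in> borel_measurable borel"
    and eq: "density (dvol A g) (indicator (chart_dom c)) = distr (chart_measure c) borel par"
    using density_dvol_eq_distr[OF c, of undefined] unfolding par_def by auto
  have eq: "density (dvol A g) (\<lambda>p. ennreal (indicator (chart_dom c) p)) = distr (chart_measure c) borel par"
    unfolding eq[symmetric] by (rule arg_cong[of _ _ "density (dvol A g)"]) (auto split: split_indicator)
  have m'[measurable]: "par \<in> measurable (chart_measure c) borel" using m by (simp add: chart_measure_def)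
  have w': "w = (\<lambda>p. indicator (chart_dom c) p *\<^sub>R w p)" using w by (auto simp: fun_eq_iff split: split_indicator)
  have par: "(indicator (chart_img c) y * vol_density g c y) *\<^sub>R w (par y)
      = indicator (chart_img c) y * (vol_density g c y * w (param c y))" for y
    by (auto simp: par_def split: split_indicator)
  have nn: "0 \<le> indicator (chart_img c) y * vol_density g c y" for y
    using vol_density_pos[OF c, of y] by (auto simp: less_imp_le split: split_indicator)
  have "(\<integral>p. w p \<partial>dvol A g) = (\<integral>p. w p \<partial>density (dvol A g) (\<lambda>p. ennreal (indicator (chart_dom c) p)))"
    by (subst integral_density) (use w' in \<open>auto simp: space_borel\<close>)
  also have "\<dots> = (\<integral>y. w (par y) \<partial>chart_measure c)"
    unfolding eq by (subst integral_distr) auto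
  also have "\<dots> = (\<integral>y. (indicator (chart_img c) y * vol_density g c y) *\<^sub>R w (par y) \<partial>lborel)"
    unfolding chart_measure_def using c nn by (subst integral_density) auto
  finally show ?I unfolding par .
  have "integrable (dvol A g) w \<longleftrightarrow> integrable (density (dvol A g) (\<lambda>p. ennreal (indicator (chart_dom c) p))) w"
    by (subst integrable_density) (use w' in auto)
  also have "\<dots> \<longleftrightarrow> integrable (chart_measure c) (\<lambda>y. w (par y))"
    unfolding eq by (subst integrable_distr_eq) auto
  also have "\<dots> \<longleftrightarrow> integrable lborel (\<lambda>y. (indicator (chart_img c) y * vol_density g c y) *\<^sub>R w (par y))"
    unfolding chart_measure_def using c nn by (subst integrable_density) auto
  finally show ?J unfolding par .
qed

end

section \<open>Integrals of derivatives of compactly supported functions\<close>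

lemma compactly_supported_integrable:
  fixes G :: "'b::euclidean_space \<Rightarrow> real"
  assumes "compact K" "continuous_on UNIV G" "\<And>y. y \<notin> K \<Longrightarrow> G y = 0"
  shows "integrable lborel G"
proof -
  have "G = (\<lambda>y. indicator K y *\<^sub>R G y)" using assms(3) by (auto simp: fun_eq_iff split: split_indicator)
  moreover have "integrable lborel (\<lambda>y. indicator K y *\<^sub>R G y)"
    by (intro borel_integrable_compact assms continuous_on_subset[OF assms(2)]) auto
  ultimately show ?thesis by simp
qed

lemma integral_translate:
  fixes G :: "'b::euclidean_space \<Rightarrow> real"
  assumes "G \<in> borel_measurable borel"
  shows "(\<integral>x. G (c + x) \<partial>lborel) = (\<integral>x. G x \<partial>lborel)"
  using integral_distr[of "(+) c" lborel borel G] assms by (simp add: lborel_distr_plus)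

text \<open>Averaging over the translations by \<open>t e\<close> with \<open>0 \<le> t \<le> 1\<close> does not change the integral of
  the derivative, and turns the integrand into the difference \<open>F (x + e) - F x\<close>.\<close>

lemma integral_directional_derivative:
  fixes F G :: "'b::euclidean_space \<Rightarrow> real"
  assumes K: "compact K" and F0: "\<And>y. y \<notin> K \<Longrightarrow> F y = 0" and G0: "\<And>y. y \<notin> K \<Longrightarrow> G y = 0"
    and G: "continuous_on UNIV G"
    and F: "\<And>y. (F has_derivative D y) (at y)" "\<And>y. D y e = G y"
  shows "(\<integral>y. G y \<partial>lborel) = 0"
proof -
  have contF: "continuous_on UNIV F"
    using F(1) by (intro continuous_at_imp_continuous_on) (auto intro: has_derivative_continuous)
  have intF: "integrable lborel F" by (rule compactly_supported_integrable[OF K contF F0])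
  have intG: "integrable lborel G" by (rule compactly_supported_integrable[OF K G G0])
  have mF: "F \<in> borel_measurable borel" and mG: "G \<in> borel_measurable borel"
    using contF G by (auto intro: borel_measurable_continuous_onI)
  have line: "((\<lambda>t. F (x + t *\<^sub>R e)) has_vector_derivative G (x + t *\<^sub>R e)) (at t)" for x t
  proof -
    have "((\<lambda>t. x + t *\<^sub>R e) has_derivative (\<lambda>s. s *\<^sub>R e)) (at t)"
      by (auto intro!: derivative_eq_intros)
    from diff_chain_at[OF this F(1)]
    have *: "((\<lambda>t. F (x + t *\<^sub>R e)) has_derivative (\<lambda>s. D (x + t *\<^sub>R e) (s *\<^sub>R e))) (at t)"
      by (simp add: o_def)
    have "linear (D (x + t *\<^sub>R e))" using F(1) has_derivative_linear by blast
    then have "D (x + t *\<^sub>R e) (s *\<^sub>R e) = s *\<^sub>R G (x + t *\<^sub>R e)" for s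
      using F(2) linear_cmul by metis
    then show ?thesis using * unfolding has_vector_derivative_def by simp
  qed
  have FTC: "(\<integral>t. indicator {0..1} t *\<^sub>R G (x + t *\<^sub>R e) \<partial>lborel) = F (x + e) - F x" for x
  proof -
    have "has_bochner_integral lborel (\<lambda>t. indicator {0..1} t *\<^sub>R G (x + t *\<^sub>R e))
        (F (x + 1 *\<^sub>R e) - F (x + 0 *\<^sub>R e))"
    proof (rule has_bochner_integral_FTC_Icc)
      show "continuous_on {0..1} (\<lambda>t. G (x + t *\<^sub>R e))"
        by (rule continuous_on_compose2[OF G]) (auto intro!: continuous_intros)
    qed (auto intro: has_vector_derivative_at_within[OF line])
    then show ?thesis by (simp add: has_bochner_integral_integral_eq)
  qed
  define H where "H = (\<lambda>(x, t). indicator {0..1::real} t *\<^sub>R G (x + t *\<^sub>R e))"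
  \<comment> \<open>The sheared image of \<open>K \<times> {0..1}\<close>, outside which
    \<open>H\<close> vanishes. Its compactness gives the joint integrability required by Fubini's
    theorem.\<close>
  define K' where "K' = (\<lambda>(k, t). (k - t *\<^sub>R e, t)) ` (K \<times> {0..1::real})"
  have "compact K'" unfolding K'_def
    by (intro compact_continuous_image compact_Times K)
      (auto simp: case_prod_unfold intro!: continuous_intros)
  have "H = (\<lambda>z. indicator K' z *\<^sub>R G (fst z + snd z *\<^sub>R e))"
  proof (rule ext, clarify)
    fix x :: 'b and t :: real
    have "(x, t) \<in> K' \<longleftrightarrow> t \<in> {0..1} \<and> x + t *\<^sub>R e \<in> K"
    proof
      assume "t \<in> {0..1} \<and> x + t *\<^sub>R e \<in> K"
      then show "(x, t) \<in> K'"
        unfolding K'_def by (intro image_eqI[of _ _ "(x + t *\<^sub>R e, t)"]) auto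
    qed (auto simp: K'_def)
    then show "H (x, t) = indicator K' (x, t) *\<^sub>R G (fst (x, t) + snd (x, t) *\<^sub>R e)"
      using G0 by (auto simp: H_def split: split_indicator)
  qed
  moreover have "integrable lborel (\<lambda>z. indicator K' z *\<^sub>R G (fst z + snd z *\<^sub>R e))"
    by (intro borel_integrable_compact \<open>compact K'\<close> continuous_on_compose2[OF G])
      (auto intro!: continuous_intros)
  ultimately have "integrable (lborel \<Otimes>\<^sub>M lborel) H" by (simp add: lborel_prod)
  \<comment> \<open>Integrating over \<open>x\<close> first gives the integral of \<open>G\<close>
    for each \<open>t\<close> in the unit interval; integrating over \<open>t\<close> first gives
    the difference of a function and its translate.\<close>
  then have "(\<integral>t. \<integral>x. H (x, t) \<partial>lborel \<partial>lborel) = (\<integral>x. \<integral>t. H (x, t) \<partial>lborel \<partial>lborel)"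
    using lborel_pair.Fubini_integral[of "\<lambda>x t. H (x, t)"] by (simp add: case_prod_eta)
  moreover have "(\<integral>x. H (x, t) \<partial>lborel) = indicator {0..1} t * (\<integral>x. G x \<partial>lborel)" for t
    using integral_translate[OF mG, of "t *\<^sub>R e"] by (simp add: H_def add.commute)
  moreover have "(\<integral>t. H (x, t) \<partial>lborel) = F (x + e) - F x" for x
    using FTC[of x] by (simp add: H_def)
  moreover have "(\<integral>x. F (x + e) - F x \<partial>lborel) = 0"
  proof -
    have "integrable lborel (\<lambda>x. F (e + x))"
      using integrable_distr_eq[of "(+) e" lborel borel F] mF intF by (simp add: lborel_distr_plus)
    then show ?thesis
      using intF integral_translate[OF mF, of e] by (simp add: add.commute)
  qed
  ultimately show ?thesis by simp
qed

section \<open>More rules for continuously differentiable functions\<close>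

lemma C1_compose_scalar:
  fixes f :: "real^'n::finite \<Rightarrow> real"
  assumes f: "C_k (Suc 0) f S" and \<psi>: "\<And>x. x \<in> S \<Longrightarrow> (\<psi> has_real_derivative \<psi>' (f x)) (at (f x))"
    and \<psi>': "continuous_on (f ` S) \<psi>'"
  shows "C_k (Suc 0) (\<lambda>y. \<psi> (f y)) S"
    and "x \<in> S \<Longrightarrow> pd i (\<lambda>y. \<psi> (f y)) x = \<psi>' (f x) * pd i f x"
proof -
  have d: "((\<lambda>y. \<psi> (f y)) has_derivative (\<lambda>v. \<psi>' (f x) * frechet_derivative f (at x) v)) (at x)"
    if "x \<in> S" for x
    using diff_chain_at[of f "frechet_derivative f (at x)" x \<psi> "(*) (\<psi>' (f x))"] C1_D(1)[OF f that] \<psi>[OF that]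
    by (simp add: frechet_derivative_works has_field_derivative_def o_def)
  have pd: "pd i (\<lambda>y. \<psi> (f y)) x = \<psi>' (f x) * pd i f x" if "x \<in> S" for x i
    using pd_eqI[OF d[OF that]] by (simp add: pd_def)
  then show "x \<in> S \<Longrightarrow> pd i (\<lambda>y. \<psi> (f y)) x = \<psi>' (f x) * pd i f x" .
  have cont: "continuous_on S (\<lambda>x. \<psi>' (f x) * pd i f x)" for i
    by (intro continuous_intros continuous_on_compose2[OF \<psi>'] C1_D[OF f]) auto
  have "continuous_on S (pd i (\<lambda>y. \<psi> (f y)))" for i
    by (rule continuous_on_eq[OF cont[of i]]) (simp add: pd)
  moreover have "(\<lambda>y. \<psi> (f y)) differentiable (at x)" if "x \<in> S" for x
    using d[OF that] by (rule differentiableI)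
  ultimately show "C_k (Suc 0) (\<lambda>y. \<psi> (f y)) S" by (simp add: C_k_Suc_pd C_k.simps)
qed

lemma C1_prod:
  fixes f :: "'j \<Rightarrow> real^'n::finite \<Rightarrow> real"
  assumes "finite J" "\<And>j. j \<in> J \<Longrightarrow> C_k (Suc 0) (f j) S"
  shows "C_k (Suc 0) (\<lambda>y. \<Prod>j\<in>J. f j y) S"
  using assms by (induction J rule: finite_induct) (simp_all add: C1_const C1_mult)

lemma C1_diff:
  fixes f g :: "real^'n::finite \<Rightarrow> real"
  assumes "C_k (Suc 0) f S" "C_k (Suc 0) g S"
  shows "C_k (Suc 0) (\<lambda>y. f y - g y) S"
proof -
  have "C_k (Suc 0) (\<lambda>y. \<Sum>b\<in>UNIV. (if b then f y else - 1 * g y)) S"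
  proof (rule C1_sum)
    fix b :: bool
    show "C_k (Suc 0) (\<lambda>y. if b then f y else - 1 * g y) S"
      using assms C1_mult[OF C1_const[of "-1"] assms(2)] by (cases b) simp_all
  qed simp
  then show ?thesis by (simp add: UNIV_bool)
qed

lemma C1_det:
  fixes m :: "real^'n::finite \<Rightarrow> real^'k::finite^'k"
  assumes "\<And>i j. C_k (Suc 0) (\<lambda>y. m y $ i $ j) S"
  shows "C_k (Suc 0) (\<lambda>y. det (m y)) S"
  unfolding det_def by (intro C1_sum C1_mult C1_const C1_prod assms) auto

lemma C1_matrix_inv:
  fixes m :: "real^'n::finite \<Rightarrow> real^'k::finite^'k"
  assumes "open S" "\<And>i j. C_k (Suc 0) (\<lambda>y. m y $ i $ j) S" "\<And>y. y \<in> S \<Longrightarrow> det (m y) \<noteq> 0"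
  shows "C_k (Suc 0) (\<lambda>y. matrix_inv (m y) $ k $ l) S"
proof (rule C_k_cong[OF assms(1)])
  show "C_k (Suc 0) (\<lambda>y. det (\<chi> i j. if j = k then axis l 1 $ i else m y $ i $ j) / det (m y)) S"
  proof (intro C1_divide C1_det assms)
    fix i j
    show "C_k (Suc 0) (\<lambda>y. (\<chi> i j. if j = k then axis l 1 $ i else m y $ i $ j) $ i $ j) S"
      using assms(2) C1_const by (cases "j = k") simp_all
  qed
qed (simp add: matrix_inv_cramer assms(3))

section \<open>Partitions of unity\<close>

text \<open>The divergence theorem differentiates cut-off functions once, so this class is enough
  and allows explicit polynomial bumps.\<close>

definition C1_function :: "('a, 'n::finite) atlas \<Rightarrow> ('a \<Rightarrow> real) \<Rightarrow> bool" where
  "C1_function A \<phi> \<longleftrightarrow> (\<forall>c\<in>A. C_k (Suc 0) (\<phi> \<circ> param c) (chart_img c))"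

lemma pos_part_square_deriv:
  "((\<lambda>x::real. (max 0 x)\<^sup>2) has_real_derivative 2 * max 0 x) (at x)"
proof (cases x "0 :: real" rule: linorder_cases)
  case less
  have "((\<lambda>x::real. 0) has_real_derivative 0) (at x)" by simp
  then show ?thesis
    by (rule has_field_derivative_transform_within_open[where S="{..<0}", THEN DERIV_cong]) (use less in auto)
next
  case equal
  have "((\<lambda>h::real. (max 0 h)\<^sup>2 / h) \<longlongrightarrow> 0) (at 0)"
  proof (rule Lim_null_comparison)
    show "\<forall>\<^sub>F h in at 0. norm ((max 0 h)\<^sup>2 / h) \<le> \<bar>h\<bar>"
      by (intro always_eventually allI) (auto simp: max_def power2_eq_square)
    show "((\<lambda>h::real. \<bar>h\<bar>) \<longlongrightarrow> 0) (at 0)" by (rule tendsto_eq_intros) (auto intro: tendsto_intros)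
  qed
  then show ?thesis unfolding DERIV_def using equal by simp
next
  case greater
  have "((\<lambda>x::real. x\<^sup>2) has_real_derivative 2 * x) (at x)" by (auto intro!: derivative_eq_intros)
  then show ?thesis
    by (rule has_field_derivative_transform_within_open[where S="{0<..}", THEN DERIV_cong]) (use greater in auto)
qed

text \<open>The squared positive part of r^2 minus the squared coordinate distance to
  \<open>p\<close>; squaring makes it join zero with a continuous first derivative. The distance is
  a sum of products to fit the rules \<open>C1_sum\<close> and \<open>C1_mult\<close>.\<close>

definition bump :: "('a, 'n::finite) chart \<Rightarrow> 'a \<Rightarrow> real \<Rightarrow> 'a \<Rightarrow> real" where
  "bump c p r q = (if q \<in> chart_dom c
     then (max 0 (r\<^sup>2 - (\<Sum>k\<in>UNIV. (coords c q $ k - coords c p $ k) * (coords c q $ k - coords c p $ k))))\<^sup>2 else 0)"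

context compact_manifold
begin

lemma compact_param_cball:
  assumes "c \<in> A" "cball a r \<subseteq> chart_img c"
  shows "compact (param c ` cball a r)" "param c ` cball a r \<subseteq> chart_dom c"
  using assms by (auto intro!: compact_continuous_image continuous_on_subset[OF continuous_on_param] param_in_dom)

lemma bump_zero:
  assumes "c \<in> A" "r > 0" "q \<notin> param c ` cball (coords c p) r"
  shows "bump c p r q = 0"
proof (cases "q \<in> chart_dom c")
  case True
  then have "coords c q \<notin> cball (coords c p) r" using assms by (metis image_eqI param_coords)
  then have "r\<^sup>2 < (dist (coords c p) (coords c q))\<^sup>2"
    using assms(2) by (intro power_strict_mono) auto
  also have "(dist (coords c p) (coords c q))\<^sup>2
      = (\<Sum>k\<in>UNIV. (coords c q $ k - coords c p $ k) * (coords c q $ k - coords c p $ k))"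
    by (simp add: dist_norm power2_norm_eq_inner inner_vec_def algebra_simps)
  finally show ?thesis by (simp add: bump_def)
qed (simp add: bump_def)

lemma bump_nonneg: "0 \<le> bump c p r q"
  by (simp add: bump_def)

lemma bump_pos:
  assumes "c \<in> A" "p \<in> chart_dom c" "r > 0" "q \<in> chart_dom c" "coords c q \<in> ball (coords c p) r"
  shows "0 < bump c p r q"
proof -
  have "(\<Sum>k\<in>UNIV. (coords c q $ k - coords c p $ k) * (coords c q $ k - coords c p $ k))
      = (dist (coords c p) (coords c q))\<^sup>2"
    by (simp add: dist_norm power2_norm_eq_inner inner_vec_def algebra_simps)
  also have "\<dots> < r\<^sup>2"
    using assms(3,5) by (intro power_strict_mono) auto
  finally show ?thesis using assms by (simp add: bump_def)
qed

text \<open>At points of the domain of \<open>c\<close> the bump is a polynomial expression in the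
  transition map followed by the squared positive part; at all other points it vanishes on a
  neighbourhood.\<close>

lemma bump_C1:
  assumes c: "c \<in> A" "r > 0" "cball (coords c p) r \<subseteq> chart_img c"
  shows "C1_function A (bump c p r)"
  unfolding C1_function_def
proof (intro ballI C_k_local)
  fix d y assume d: "d \<in> A" "y \<in> chart_img d"
  show "\<exists>U. open U \<and> y \<in> U \<and> U \<subseteq> chart_img d \<and> C_k (Suc 0) (bump c p r \<circ> param d) U"
  proof (cases "param d y \<in> chart_dom c")
    case True
    let ?U = "coords d ` (chart_dom d \<inter> chart_dom c)"
    have op: "open ?U" using c d by (intro open_coords_image) (auto intro: open_dom)
    have "y \<in> ?U" using True d param_in_dom by (metis IntI coords_param image_eqI)
    let ?f = "\<lambda>y. r\<^sup>2 - (\<Sum>k\<in>UNIV. ((coords c \<circ> param d) y $ k - coords c p $ k) * ((coords c \<circ> param d) y $ k - coords c p $ k))"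
    have "C_k (Suc 0) (\<lambda>y. (max 0 (?f y))\<^sup>2) ?U"
    proof (rule C1_compose_scalar(1)[where \<psi>="\<lambda>x. (max 0 x)\<^sup>2" and \<psi>'="\<lambda>x. 2 * max 0 x"])
      show "C_k (Suc 0) ?f ?U"
        using C1_component[OF transition_C_k[OF d(1) c(1), of "Suc 0"] bounded_linear_vec_nth]
        by (intro C1_diff C1_const C1_sum C1_mult) auto
    qed (auto intro!: pos_part_square_deriv continuous_intros)
    then have "C_k (Suc 0) (bump c p r \<circ> param d) ?U"
      by (rule C_k_cong[OF op, rotated]) (use d in \<open>auto simp: bump_def\<close>)
    then show ?thesis using op \<open>y \<in> ?U\<close> by (intro exI[of _ ?U]) auto
  next
    case False
    let ?K = "param c ` cball (coords c p) r"
    let ?U = "chart_img d \<inter> param d -` (- ?K)"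
    \<comment> \<open>The Hausdorff property enters here: the compact ball is closed in the
      manifold, so its complement is a neighbourhood on which the bump is zero.\<close>
    have K: "closed ?K" "?K \<subseteq> chart_dom c"
      using compact_param_cball[OF c(1,3)] compact_imp_closed by blast+
    then have op: "open ?U" using d
      by (intro continuous_open_preimage continuous_on_param open_img) auto
    have "y \<in> ?U" using False K d by auto
    have "C_k (Suc 0) (\<lambda>y. 0 :: real) ?U" by (rule C1_const)
    then have "C_k (Suc 0) (bump c p r \<circ> param d) ?U"
      by (rule C_k_cong[OF op, rotated]) (use bump_zero[OF c(1,2)] in auto)
    then show ?thesis using op \<open>y \<in> ?U\<close> by (intro exI[of _ ?U]) auto
  qed
qed

text \<open>Finitely many bumps have a positive sum by compactness, and division by it normalises
  them. The index set consists of the centres of the bumps.\<close>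

lemma partition_of_unity:
  obtains J :: "'a set" and cs K and \<phi> :: "'a \<Rightarrow> 'a \<Rightarrow> real" where "finite J" "\<And>j. j \<in> J \<Longrightarrow> cs j \<in> A"
    "\<And>j. j \<in> J \<Longrightarrow> compact (K j)" "\<And>j. j \<in> J \<Longrightarrow> K j \<subseteq> chart_dom (cs j)"
    "\<And>j. j \<in> J \<Longrightarrow> C1_function A (\<phi> j)" "\<And>j q. j \<in> J \<Longrightarrow> q \<notin> K j \<Longrightarrow> \<phi> j q = 0"
    "\<And>q. (\<Sum>j\<in>J. \<phi> j q) = 1"
proof -
  have "\<exists>c r. c \<in> A \<and> p \<in> chart_dom c \<and> r > 0 \<and> cball (coords c p) r \<subseteq> chart_img c" for p
  proof -
    obtain c where c: "c \<in> A" "p \<in> chart_dom c" using chart_exists by blast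
    then obtain r where "r > 0" "cball (coords c p) r \<subseteq> chart_img c"
      using open_img[OF c(1)] by (meson image_eqI open_contains_cball)
    then show ?thesis using c by blast
  qed
  then obtain cs r where cr: "\<And>p. cs p \<in> A" "\<And>p. p \<in> chart_dom (cs p)" "\<And>p. r p > 0"
    "\<And>p. cball (coords (cs p) p) (r p) \<subseteq> chart_img (cs p)" by metis
  define U where "U p = chart_dom (cs p) \<inter> coords (cs p) -` ball (coords (cs p) p) (r p)" for p
  have U: "open (U p)" "p \<in> U p" for p
    unfolding U_def using cr by (auto intro!: continuous_open_preimage continuous_on_coords open_dom)
  obtain J where J: "finite J" "UNIV \<subseteq> (\<Union>p\<in>J. U p)"
    using compactE_image[OF compact_UNIV, of UNIV U] U by (metis UNIV_I UN_I subsetI)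
  define b where "b p = bump (cs p) p (r p)" for p
  have b0: "0 \<le> b p q" for p q by (simp add: b_def bump_nonneg)
  have pos: "0 < (\<Sum>p\<in>J. b p q)" for q
  proof -
    obtain p where "p \<in> J" "q \<in> U p" using J(2) by blast
    then have "0 < b p q" unfolding b_def U_def using cr by (intro bump_pos) auto
    then show ?thesis using \<open>p \<in> J\<close> J(1) b0 by (intro sum_pos2) auto
  qed
  have bC1: "C1_function A (b p)" for p unfolding b_def by (rule bump_C1[OF cr(1,3,4)])
  show ?thesis
  proof (rule that[of J cs "\<lambda>p. param (cs p) ` cball (coords (cs p) p) (r p)" "\<lambda>p q. b p q / (\<Sum>p'\<in>J. b p' q)"])
    show "C1_function A (\<lambda>q. b p q / (\<Sum>p'\<in>J. b p' q))" for p
      unfolding C1_function_def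
    proof
      fix c assume c: "c \<in> A"
      have "C_k (Suc 0) (\<lambda>y. (b p \<circ> param c) y / (\<Sum>p'\<in>J. (b p' \<circ> param c) y)) (chart_img c)"
      proof (intro C1_divide C1_sum J(1))
        show "(\<Sum>p'\<in>J. (b p' \<circ> param c) y) \<noteq> 0" for y
          using pos[of "param c y"] by simp
        show "C_k (Suc 0) (b p' \<circ> param c) (chart_img c)" for p'
          using bC1[of p'] c by (simp add: C1_function_def)
        then show "C_k (Suc 0) (b p' \<circ> param c) (chart_img c)" for p' .
      qed
      then show "C_k (Suc 0) ((\<lambda>q. b p q / (\<Sum>p'\<in>J. b p' q)) \<circ> param c) (chart_img c)"
        by (simp add: o_def)
    qed
    show "b p q / (\<Sum>p'\<in>J. b p' q) = 0" if "q \<notin> param (cs p) ` cball (coords (cs p) p) (r p)" for p q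
      unfolding b_def using bump_zero[OF cr(1,3) that] by simp
    show "(\<Sum>p\<in>J. b p q / (\<Sum>p'\<in>J. b p' q)) = 1" for q
      using pos[of q] by (simp add: sum_divide_distrib[symmetric])
    show "finite J" by (rule J(1))
    show "cs p \<in> A" for p by (rule cr(1))
    show "compact (param (cs p) ` cball (coords (cs p) p) (r p))"
      "param (cs p) ` cball (coords (cs p) p) (r p) \<subseteq> chart_dom (cs p)" for p
      using compact_param_cball[OF cr(1,4)] by blast+
  qed
qed

end

section \<open>The divergence theorem for gradients\<close>

text \<open>A fixed shape for fourfold index sums, so that renaming indices becomes a sequence of
  adjacent transpositions.\<close>

definition quad_sum :: "('n::finite \<Rightarrow> 'n \<Rightarrow> 'n \<Rightarrow> 'n \<Rightarrow> real) \<Rightarrow> real" where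
  "quad_sum F = (\<Sum>i\<in>UNIV. \<Sum>j\<in>UNIV. \<Sum>k\<in>UNIV. \<Sum>l\<in>UNIV. F i j k l)"

lemma quad_sum_swap12: "quad_sum (\<lambda>i j k l. F j i k l) = quad_sum F"
  unfolding quad_sum_def by (rule sum.swap)

lemma quad_sum_swap23: "quad_sum (\<lambda>i j k l. F i k j l) = quad_sum F"
  unfolding quad_sum_def by (intro sum.cong refl sum.swap)

lemma quad_sum_swap34: "quad_sum (\<lambda>i j k l. F i j l k) = quad_sum F"
  unfolding quad_sum_def by (intro sum.cong refl sum.swap)

text \<open>The divergence formula \<open>(1/\<surd>g) \<partial>\<^sub>i (\<surd>g g\<^sup>i\<^sup>j f\<^sub>j) = g\<^sup>i\<^sup>j (f\<^sub>i\<^sub>j - \<Gamma>\<^sup>k\<^sub>i\<^sub>j f\<^sub>k)\<close> at a point, with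
  \<open>N\<close> in the role of the inverse metric and \<open>D i k l\<close> in the role of \<open>\<partial>\<^sub>i g\<^sub>k\<^sub>l\<close>.\<close>

lemma divergence_formula_algebra:
  fixes N :: "'n::finite \<Rightarrow> 'n \<Rightarrow> real"
  assumes N: "\<And>i j. N i j = N j i" and D: "\<And>i j k. D i j k = D i k j"
  shows "(\<Sum>i\<in>UNIV. 1/2 * (\<Sum>k\<in>UNIV. \<Sum>l\<in>UNIV. N l k * D i k l) * (\<Sum>j\<in>UNIV. N i j * f j)
        + (\<Sum>j\<in>UNIV. - (\<Sum>k\<in>UNIV. \<Sum>l\<in>UNIV. N i k * D i k l * N l j) * f j + N i j * h i j))
    = (\<Sum>i\<in>UNIV. \<Sum>j\<in>UNIV. N i j * (h i j
        - (\<Sum>k\<in>UNIV. 1/2 * (\<Sum>l\<in>UNIV. N k l * (D i j l + D j i l - D l i j)) * f k)))"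
proof -
  \<comment> \<open>Up to the factors 1/2 and -1, \<open>T1\<close> comes from differentiating the
    volume density and \<open>T2\<close> from differentiating the inverse metric.\<close>
  define T1 where "T1 = quad_sum (\<lambda>i j k l. N l k * D i k l * N i j * f j)"
  define T2 where "T2 = quad_sum (\<lambda>i j k l. N i k * D i k l * N l j * f j)"
  have a: "quad_sum (\<lambda>i j k l. N i j * N k l * D i j l * f k) = T2"
  proof -
    have *: "quad_sum (\<lambda>i j k l. N i j * N k l * D i j l * f k) = quad_sum (\<lambda>i j k l. N i k * N j l * D i k l * f j)"
      by (rule quad_sum_swap23[symmetric])
    have "N i k * N j l * D i k l * f j = N i k * D i k l * N l j * f j" for i j k l
      using N[of j l] by simp
    then show ?thesis unfolding T2_def * by (simp only:)
  qed
  have b: "quad_sum (\<lambda>i j k l. N i j * N k l * D j i l * f k) = T2"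
  proof -
    have *: "quad_sum (\<lambda>i j k l. N i j * N k l * D j i l * f k) = quad_sum (\<lambda>i j k l. N j i * N k l * D i j l * f k)"
      by (rule quad_sum_swap12[symmetric])
    have "N j i * N k l * D i j l * f k = N i j * N k l * D i j l * f k" for i j k l
      using N[of j i] by simp
    then show ?thesis unfolding * by (simp only: a)
  qed
  have c: "quad_sum (\<lambda>i j k l. N i j * N k l * D l i j * f k) = T1"
  proof -
    \<comment> \<open>Five adjacent transpositions realise the cyclic renaming i to k, k to j, j to
      l, l to i.\<close>
    have "quad_sum (\<lambda>i j k l. N i j * N k l * D l i j * f k) = quad_sum (\<lambda>i j k l. N i j * N l k * D k i j * f l)"
      by (rule quad_sum_swap34[symmetric])
    also have "\<dots> = quad_sum (\<lambda>i j k l. N i k * N l j * D j i k * f l)"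
      by (rule quad_sum_swap23[symmetric])
    also have "\<dots> = quad_sum (\<lambda>i j k l. N j k * N l i * D i j k * f l)"
      by (rule quad_sum_swap12[symmetric])
    also have "\<dots> = quad_sum (\<lambda>i j k l. N j l * N k i * D i j l * f k)"
      by (rule quad_sum_swap34[symmetric])
    also have "\<dots> = quad_sum (\<lambda>i j k l. N k l * N j i * D i k l * f j)"
      by (rule quad_sum_swap23[symmetric])
    finally have *: "quad_sum (\<lambda>i j k l. N i j * N k l * D l i j * f k)
        = quad_sum (\<lambda>i j k l. N k l * N j i * D i k l * f j)" .
    have "N k l * N j i * D i k l * f j = N l k * D i k l * N i j * f j" for i j k l
      using N[of k l] N[of j i] by simp
    then show ?thesis unfolding T1_def * by (simp only:)
  qed
  have L1: "(\<Sum>i\<in>UNIV. 1/2 * (\<Sum>k\<in>UNIV. \<Sum>l\<in>UNIV. N l k * D i k l) * (\<Sum>j\<in>UNIV. N i j * f j)) = 1/2 * T1"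
  proof -
    have "(\<Sum>k\<in>UNIV. \<Sum>l\<in>UNIV. N l k * D i k l) * (\<Sum>j\<in>UNIV. N i j * f j)
        = (\<Sum>j\<in>UNIV. \<Sum>k\<in>UNIV. \<Sum>l\<in>UNIV. N l k * D i k l * N i j * f j)" for i
      by (subst sum_distrib_left) (simp add: sum_distrib_right mult.assoc)
    then have "1/2 * (\<Sum>k\<in>UNIV. \<Sum>l\<in>UNIV. N l k * D i k l) * (\<Sum>j\<in>UNIV. N i j * f j)
        = 1/2 * (\<Sum>j\<in>UNIV. \<Sum>k\<in>UNIV. \<Sum>l\<in>UNIV. N l k * D i k l * N i j * f j)" for i
      by (simp only: mult.assoc)
    then show ?thesis unfolding T1_def quad_sum_def by (simp only: sum_distrib_left[where r = "1/2"])
  qed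
  have L2: "(\<Sum>i\<in>UNIV. \<Sum>j\<in>UNIV. (\<Sum>k\<in>UNIV. \<Sum>l\<in>UNIV. N i k * D i k l * N l j) * f j) = T2"
    unfolding T2_def quad_sum_def by (simp add: sum_distrib_right)
  \<comment> \<open>The first two derivative terms of the Christoffel symbol each give
    \<open>T2\<close>, the third gives \<open>T1\<close>.\<close>
  have R: "(\<Sum>i\<in>UNIV. \<Sum>j\<in>UNIV. N i j * (\<Sum>k\<in>UNIV. 1/2 * (\<Sum>l\<in>UNIV. N k l * (D i j l + D j i l - D l i j)) * f k))
      = 1/2 * (T2 + T2 - T1)"
  proof -
    have "N i j * (\<Sum>k\<in>UNIV. 1/2 * (\<Sum>l\<in>UNIV. N k l * (D i j l + D j i l - D l i j)) * f k)
        = 1/2 * (\<Sum>k\<in>UNIV. \<Sum>l\<in>UNIV. (N i j * N k l * D i j l * f k + N i j * N k l * D j i l * f k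
            - N i j * N k l * D l i j * f k))" for i j
      unfolding sum_distrib_left sum_distrib_right by (intro sum.cong refl) (simp add: algebra_simps)
    then have "(\<Sum>i\<in>UNIV. \<Sum>j\<in>UNIV. N i j * (\<Sum>k\<in>UNIV. 1/2 * (\<Sum>l\<in>UNIV. N k l * (D i j l + D j i l - D l i j)) * f k))
      = 1/2 * (quad_sum (\<lambda>i j k l. N i j * N k l * D i j l * f k) + quad_sum (\<lambda>i j k l. N i j * N k l * D j i l * f k)
        - quad_sum (\<lambda>i j k l. N i j * N k l * D l i j * f k))"
      unfolding quad_sum_def sum_subtractf[symmetric] sum.distrib[symmetric] sum_distrib_left by presburger
    then show ?thesis unfolding a b c .
  qed
  have "(\<Sum>i\<in>UNIV. 1/2 * (\<Sum>k\<in>UNIV. \<Sum>l\<in>UNIV. N l k * D i k l) * (\<Sum>j\<in>UNIV. N i j * f j)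
        + (\<Sum>j\<in>UNIV. - (\<Sum>k\<in>UNIV. \<Sum>l\<in>UNIV. N i k * D i k l * N l j) * f j + N i j * h i j))
      = 1/2 * T1 - T2 + (\<Sum>i\<in>UNIV. \<Sum>j\<in>UNIV. N i j * h i j)"
    unfolding L1[symmetric] L2[symmetric] by (simp add: sum.distrib sum_negf sum_subtractf)
  also have "\<dots> = (\<Sum>i\<in>UNIV. \<Sum>j\<in>UNIV. N i j * h i j) - 1/2 * (T2 + T2 - T1)" by (simp add: field_simps)
  also have "\<dots> = (\<Sum>i\<in>UNIV. \<Sum>j\<in>UNIV. N i j * (h i j
        - (\<Sum>k\<in>UNIV. 1/2 * (\<Sum>l\<in>UNIV. N k l * (D i j l + D j i l - D l i j)) * f k)))"
    unfolding R[symmetric] by (simp add: right_diff_distrib sum_subtractf)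
  finally show ?thesis .
qed

lemma pd_matrix_inv:
  fixes m :: "real^'n::finite \<Rightarrow> real^'k::finite^'k"
  assumes m: "\<And>k l. (\<lambda>y. m y $ k $ l) differentiable (at y)" and nz: "det (m y) \<noteq> 0"
  shows "pd i (\<lambda>y. matrix_inv (m y) $ a $ b) y = - (\<Sum>k\<in>UNIV. \<Sum>l\<in>UNIV.
      matrix_inv (m y) $ a $ k * pd i (\<lambda>y. m y $ k $ l) y * matrix_inv (m y) $ l $ b)"
proof -
  have D: "((\<lambda>y. m y $ k $ l) has_derivative frechet_derivative (\<lambda>y. m y $ k $ l) (at y)) (at y)" for k l
    using m unfolding frechet_derivative_works .
  show ?thesis
    using pd_eqI[OF has_derivative_matrix_inv[OF D nz UNIV_I, of a b], of i] unfolding pd_def .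
qed

lemma pd_sqrt_det:
  fixes m :: "real^'n::finite \<Rightarrow> real^'k::finite^'k"
  assumes m: "\<And>k l. (\<lambda>y. m y $ k $ l) differentiable (at y)" and pos: "det (m y) > 0"
  shows "pd i (\<lambda>y. sqrt (det (m y))) y = sqrt (det (m y)) * (1/2 * (\<Sum>k\<in>UNIV. \<Sum>l\<in>UNIV.
      matrix_inv (m y) $ l $ k * pd i (\<lambda>y. m y $ k $ l) y))"
proof -
  have D: "((\<lambda>y. m y $ k $ l) has_derivative frechet_derivative (\<lambda>y. m y $ k $ l) (at y)) (at y)" for k l
    using m unfolding frechet_derivative_works .
  have nz: "det (m y) \<noteq> 0" using pos by simp
  note d = has_derivative_det[OF D nz]
  note e = has_derivative_real_sqrt[where g = "\<lambda>y. det (m y)", OF pos d]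
  note f = pd_eqI[OF e, of i]
  have "pd i (\<lambda>y. sqrt (det (m y))) y = det (m y) * (\<Sum>k\<in>UNIV. \<Sum>l\<in>UNIV.
      matrix_inv (m y) $ l $ k * pd i (\<lambda>y. m y $ k $ l) y) * (inverse (sqrt (det (m y))) / 2)"
    using f unfolding pd_def .
  moreover have "det (m y) * S * (inverse (sqrt (det (m y))) / 2)
      = (det (m y) * inverse (sqrt (det (m y)))) * (1/2 * S)" for S by simp
  ultimately have "pd i (\<lambda>y. sqrt (det (m y))) y = (det (m y) * inverse (sqrt (det (m y)))) * (1/2 *
      (\<Sum>k\<in>UNIV. \<Sum>l\<in>UNIV. matrix_inv (m y) $ l $ k * pd i (\<lambda>y. m y $ k $ l) y))"
    by (rule trans)
  also have "det (m y) * inverse (sqrt (det (m y))) = sqrt (det (m y))"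
    using pos by (simp add: field_simps)
  finally show ?thesis .
qed

definition grad_inner ::
    "('a, 'n::finite) tensor2 \<Rightarrow> ('a \<Rightarrow> real) \<Rightarrow> ('a \<Rightarrow> real) \<Rightarrow> ('a, 'n) chart \<Rightarrow> 'a \<Rightarrow> real" where
  "grad_inner g \<phi> f c p = (\<Sum>i\<in>UNIV. \<Sum>j\<in>UNIV.
     matrix_inv (g c p) $ i $ j * partial_deriv c i \<phi> p * partial_deriv c j f p)"

context riemannian_manifold
begin

lemma metric_inv_symmetric:
  assumes "c \<in> A" "p \<in> chart_dom c"
  shows "matrix_inv (g c p) $ i $ j = matrix_inv (g c p) $ j $ i"
proof -
  have "transpose (matrix_inv (g c p)) = matrix_inv (g c p)"
    using transpose_matrix_inv[OF metric_det_nonzero[OF assms]] metric_symmetric[OF assms] by simp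
  from arg_cong[OF this, of "\<lambda>M. M $ i $ j"] show ?thesis by (simp add: transpose_def)
qed

text \<open>Allows the gradient terms of the cut-off functions, each arising in its own chart, to be
  summed in one common chart.\<close>

lemma grad_inner_chart_independent:
  assumes cd: "c \<in> A" "d \<in> A" "p \<in> chart_dom c" "p \<in> chart_dom d"
    and "(\<phi> \<circ> param d) differentiable (at (coords d p))" "(f \<circ> param d) differentiable (at (coords d p))"
  shows "grad_inner g \<phi> f c p = grad_inner g \<phi> f d p"
proof -
  let ?J = "chart_jacobian c d p"
  define u where "u e = (\<chi> i. partial_deriv e i \<phi> p)" for e :: "('a, 'n) chart"
  define v where "v e = (\<chi> i. partial_deriv e i f p)" for e :: "('a, 'n) chart"
  have gi: "grad_inner g \<phi> f e p = u e \<bullet> (matrix_inv (g e p) *v v e)" for e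
    by (simp add: grad_inner_def u_def v_def inner_vec_def matrix_vector_mult_def sum_distrib_left mult_ac)
  have uv: "u c = transpose ?J *v u d" "v c = transpose ?J *v v d"
    by (simp_all add: u_def v_def vec_eq_iff partial_deriv_eq_pd pd_transform(2)[OF cd assms(5)]
        pd_transform(2)[OF cd assms(6)] matrix_vector_mult_def transpose_def)
  have nz: "det (g d p) \<noteq> 0" "det ?J \<noteq> 0"
    using metric_det_nonzero chart_jacobian_det_nonzero cd by blast+
  have "matrix_inv (g c p) = matrix_inv ?J ** matrix_inv (g d p) ** transpose (matrix_inv ?J)"
    unfolding tensor_field_transform[OF metric_tensor_field cd] by (rule matrix_inv_congruence[OF nz])
  then have "?J ** matrix_inv (g c p) ** transpose ?J
      = (?J ** matrix_inv ?J) ** matrix_inv (g d p) ** transpose (?J ** matrix_inv ?J)"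
    by (simp add: matrix_transpose_mul matrix_mul_assoc)
  then have "?J ** matrix_inv (g c p) ** transpose ?J = matrix_inv (g d p)"
    by (simp add: matrix_inv_works[OF nz(2)] transpose_mat)
  moreover have "(transpose ?J *v a) \<bullet> b = a \<bullet> (?J *v b)" for a b
    by (simp add: dot_lmul_matrix)
  ultimately show ?thesis
    unfolding gi uv by (simp only: matrix_vector_mul_assoc matrix_mul_assoc)
qed

lemma
  assumes c: "c \<in> A" and y: "y \<in> chart_img c"
  shows pd_vol_density: "pd i (vol_density g c) y = vol_density g c y * (1/2 * (\<Sum>k\<in>UNIV. \<Sum>l\<in>UNIV.
      matrix_inv (g c (param c y)) $ l $ k * pd i (\<lambda>y. g c (param c y) $ k $ l) y))"
    and pd_metric_inv: "pd i (\<lambda>y. matrix_inv (g c (param c y)) $ a $ b) y = - (\<Sum>k\<in>UNIV. \<Sum>l\<in>UNIV.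
      matrix_inv (g c (param c y)) $ a $ k * pd i (\<lambda>y. g c (param c y) $ k $ l) y * matrix_inv (g c (param c y)) $ l $ b)"
proof -
  have pos: "det (g c (param c y)) > 0" using metric_det_pos[OF c param_in_dom[OF c y]] .
  have m: "(\<lambda>y. g c (param c y) $ k $ l) differentiable (at y)" for k l
    by (rule C1_D(1)[OF metric_C1[OF c] y])
  note sd = pd_sqrt_det[where m = "\<lambda>y. g c (param c y)" and y = y, OF m pos]
  have vd: "vol_density g c = (\<lambda>y. sqrt (det (g c (param c y))))"
    by (simp add: vol_density_def fun_eq_iff)
  show "pd i (vol_density g c) y = vol_density g c y * (1/2 * (\<Sum>k\<in>UNIV. \<Sum>l\<in>UNIV.
      matrix_inv (g c (param c y)) $ l $ k * pd i (\<lambda>y. g c (param c y) $ k $ l) y))"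
    unfolding vd by (rule sd)
  show "pd i (\<lambda>y. matrix_inv (g c (param c y)) $ a $ b) y = - (\<Sum>k\<in>UNIV. \<Sum>l\<in>UNIV.
      matrix_inv (g c (param c y)) $ a $ k * pd i (\<lambda>y. g c (param c y) $ k $ l) y * matrix_inv (g c (param c y)) $ l $ b)"
    by (rule pd_matrix_inv[where m = "\<lambda>y. g c (param c y)" and y = y and i = i and a = a and b = b,
        OF m metric_det_nonzero[OF c param_in_dom[OF c y]]])
qed

lemma C1_vol_density:
  assumes c: "c \<in> A"
  shows "C_k (Suc 0) (vol_density g c) (chart_img c)"
proof -
  have pos: "det (g c (param c y)) > 0" if "y \<in> chart_img c" for y
    using metric_det_pos[OF c param_in_dom[OF c that]] .
  show ?thesis
    unfolding vol_density_def[abs_def]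
  proof (rule C1_compose_scalar(1)[where \<psi> = sqrt and \<psi>' = "\<lambda>x. inverse (sqrt x) / 2"
      and f = "\<lambda>y. det (g c (param c y))"])
    show "C_k (Suc 0) (\<lambda>y. det (g c (param c y))) (chart_img c)"
      by (rule C1_det[OF metric_C1[OF c]])
    show "(sqrt has_real_derivative inverse (sqrt (det (g c (param c y)))) / 2) (at (det (g c (param c y))))"
      if "y \<in> chart_img c" for y
      by (rule DERIV_real_sqrt[OF pos[OF that]])
    show "continuous_on ((\<lambda>y. det (g c (param c y))) ` chart_img c) (\<lambda>x. inverse (sqrt x) / 2)"
    proof (intro continuous_intros ballI)
      fix x assume "x \<in> (\<lambda>y. det (g c (param c y))) ` chart_img c"
      then obtain y where "y \<in> chart_img c" "x = det (g c (param c y))" by blast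
      then show "sqrt x \<noteq> 0" using pos[of y] by simp
    qed simp
  qed
qed

lemma C1_metric_inv:
  "c \<in> A \<Longrightarrow> C_k (Suc 0) (\<lambda>y. matrix_inv (g c (param c y)) $ i $ j) (chart_img c)"
  by (intro C1_matrix_inv open_img metric_C1 metric_det_nonzero param_in_dom)

lemma partial_deriv_param:
  "c \<in> A \<Longrightarrow> y \<in> chart_img c \<Longrightarrow> partial_deriv c i f (param c y) = pd i (f \<circ> param c) y"
  by (simp add: partial_deriv_eq_pd)

lemma partial_deriv_partial_deriv_param:
  assumes "c \<in> A" "y \<in> chart_img c"
  shows "partial_deriv c i (partial_deriv c j f) (param c y) = pd i (pd j (f \<circ> param c)) y"
  unfolding partial_deriv_param[OF assms]
proof (rule pd_cong_ev)
  show "\<forall>\<^sub>F y in nhds y. (partial_deriv c j f \<circ> param c) y = pd j (f \<circ> param c) y"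
    by (rule eventually_nhds_in_openI[OF open_img[OF assms(1)] assms(2)])
      (simp add: partial_deriv_param[OF assms(1)])
qed

lemma christoffel_param:
  assumes "c \<in> A" "y \<in> chart_img c"
  shows "christoffel g c k i j (param c y) = 1/2 * (\<Sum>l\<in>UNIV. matrix_inv (g c (param c y)) $ k $ l *
     (pd i (\<lambda>y. g c (param c y) $ j $ l) y + pd j (\<lambda>y. g c (param c y) $ i $ l) y
      - pd l (\<lambda>y. g c (param c y) $ i $ j) y))"
  unfolding christoffel_def by (simp add: partial_deriv_param[OF assms] o_def)

text \<open>The identity div(\<phi> grad f) = \<phi> \<Delta>f + <grad \<phi>, grad f>, multiplied
  by the volume density. The product rule, the derivatives of density and inverse metric, and
  \<open>divergence_formula_algebra\<close> combine.\<close>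

lemma divergence_formula:
  assumes c: "c \<in> A" and y: "y \<in> chart_img c"
    and \<phi>: "C_k (Suc 0) (\<phi> \<circ> param c) (chart_img c)" and f: "C_k (Suc (Suc 0)) (f \<circ> param c) (chart_img c)"
  shows "(\<Sum>i\<in>UNIV. pd i (\<lambda>y. \<phi> (param c y) * (vol_density g c y *
        (\<Sum>j\<in>UNIV. matrix_inv (g c (param c y)) $ i $ j * pd j (f \<circ> param c) y))) y)
    = vol_density g c y * (\<phi> (param c y) * metric_trace g (hessian g f) c (param c y)
        + grad_inner g \<phi> f c (param c y))"
proof -
  let ?\<rho> = "vol_density g c" and ?N = "\<lambda>i j y. matrix_inv (g c (param c y)) $ i $ j"
  let ?f = "\<lambda>j. pd j (f \<circ> param c)"
  define D where "D i k l = pd i (\<lambda>y. g c (param c y) $ k $ l) y" for i k l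
  have fC1: "C_k (Suc 0) (?f j) (chart_img c)" for j
    using f unfolding C_k_Suc_pd[of "Suc 0"] by blast
  have d\<phi>: "(\<lambda>y. \<phi> (param c y)) differentiable (at y)" using C1_D(1)[OF \<phi> y] by (simp add: o_def)
  have d\<rho>: "?\<rho> differentiable (at y)" using C1_D(1)[OF C1_vol_density[OF c] y] .
  have dN: "?N i j differentiable (at y)" for i j using C1_D(1)[OF C1_metric_inv[OF c] y] .
  have df: "?f j differentiable (at y)" for j using C1_D(1)[OF fC1 y] .
  have dS: "(\<lambda>y. \<Sum>j\<in>UNIV. ?N i j y * ?f j y) differentiable (at y)" for i
    by (intro differentiable_sum ballI differentiable_mult dN df) simp
  have D_sym: "D i k l = D i l k" for i k l
  proof -
    have "g c (param c z) $ k $ l = g c (param c z) $ l $ k" if "z \<in> chart_img c" for z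
      using arg_cong[OF metric_symmetric[OF c param_in_dom[OF c that]], of "\<lambda>M. M $ l $ k"]
      by (simp add: transpose_def)
    then show ?thesis unfolding D_def using y
      by (intro pd_cong_ev eventually_nhds_in_openI[OF open_img[OF c]]) auto
  qed
  have N_sym: "?N i j y = ?N j i y" for i j by (rule metric_inv_symmetric[OF c param_in_dom[OF c y]])
  have pdS: "pd i (\<lambda>y. \<Sum>j\<in>UNIV. ?N i j y * ?f j y) y
      = (\<Sum>j\<in>UNIV. - (\<Sum>k\<in>UNIV. \<Sum>l\<in>UNIV. ?N i k y * D i k l * ?N l j y) * ?f j y + ?N i j y * pd i (?f j) y)" for i
    by (subst pd_sum) (simp_all add: differentiable_mult dN df pd_mult pd_metric_inv[OF c y] D_def)
  have rearrange: "(\<Sum>i\<in>UNIV. a i * (r * s i) + p * (r * w i))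
      = r * (\<Sum>i\<in>UNIV. a i * s i) + r * (p * (\<Sum>i\<in>UNIV. w i))" for a s w :: "'n \<Rightarrow> real" and r p
    by (simp add: sum.distrib sum_distrib_left mult_ac)
  have "(\<Sum>i\<in>UNIV. pd i (\<lambda>y. \<phi> (param c y) * (?\<rho> y * (\<Sum>j\<in>UNIV. ?N i j y * ?f j y))) y)
      = (\<Sum>i\<in>UNIV. pd i (\<lambda>y. \<phi> (param c y)) y * (?\<rho> y * (\<Sum>j\<in>UNIV. ?N i j y * ?f j y))
          + \<phi> (param c y) * (?\<rho> y * (1/2 * (\<Sum>k\<in>UNIV. \<Sum>l\<in>UNIV. ?N l k y * D i k l) * (\<Sum>j\<in>UNIV. ?N i j y * ?f j y)
              + pd i (\<lambda>y. \<Sum>j\<in>UNIV. ?N i j y * ?f j y) y)))"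
    using pd_mult[OF d\<phi> differentiable_mult[OF d\<rho> dS]] pd_mult[OF d\<rho> dS]
    by (simp add: pd_vol_density[OF c y] D_def algebra_simps)
  also have "\<dots> = ?\<rho> y * (\<Sum>i\<in>UNIV. pd i (\<lambda>y. \<phi> (param c y)) y * (\<Sum>j\<in>UNIV. ?N i j y * ?f j y))
      + ?\<rho> y * (\<phi> (param c y) * (\<Sum>i\<in>UNIV. 1/2 * (\<Sum>k\<in>UNIV. \<Sum>l\<in>UNIV. ?N l k y * D i k l) * (\<Sum>j\<in>UNIV. ?N i j y * ?f j y)
              + pd i (\<lambda>y. \<Sum>j\<in>UNIV. ?N i j y * ?f j y) y))"
    by (rule rearrange)
  also have "(\<Sum>i\<in>UNIV. 1/2 * (\<Sum>k\<in>UNIV. \<Sum>l\<in>UNIV. ?N l k y * D i k l) * (\<Sum>j\<in>UNIV. ?N i j y * ?f j y)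
              + pd i (\<lambda>y. \<Sum>j\<in>UNIV. ?N i j y * ?f j y) y)
      = (\<Sum>i\<in>UNIV. \<Sum>j\<in>UNIV. ?N i j y * (pd i (?f j) y
        - (\<Sum>k\<in>UNIV. 1/2 * (\<Sum>l\<in>UNIV. ?N k l y * (D i j l + D j i l - D l i j)) * ?f k y)))"
    unfolding pdS using divergence_formula_algebra[of "\<lambda>i j. ?N i j y" D, OF N_sym D_sym] .
  also have "\<dots> = metric_trace g (hessian g f) c (param c y)"
    unfolding metric_trace_def hessian_def D_def vec_lambda_beta partial_deriv_partial_deriv_param[OF c y]
    unfolding partial_deriv_param[OF c y] christoffel_param[OF c y] ..
  also have "(\<Sum>i\<in>UNIV. pd i (\<lambda>y. \<phi> (param c y)) y * (\<Sum>j\<in>UNIV. ?N i j y * ?f j y)) = grad_inner g \<phi> f c (param c y)"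
    unfolding grad_inner_def by (simp add: partial_deriv_param[OF c y] o_def sum_distrib_left mult_ac)
  finally show ?thesis by (simp only: distrib_left add.commute)
qed

text \<open>In coordinates the density times \<open>w\<close> is a sum of partial derivatives of
  fields supported in the compact image of \<open>K\<close>, and each of these integrates to
  zero.\<close>

lemma integral_divergence_chart:
  assumes c: "c \<in> A" and K: "compact K" "K \<subseteq> chart_dom c"
    and \<phi>: "C_k (Suc 0) (\<phi> \<circ> param c) (chart_img c)" "\<And>p. p \<notin> K \<Longrightarrow> \<phi> p = 0"
    and f: "C_k (Suc (Suc 0)) (f \<circ> param c) (chart_img c)"
  defines "w \<equiv> (\<lambda>p. if p \<in> chart_dom c
      then \<phi> p * metric_trace g (hessian g f) c p + grad_inner g \<phi> f c p else 0)"
  shows "integrable (dvol A g) w" "(\<integral>p. w p \<partial>dvol A g) = 0"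
proof -
  define V where "V i y = \<phi> (param c y) * (vol_density g c y *
      (\<Sum>j\<in>UNIV. matrix_inv (g c (param c y)) $ i $ j * pd j (f \<circ> param c) y))" for i y
  \<comment> \<open>\<open>F\<close> and \<open>G\<close> extend the field and its derivative by
    zero to the whole coordinate space; since the field already vanishes off \<open>K'\<close>,
    nothing breaks at the boundary of the chart image.\<close>
  define F where "F i y = (if y \<in> chart_img c then V i y else 0)" for i y
  define G where "G i y = (if y \<in> chart_img c then pd i (V i) y else 0)" for i y
  define K' where "K' = coords c ` K"
  have K'c: "compact K'" unfolding K'_def
    by (intro compact_continuous_image K continuous_on_subset[OF continuous_on_coords[OF c] K(2)])
  have K'i: "K' \<subseteq> chart_img c" unfolding K'_def using K(2) by blast
  have opn: "open (- K')" using compact_imp_closed[OF K'c] by (simp add: open_Compl)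
  have V0: "V i y = 0" if "y \<in> chart_img c" "y \<notin> K'" for i y
  proof -
    have "param c y \<notin> K" using that c unfolding K'_def by (metis coords_param image_eqI)
    then show ?thesis using \<phi>(2) by (simp add: V_def)
  qed
  have F0: "F i y = 0" if "y \<notin> K'" for i y using V0 that by (simp add: F_def)
  have VC1: "C_k (Suc 0) (V i) (chart_img c)" for i
  proof -
    have "C_k (Suc 0) (\<lambda>y. (\<phi> \<circ> param c) y * (vol_density g c y *
      (\<Sum>j\<in>UNIV. matrix_inv (g c (param c y)) $ i $ j * pd j (f \<circ> param c) y))) (chart_img c)"
      using f by (intro C1_mult C1_sum \<phi> C1_vol_density C1_metric_inv c) (auto simp: C_k_Suc_pd[of "Suc 0"])
    then show ?thesis by (simp add: V_def[abs_def])
  qed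
  have F_in: "(F i has_derivative frechet_derivative (V i) (at y)) (at y)" if "y \<in> chart_img c" for i y
  proof -
    have "(V i has_derivative frechet_derivative (V i) (at y)) (at y)"
      using C1_D(1)[OF VC1 that] by (simp add: frechet_derivative_works)
    then show ?thesis
      by (rule has_derivative_transform_within_open[OF _ open_img[OF c] that]) (simp add: F_def)
  qed
  have F_out: "(F i has_derivative (\<lambda>v. 0)) (at y)" if "y \<notin> K'" for i y
    by (rule has_derivative_transform_within_open[OF has_derivative_const opn]) (use that F0 in auto)
  have pdF: "pd i (F i) y = G i y" for i y
  proof (cases "y \<in> chart_img c")
    case True
    then show ?thesis using pd_eqI[OF F_in[OF True]] by (simp add: G_def pd_def)
  next
    case False
    then have "y \<notin> K'" using K'i by blast
    then show ?thesis using pd_eqI[OF F_out] False by (simp add: G_def)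
  qed
  have G0: "G i y = 0" if "y \<notin> K'" for i y
    using pd_eqI[OF F_out[OF that]] pdF by metis
  have Fd: "(F i has_derivative frechet_derivative (F i) (at y)) (at y)" for i y
  proof -
    have "F i differentiable (at y)"
    proof (cases "y \<in> chart_img c")
      case True
      then show ?thesis by (rule differentiableI[OF F_in])
    next
      case False
      then have "y \<notin> K'" using K'i by blast
      then show ?thesis by (rule differentiableI[OF F_out])
    qed
    then show ?thesis by (simp add: frechet_derivative_works)
  qed
  \<comment> \<open>The chart image and the complement of \<open>K'\<close> are open and cover the
    space, and on each of them continuity is clear.\<close>
  have Gc: "continuous_on UNIV (G i)" for i
  proof -
    have "continuous_on (chart_img c) (G i)"
      using C1_D(2)[OF VC1, of i i] by (rule continuous_on_eq) (simp add: G_def)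
    moreover have "continuous_on (- K') (G i)"
      using continuous_on_const[of "- K'" "0 :: real"] by (rule continuous_on_eq) (simp add: G0)
    moreover have "chart_img c \<union> - K' = UNIV" using K'i by blast
    ultimately show ?thesis using continuous_on_open_Un[OF open_img[OF c] opn] by metis
  qed
  have Gint: "integrable lborel (G i)" for i
    by (rule compactly_supported_integrable[OF K'c Gc G0])
  have Gz: "(\<integral>y. G i y \<partial>lborel) = 0" for i
  proof (rule integral_directional_derivative[OF K'c F0 G0 Gc Fd])
    show "frechet_derivative (F i) (at y) (axis i 1) = G i y" for y
      using pdF[of i y] by (simp add: pd_def)
  qed
  have sumG: "(\<Sum>i\<in>UNIV. G i y) = indicator (chart_img c) y * (vol_density g c y * w (param c y))" for y
  proof (cases "y \<in> chart_img c")
    case True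
    have "(\<Sum>i\<in>UNIV. G i y) = (\<Sum>i\<in>UNIV. pd i (V i) y)" using True by (simp add: G_def)
    also have "\<dots> = vol_density g c y * (\<phi> (param c y) * metric_trace g (hessian g f) c (param c y)
        + grad_inner g \<phi> f c (param c y))"
      unfolding V_def[abs_def] by (rule divergence_formula[OF c True \<phi>(1) f])
    finally show ?thesis using True param_in_dom[OF c True] by (simp add: w_def)
  qed (simp add: G_def)
  have w_eq: "w p = (\<Sum>i\<in>UNIV. G i (coords c p)) / vol_density g c (coords c p)" if "p \<in> chart_dom c" for p
    using vol_density_pos[OF c, of "coords c p"] that c by (simp add: sumG)
  have wm: "w \<in> borel_measurable borel"
  proof -
    have "continuous_on (chart_dom c) (\<lambda>p. (\<Sum>i\<in>UNIV. G i (coords c p)) / vol_density g c (coords c p))"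
    proof (intro continuous_intros ballI)
      show "continuous_on (chart_dom c) (\<lambda>p. G i (coords c p))" for i
        by (rule continuous_on_compose2[OF Gc continuous_on_coords[OF c]]) simp
      show "continuous_on (chart_dom c) (\<lambda>p. vol_density g c (coords c p))"
        by (rule continuous_on_compose2[OF continuous_on_vol_density[OF c] continuous_on_coords[OF c]]) simp
      show "vol_density g c (coords c p) \<noteq> 0" if "p \<in> chart_dom c" for p
        using vol_density_pos[OF c, of "coords c p"] that by auto
    qed
    then have "continuous_on (chart_dom c) w" by (rule continuous_on_eq) (simp add: w_eq)
    then have "(\<lambda>p. indicator (chart_dom c) p *\<^sub>R w p) \<in> borel_measurable borel"
      by (rule borel_measurable_continuous_on_indicator[OF borel_open[OF open_dom[OF c]]])
    moreover have "(\<lambda>p. indicator (chart_dom c) p *\<^sub>R w p) = w"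
      by (auto simp: w_def fun_eq_iff split: split_indicator)
    ultimately show ?thesis by simp
  qed
  have w0: "w p = 0" if "p \<notin> chart_dom c" for p using that by (simp add: w_def)
  show "integrable (dvol A g) w"
  proof -
    have "integrable lborel (\<lambda>y. \<Sum>i\<in>UNIV. G i y)"
      by (intro Bochner_Integration.integrable_sum Gint)
    then show ?thesis using integral_chart(2)[OF c wm w0] unfolding sumG by blast
  qed
  show "(\<integral>p. w p \<partial>dvol A g) = 0"
  proof -
    have "(\<integral>y. (\<Sum>i\<in>UNIV. G i y) \<partial>lborel) = 0"
      by (subst Bochner_Integration.integral_sum) (auto simp: Gint Gz)
    then show ?thesis using integral_chart(1)[OF c wm w0] unfolding sumG by simp
  qed
qed

text \<open>Summing the chart identities over a partition of unity leaves the Laplacian, because the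
  gradients of the cut-off functions add up to the gradient of 1. The hypothesis on \<open>D\<close>
  records chart independence of the Laplacian; for the lapse it is supplied by
  \<open>lapse_equation\<close>.\<close>

lemma laplacian_integral:
  assumes f: "\<And>c. c \<in> A \<Longrightarrow> C_k (Suc (Suc 0)) (f \<circ> param c) (chart_img c)"
    and D: "\<And>c p. c \<in> A \<Longrightarrow> p \<in> chart_dom c \<Longrightarrow> metric_trace g (hessian g f) c p = D p"
  shows "integrable (dvol A g) D" "(\<integral>p. D p \<partial>dvol A g) = 0"
proof -
  obtain J :: "'a set" and cs K and \<phi> :: "'a \<Rightarrow> 'a \<Rightarrow> real" where P: "finite J" "\<And>j. j \<in> J \<Longrightarrow> cs j \<in> A"
    "\<And>j. j \<in> J \<Longrightarrow> compact (K j)" "\<And>j. j \<in> J \<Longrightarrow> K j \<subseteq> chart_dom (cs j)"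
    "\<And>j. j \<in> J \<Longrightarrow> C1_function A (\<phi> j)" "\<And>j q. j \<in> J \<Longrightarrow> q \<notin> K j \<Longrightarrow> \<phi> j q = 0"
    "\<And>q. (\<Sum>j\<in>J. \<phi> j q) = 1"
    using partition_of_unity by blast
  define w where "w j p = (if p \<in> chart_dom (cs j)
      then \<phi> j p * metric_trace g (hessian g f) (cs j) p + grad_inner g (\<phi> j) f (cs j) p else 0)" for j p
  have w: "integrable (dvol A g) (w j)" "(\<integral>p. w j p \<partial>dvol A g) = 0" if "j \<in> J" for j
  proof -
    have "C_k (Suc 0) (\<phi> j \<circ> param (cs j)) (chart_img (cs j))"
      using P(5)[OF that] P(2)[OF that] unfolding C1_function_def by blast
    note div = integral_divergence_chart[where \<phi> = "\<phi> j" and f = f,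
        OF P(2)[OF that] P(3)[OF that] P(4)[OF that] this P(6)[OF that] f[OF P(2)[OF that]]]
    show "integrable (dvol A g) (w j)" unfolding w_def[abs_def] by (rule div(1))
    show "(\<integral>p. w j p \<partial>dvol A g) = 0" unfolding w_def by (rule div(2))
  qed
  have sumw: "(\<Sum>j\<in>J. w j p) = D p" for p
  proof -
    obtain d where d: "d \<in> A" "p \<in> chart_dom d" using chart_exists by blast
    have dphi: "(\<phi> j \<circ> param d) differentiable (at (coords d p))" if "j \<in> J" for j
      using P(5)[OF that] d unfolding C1_function_def by (auto dest: C1_D(1))
    have df: "(f \<circ> param d) differentiable (at (coords d p))"
      using f[OF d(1)] d(2) by (auto simp: C_k_Suc_pd)
    have w_eq: "w j p = \<phi> j p * D p + grad_inner g (\<phi> j) f d p" if j: "j \<in> J" for j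
    proof (cases "p \<in> chart_dom (cs j)")
      case True
      then show ?thesis
        using grad_inner_chart_independent[OF P(2)[OF j] d(1) True d(2) dphi[OF j] df] D[OF P(2)[OF j] True]
        by (simp add: w_def)
    next
      case False
      \<comment> \<open>Outside the chart of \<open>j\<close> the function \<open>w j\<close> is
        zero by definition. The other side is zero too: \<open>K j\<close> is closed, so the cut-off
        vanishes near \<open>p\<close> together with its derivatives.\<close>
      then have pK: "p \<in> - K j" using P(4)[OF j] by blast
      have "open (- K j)" using compact_imp_closed[OF P(3)[OF j]] by (simp add: open_Compl)
      from eventually_param_in[OF d this pK]
      have "\<forall>\<^sub>F y in nhds (coords d p). (\<phi> j \<circ> param d) y = 0"
        by eventually_elim (use P(6)[OF j] in simp)
      then have "partial_deriv d i (\<phi> j) p = 0" for i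
        unfolding partial_deriv_eq_pd using pd_cong_ev[of "\<phi> j \<circ> param d" "\<lambda>y. 0"] by simp
      then show ?thesis using False P(6)[OF j] pK by (simp add: w_def grad_inner_def)
    qed
    have "(\<Sum>j\<in>J. partial_deriv d i (\<phi> j) p) = 0" for i
    proof -
      have "(\<Sum>j\<in>J. partial_deriv d i (\<phi> j) p) = pd i (\<lambda>y. \<Sum>j\<in>J. (\<phi> j \<circ> param d) y) (coords d p)"
        unfolding partial_deriv_eq_pd by (rule pd_sum[symmetric]) (rule dphi)
      then show ?thesis by (simp add: P(7))
    qed
    moreover have "(\<Sum>j\<in>J. grad_inner g (\<phi> j) f d p)
        = (\<Sum>a\<in>UNIV. \<Sum>b\<in>UNIV. matrix_inv (g d p) $ a $ b * (\<Sum>j\<in>J. partial_deriv d a (\<phi> j) p) * partial_deriv d b f p)"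
      unfolding grad_inner_def sum_distrib_left sum_distrib_right
      by (subst sum.swap, rule sum.cong[OF refl], rule sum.swap)
    ultimately have "(\<Sum>j\<in>J. grad_inner g (\<phi> j) f d p) = 0" by simp
    moreover have "(\<Sum>j\<in>J. w j p) = (\<Sum>j\<in>J. \<phi> j p) * D p + (\<Sum>j\<in>J. grad_inner g (\<phi> j) f d p)"
      by (simp add: w_eq sum.distrib sum_distrib_right)
    ultimately show ?thesis by (simp add: P(7))
  qed
  show "integrable (dvol A g) D"
    using Bochner_Integration.integrable_sum[of J "dvol A g" w, OF w(1)] unfolding sumw .
  show "(\<integral>p. D p \<partial>dvol A g) = 0"
    using Bochner_Integration.integral_sum[of J "dvol A g" w, OF w(1)] w(2) unfolding sumw by simp
qed

text \<open>At a minimum the first derivatives vanish, which removes the Christoffel terms; the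
  remaining matrix of second derivatives is positive semidefinite and is contracted with the
  positive inverse metric.\<close>

lemma laplacian_nonneg_at_min:
  assumes c: "c \<in> A" "p \<in> chart_dom c" and f: "C_k (Suc (Suc 0)) (f \<circ> param c) (chart_img c)"
    and min: "\<And>q. f p \<le> f q"
  shows "0 \<le> metric_trace g (hessian g f) c p"
proof -
  define F where "F = f \<circ> param c"
  define y where "y = coords c p"
  have y: "y \<in> chart_img c" "param c y = p" using c by (simp_all add: y_def)
  have FC1: "C_k (Suc 0) (pd j F) (chart_img c)" for j
    using f unfolding F_def C_k_Suc_pd[of "Suc 0"] by blast
  have Fd: "F differentiable (at z)" if "z \<in> chart_img c" for z
    using f that unfolding F_def C_k_Suc_pd[of "Suc 0"] by blast
  have Fmin: "F y \<le> F z" for z using min y by (simp add: F_def)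
  have crit: "pd k F y = 0" for k
  proof -
    have "(F has_derivative frechet_derivative F (at y)) (at y)"
      using Fd[OF y(1)] by (simp add: frechet_derivative_works)
    from differential_zero_maxmin[OF y(1) open_img[OF c(1)] this] Fmin
    show ?thesis by (simp add: pd_def)
  qed
  define H where "H = (\<chi> i j. pd i (pd j F) y)"
  have psd: "0 \<le> v \<bullet> (H *v v)" for v
  proof (rule ccontr)
    assume neg: "\<not> 0 \<le> v \<bullet> (H *v v)"
    \<comment> \<open>The derivative of \<open>F\<close> along the line in direction
      \<open>v\<close>. It is zero at 0; a negative second derivative would make it negative just to
      the right, so \<open>F\<close> would fall below its minimum.\<close>
    define \<psi>' where "\<psi>' t = (\<Sum>j\<in>UNIV. v $ j * pd j F (y + t *\<^sub>R v))" for t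
    define T where "T = {t. y + t *\<^sub>R v \<in> chart_img c}"
    have T: "open T" unfolding T_def
      using continuous_open_vimage[OF open_img[OF c(1)], of "\<lambda>t. y + t *\<^sub>R v"]
      by (simp add: vimage_def continuous_intros)
    have ln: "((\<lambda>t. q (y + t *\<^sub>R v)) has_real_derivative (\<Sum>j\<in>UNIV. v $ j * pd j q (y + t *\<^sub>R v))) (at t)"
      if "q differentiable (at (y + t *\<^sub>R v))" for q t
    proof -
      have "((\<lambda>t. y + t *\<^sub>R v) has_derivative (\<lambda>s. s *\<^sub>R v)) (at t)"
        by (auto intro!: derivative_eq_intros)
      from diff_chain_at[OF this has_derivative_pd[OF that]]
      have "((\<lambda>t. q (y + t *\<^sub>R v)) has_derivative (\<lambda>s. \<Sum>j\<in>UNIV. (s *\<^sub>R v) $ j * pd j q (y + t *\<^sub>R v))) (at t)"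
        by (simp add: o_def)
      moreover have "(\<lambda>s. \<Sum>j\<in>UNIV. (s *\<^sub>R v) $ j * pd j q (y + t *\<^sub>R v))
          = (*) (\<Sum>j\<in>UNIV. v $ j * pd j q (y + t *\<^sub>R v))"
      proof
        show "(\<Sum>j\<in>UNIV. (s *\<^sub>R v) $ j * pd j q (y + t *\<^sub>R v))
          = (\<Sum>j\<in>UNIV. v $ j * pd j q (y + t *\<^sub>R v)) * s" for s
          unfolding sum_distrib_right by (intro sum.cong refl) simp
      qed
      ultimately show ?thesis
        unfolding has_field_derivative_def by (simp only:)
    qed
    have d1: "((\<lambda>t. F (y + t *\<^sub>R v)) has_real_derivative \<psi>' t) (at t)" if "t \<in> T" for t
      unfolding \<psi>'_def using that Fd by (intro ln) (simp add: T_def)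
    have "(\<psi>' has_real_derivative (\<Sum>j\<in>UNIV. v $ j * (\<Sum>i\<in>UNIV. v $ i * pd i (pd j F) (y + 0 *\<^sub>R v)))) (at 0)"
      unfolding \<psi>'_def[abs_def] using C1_D(1)[OF FC1] y
      by (intro DERIV_sum DERIV_cmult ln) simp
    moreover have "(\<Sum>j\<in>UNIV. v $ j * (\<Sum>i\<in>UNIV. v $ i * pd i (pd j F) (y + 0 *\<^sub>R v))) = v \<bullet> (H *v v)"
      unfolding quadratic_form_sum H_def vec_lambda_beta sum_distrib_left
      by (subst sum.swap) (intro sum.cong refl, simp)
    ultimately have d2: "(\<psi>' has_real_derivative v \<bullet> (H *v v)) (at 0)" by simp
    obtain e where e: "e > 0" "\<And>t. 0 < t \<Longrightarrow> t < e \<Longrightarrow> \<psi>' (0 + t) < \<psi>' 0"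
      using DERIV_neg_dec_right[OF d2] neg by auto
    have "0 \<in> T" using y by (simp add: T_def)
    then obtain r where r: "r > 0" "ball 0 r \<subseteq> T" using T open_contains_ball by blast
    define b where "b = min e r / 2"
    have b: "0 < b" "b < e" "b < r" using e r by (auto simp: b_def)
    have "F (y + b *\<^sub>R v) < F (y + 0 *\<^sub>R v)"
    proof (rule DERIV_neg_imp_decreasing_open[OF b(1)])
      fix t assume t: "0 < t" "t < b"
      then have "t \<in> T" using b r(2) by (auto simp: subset_iff)
      moreover have "\<psi>' 0 = 0" using crit by (simp add: \<psi>'_def)
      ultimately show "\<exists>z. ((\<lambda>t. F (y + t *\<^sub>R v)) has_real_derivative z) (at t) \<and> z < 0"
        using d1[of t] e(2)[of t] t b by auto
    next
      have "t \<in> T" if "t \<in> {0..b}" for t using that b r(2) by (auto simp: subset_iff)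
      then show "continuous_on {0..b} (\<lambda>t. F (y + t *\<^sub>R v))"
        by (intro continuous_at_imp_continuous_on ballI DERIV_isCont[OF d1])
    qed
    then show False using Fmin[of "y + b *\<^sub>R v"] by simp
  qed
  have "metric_trace g (hessian g f) c (param c y) = (\<Sum>i\<in>UNIV. \<Sum>j\<in>UNIV. matrix_inv (g c p) $ i $ j * H $ i $ j)"
    unfolding metric_trace_def hessian_def vec_lambda_beta partial_deriv_partial_deriv_param[OF c(1) y(1)]
    unfolding partial_deriv_param[OF c(1) y(1)] using crit y(2) by (simp add: H_def F_def)
  also have "\<dots> \<ge> 0"
  proof (rule sum_mult_psd_nonneg[OF _ _ psd])
    show "transpose (matrix_inv (g c p)) = matrix_inv (g c p)"
      using transpose_matrix_inv[OF metric_det_nonzero[OF c]] metric_symmetric[OF c] by simp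
    show "0 \<le> v \<bullet> (matrix_inv (g c p) *v v)" for v
      using pos_def_matrix_inv[OF metric_pos[OF c] metric_symmetric[OF c]] .
  qed
  finally show ?thesis using y(2) by simp
qed

end

section \<open>Scaling of the metric\<close>

lemma matrix_inv_scaleR:
  fixes G :: "real^'n::finite^'n"
  assumes "det G \<noteq> 0" "a \<noteq> 0"
  shows "matrix_inv (a *\<^sub>R G) = (1 / a) *\<^sub>R matrix_inv G"
proof (rule matrix_inv_unique)
  have "(a *\<^sub>R G) ** ((1 / a) *\<^sub>R matrix_inv G) = G ** matrix_inv G"
    using assms(2) by (simp add: matrix_matrix_mult_def vec_eq_iff)
  then show "(a *\<^sub>R G) ** ((1 / a) *\<^sub>R matrix_inv G) = mat 1"
    by (simp add: matrix_inv_works[OF assms(1)])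
qed

context riemannian_manifold
begin

lemma christoffel_scale:
  assumes c: "c \<in> A" "q \<in> chart_dom c" and a: "a \<noteq> 0"
  shows "christoffel (\<lambda>c p. a *\<^sub>R g c p) c k i j q = christoffel g c k i j q"
proof -
  have "partial_deriv c i (\<lambda>q. (a *\<^sub>R g c q) $ j $ l) q = a * partial_deriv c i (\<lambda>q. g c q $ j $ l) q" for i j l
  proof -
    have d: "(\<lambda>y. g c (param c y) $ j $ l) differentiable (at (coords c q))"
      using C1_D(1)[OF metric_C1[OF c(1)]] c(2) by blast
    then show ?thesis
      using pd_mult[of "\<lambda>y. a" "coords c q" "\<lambda>y. g c (param c y) $ j $ l" i]
      by (simp add: partial_deriv_eq_pd o_def)
  qed
  then show ?thesis
    unfolding christoffel_def matrix_inv_scaleR[OF metric_det_nonzero[OF c] a]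
    using a by (simp add: right_diff_distrib[symmetric] distrib_left[symmetric])
qed

text \<open>The Christoffel symbols of the scaled metric agree with the original ones on the whole
  chart domain, so their derivatives agree as well.\<close>

lemma ricci_scale:
  assumes c: "c \<in> A" "p \<in> chart_dom c" and a: "a \<noteq> 0"
  shows "ricci (\<lambda>c p. a *\<^sub>R g c p) c p = ricci g c p"
proof -
  have "partial_deriv c m (christoffel (\<lambda>c p. a *\<^sub>R g c p) c k i j) p = partial_deriv c m (christoffel g c k i j) p" for m k i j
    unfolding partial_deriv_eq_pd
  proof (rule pd_cong_ev)
    show "\<forall>\<^sub>F y in nhds (coords c p). (christoffel (\<lambda>c p. a *\<^sub>R g c p) c k i j \<circ> param c) y
        = (christoffel g c k i j \<circ> param c) y"
      by (rule eventually_nhds_in_openI[OF open_img[OF c(1)]])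
        (use c a in \<open>auto intro!: christoffel_scale\<close>)
  qed
  then show ?thesis
    unfolding ricci_def by (simp add: christoffel_scale[OF c a])
qed

lemma scalar_curvature_scale:
  assumes "a \<noteq> 0"
  shows "scalar_curvature A (\<lambda>c p. a *\<^sub>R g c p) p = scalar_curvature A g p / a"
  unfolding scalar_curvature_def metric_trace_def ricci_scale[OF chart_at assms]
    matrix_inv_scaleR[OF metric_det_nonzero[OF chart_at] assms]
  by (simp add: sum_divide_distrib)

lemma norm_sq_scale:
  assumes "a \<noteq> 0"
  shows "norm_sq A (\<lambda>c p. a *\<^sub>R g c p) (\<lambda>c p. b *\<^sub>R T c p) p = b\<^sup>2 / a\<^sup>2 * norm_sq A g T p"
  unfolding norm_sq_def metric_norm_sq_def matrix_inv_scaleR[OF metric_det_nonzero[OF chart_at] assms]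
  by (simp add: sum_distrib_left power2_eq_square field_simps)

end

section \<open>Einstein flows in Hubble time\<close>

text \<open>The local extension lives on an open set of space-time even when \<open>t\<close> is an
  endpoint of \<open>I\<close>, so its slice is \<open>C_k\<close> on an open set of space.\<close>

lemma smooth_on_slice:
  assumes "smooth_on (I \<times> \<Omega>) f" "t \<in> I" "open \<Omega>"
  shows "C_k k (\<lambda>y. f (t, y)) \<Omega>"
proof (rule C_k_local)
  fix y assume y: "y \<in> \<Omega>"
  then obtain U g where U: "open U" "(t, y) \<in> U" "C_k k g U" "\<And>z. z \<in> (I \<times> \<Omega>) \<inter> U \<Longrightarrow> g z = f z"
    using assms(1,2) unfolding smooth_on_def by (metis mem_Sigma_iff)
  let ?V = "{y. (t, y) \<in> U} \<inter> \<Omega>"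
  have "open {y. (t, y) \<in> U}"
    using continuous_open_vimage[of U "\<lambda>y. (t, y)"] U(1)
    by (simp add: vimage_def continuous_on_Pair continuous_intros)
  then have op: "open ?V" using assms(3) by auto
  have "C_k k (\<lambda>y. g (t, y)) ?V"
    using C_k_slice[OF U(1,3)] by (rule C_k_subset) auto
  then have "C_k k (\<lambda>y. f (t, y)) ?V"
    by (rule C_k_cong[OF op, rotated]) (use U(4) assms(2) in auto)
  then show "\<exists>V. open V \<and> y \<in> V \<and> V \<subseteq> \<Omega> \<and> C_k k (\<lambda>y. f (t, y)) V"
    using op y U(2) by (intro exI[of _ ?V]) auto
qed

lemma bounded_linear_matrix_component: "bounded_linear (\<lambda>M::real^'n::finite^'m::finite. M $ i $ j)"
  using bounded_linear_compose[OF bounded_linear_vec_nth[of j] bounded_linear_vec_nth[of i]] by simp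

text \<open>The two terms quadratic in \<open>K\<close> cancel: the derivative of the inverse metric
  contributes 2a|K|^2 and the evolution of \<open>K\<close> contributes -2a|K|^2. Here
  \<open>N\<close> is the inverse metric, \<open>s\<close> the Hessian of the lapse and
  \<open>r\<close> the Ricci tensor.\<close>

lemma trace_evolution_algebra:
  fixes N K :: "'n::finite \<Rightarrow> 'n \<Rightarrow> real"
  assumes N: "\<And>i j. N i j = N j i" and K: "\<And>i j. K i j = K j i"
  shows "(\<Sum>i\<in>UNIV. \<Sum>j\<in>UNIV. (2 * a * (\<Sum>k\<in>UNIV. \<Sum>l\<in>UNIV. N i k * K k l * N l j)) * K i j
      + N i j * (a * H * K i j - 2 * a * (\<Sum>k\<in>UNIV. \<Sum>l\<in>UNIV. N k l * K i k * K l j) - s i j + a * r i j))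
    = a * H * (\<Sum>i\<in>UNIV. \<Sum>j\<in>UNIV. N i j * K i j) - (\<Sum>i\<in>UNIV. \<Sum>j\<in>UNIV. N i j * s i j)
      + a * (\<Sum>i\<in>UNIV. \<Sum>j\<in>UNIV. N i j * r i j)"
proof -
  let ?Q = "quad_sum (\<lambda>i j k l. N i k * N j l * K i j * K k l)"
  have 1: "(\<Sum>i\<in>UNIV. \<Sum>j\<in>UNIV. (\<Sum>k\<in>UNIV. \<Sum>l\<in>UNIV. N i k * K k l * N l j) * K i j) = ?Q"
    unfolding quad_sum_def sum_distrib_right
  proof (intro sum.cong refl)
    fix i j k l
    show "N i k * K k l * N l j * K i j = N i k * N j l * K i j * K k l" using N[of l j] by simp
  qed
  have 2: "(\<Sum>i\<in>UNIV. \<Sum>j\<in>UNIV. N i j * (\<Sum>k\<in>UNIV. \<Sum>l\<in>UNIV. N k l * K i k * K l j)) = ?Q"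
  proof -
    have "?Q = quad_sum (\<lambda>i j k l. N i j * N k l * K i k * K j l)"
      by (rule quad_sum_swap23[symmetric])
    moreover have "(\<Sum>i\<in>UNIV. \<Sum>j\<in>UNIV. N i j * (\<Sum>k\<in>UNIV. \<Sum>l\<in>UNIV. N k l * K i k * K l j))
        = quad_sum (\<lambda>i j k l. N i j * N k l * K i k * K j l)"
      unfolding quad_sum_def sum_distrib_left
    proof (intro sum.cong refl)
      fix i j k l
      show "N i j * (N k l * K i k * K l j) = N i j * N k l * K i k * K j l" using K[of l j] by simp
    qed
    ultimately show ?thesis by simp
  qed
  have "(2 * a * x) * K i j + N i j * (a * H * K i j - 2 * a * y - s i j + a * r i j)
      = 2 * a * (x * K i j) - 2 * a * (N i j * y) + a * H * (N i j * K i j) - N i j * s i j + a * (N i j * r i j)" for x y i j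
    by (simp add: algebra_simps)
  then have "(\<Sum>i\<in>UNIV. \<Sum>j\<in>UNIV. (2 * a * (\<Sum>k\<in>UNIV. \<Sum>l\<in>UNIV. N i k * K k l * N l j)) * K i j
      + N i j * (a * H * K i j - 2 * a * (\<Sum>k\<in>UNIV. \<Sum>l\<in>UNIV. N k l * K i k * K l j) - s i j + a * r i j))
    = 2 * a * (\<Sum>i\<in>UNIV. \<Sum>j\<in>UNIV. (\<Sum>k\<in>UNIV. \<Sum>l\<in>UNIV. N i k * K k l * N l j) * K i j)
      - 2 * a * (\<Sum>i\<in>UNIV. \<Sum>j\<in>UNIV. N i j * (\<Sum>k\<in>UNIV. \<Sum>l\<in>UNIV. N k l * K i k * K l j))
      + a * H * (\<Sum>i\<in>UNIV. \<Sum>j\<in>UNIV. N i j * K i j) - (\<Sum>i\<in>UNIV. \<Sum>j\<in>UNIV. N i j * s i j)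
      + a * (\<Sum>i\<in>UNIV. \<Sum>j\<in>UNIV. N i j * r i j)"
    by (simp only: sum.distrib sum_subtractf sum_distrib_left[symmetric])
  then show ?thesis unfolding 1 2 by simp
qed

lemma mono_tendsto_at_right_INF:
  fixes f :: "real \<Rightarrow> 'b::{complete_linorder, linorder_topology}"
  assumes "T > 0" "\<And>a b. 0 < a \<Longrightarrow> a \<le> b \<Longrightarrow> b < T \<Longrightarrow> f a \<le> f b"
  shows "(f \<longlongrightarrow> (INF t\<in>{0<..<T}. f t)) (at_right 0)"
proof (rule order_tendstoI)
  fix x assume "x < (INF t\<in>{0<..<T}. f t)"
  then have "x < f t" if "t \<in> {0<..<T}" for t using that by (meson INF_lower less_le_trans)
  then show "\<forall>\<^sub>F t in at_right 0. x < f t"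
    using assms(1) by (auto simp: eventually_at_right_field intro!: exI[of _ T])
next
  fix x assume "(INF t\<in>{0<..<T}. f t) < x"
  then obtain t where t: "t \<in> {0<..<T}" "f t < x" by (auto simp: INF_less_iff)
  then have "f u < x" if "0 < u" "u < t" for u using assms(2)[of u t] that by auto
  then show "\<forall>\<^sub>F t in at_right 0. f t < x"
    using t by (auto simp: eventually_at_right_field intro!: exI[of _ t])
qed

lemma rescaled_time_bounds:
  fixes \<Lambda> s u T :: real
  assumes "\<Lambda> > 1" "0 < s" "s * \<Lambda> < T" "u \<in> {inverse \<Lambda>..\<Lambda>}"
  shows "0 < u" "0 < s * u" "s * u < T"
proof -
  have "0 < inverse \<Lambda>" using assms(1) by simp
  also have "\<dots> \<le> u" using assms(4) by simp
  finally show "0 < u" .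
  then show "0 < s * u" using assms(2) by simp
  have "s * u \<le> s * \<Lambda>" using assms(2,4) by simp
  then show "s * u < T" using assms(3) by simp
qed

text \<open>Dimension three is built into the index type. The time parameter forces the mean
  curvature to be -3/t on each slice, and the flow is used in this form.\<close>

locale hubble_flow = compact_manifold A
  for A :: "('a::{t2_space, second_countable_topology}, 3) atlas" +
  fixes L :: "real \<Rightarrow> 'a \<Rightarrow> real" and h K :: "real \<Rightarrow> ('a, 3) tensor2" and t0 :: real
  assumes flow: "einstein_flow A {0<..t0} L h K"
    and hubble: "hubble_time A {0<..t0} h K"
    and scalar_curvature_nonpos: "\<And>t p. t \<in> {0<..t0} \<Longrightarrow> scalar_curvature A (h t) p \<le> 0"
begin

section \<open>Regularity of the flow in space and time\<close>

lemma riemannian: "t \<in> {0<..t0} \<Longrightarrow> riemannian_manifold A (h t)"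
proof
  assume t: "t \<in> {0<..t0}"
  then show "riemannian_metric A (h t)" using flow unfolding einstein_flow_def by blast
  fix c i j assume c: "c \<in> A"
  have "C_k (Suc 0) (\<lambda>y. (\<lambda>(t, y). h t c (param c y)) (t, y)) (chart_img c)"
    using flow c t unfolding einstein_flow_def smooth_family_tensor_def
    by (intro smooth_on_slice[where I = "{0<..t0}"] open_img) blast+
  from C1_component[OF this bounded_linear_matrix_component]
  show "C_k (Suc 0) (\<lambda>y. h t c (param c y) $ i $ j) (chart_img c)" by simp
qed

lemma lapse_C_k: "c \<in> A \<Longrightarrow> t \<in> {0<..t0} \<Longrightarrow> C_k k (L t \<circ> param c) (chart_img c)"
proof -
  assume c: "c \<in> A" and t: "t \<in> {0<..t0}"
  have "C_k k (\<lambda>y. (\<lambda>(t, y). L t (param c y)) (t, y)) (chart_img c)"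
    using flow c t unfolding einstein_flow_def smooth_family_fun_def
    by (intro smooth_on_slice[where I = "{0<..t0}"] open_img) blast+
  then show ?thesis by (simp add: o_def)
qed

lemma continuous_on_family:
  fixes f :: "real \<Rightarrow> 'a \<Rightarrow> 'b::real_normed_vector"
  assumes c: "c \<in> A" and f: "smooth_on ({0<..t0} \<times> chart_img c) (\<lambda>(t, y). f t (param c y))"
  shows "continuous_on ({0<..<t0} \<times> chart_dom c) (\<lambda>(t, p). f t p)"
proof -
  have "continuous_on ({0<..<t0} \<times> chart_dom c) (\<lambda>z. (\<lambda>(t, y). f t (param c y)) (fst z, coords c (snd z)))"
    by (rule continuous_on_compose2[OF smooth_on_imp_continuous_on[OF f]])
      (auto intro!: continuous_intros continuous_on_compose2[OF continuous_on_coords[OF c]])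
  then show ?thesis by (rule continuous_on_eq) (use c in auto)
qed

lemma continuous_on_components:
  assumes c: "c \<in> A"
  shows "continuous_on ({0<..<t0} \<times> chart_dom c) (\<lambda>(t, p). h t c p $ i $ j)"
    and "continuous_on ({0<..<t0} \<times> chart_dom c) (\<lambda>(t, p). K t c p $ i $ j)"
proof -
  have "smooth_on ({0<..t0} \<times> chart_img c) (\<lambda>(t, y). h t c (param c y))"
    "smooth_on ({0<..t0} \<times> chart_img c) (\<lambda>(t, y). K t c (param c y))"
    using flow c unfolding einstein_flow_def smooth_family_tensor_def by blast+
  note cont = this[THEN continuous_on_family[OF c, rotated]]
  show "continuous_on ({0<..<t0} \<times> chart_dom c) (\<lambda>(t, p). h t c p $ i $ j)"
    using bounded_linear.continuous_on[OF bounded_linear_matrix_component cont(1), of i j]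
    by (simp add: case_prod_unfold)
  show "continuous_on ({0<..<t0} \<times> chart_dom c) (\<lambda>(t, p). K t c p $ i $ j)"
    using bounded_linear.continuous_on[OF bounded_linear_matrix_component cont(2), of i j]
    by (simp add: case_prod_unfold)
qed

text \<open>With an open time interval the products with chart domains are open, so continuity can
  be glued from chart to chart.\<close>

lemma continuous_on_all_charts:
  fixes f :: "real \<times> 'a \<Rightarrow> 'b::topological_space"
  assumes "\<And>c. c \<in> A \<Longrightarrow> continuous_on ({0<..<t0} \<times> chart_dom c) f"
  shows "continuous_on ({0<..<t0} \<times> UNIV) f"
proof -
  have "continuous_on (\<Union>c\<in>A. {0<..<t0} \<times> chart_dom c) f"
    by (rule continuous_on_open_UN) (auto intro: open_Times open_dom assms)
  moreover have "(\<Union>c\<in>A. {0<..<t0} \<times> chart_dom c) = {0<..<t0} \<times> UNIV"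
    using chart_exists by auto
  ultimately show ?thesis by simp
qed

lemma continuous_on_lapse: "continuous_on ({0<..<t0} \<times> UNIV) (\<lambda>(t, p). L t p)"
  using flow unfolding einstein_flow_def smooth_family_fun_def
  by (intro continuous_on_all_charts continuous_on_family) blast+

lemma continuous_on_time_slice:
  assumes "continuous_on ({0<..<t0} \<times> UNIV) (\<lambda>(t, p). f t p)" "0 < t" "t < t0"
  shows "continuous_on (UNIV :: 'a set) (f t)"
proof -
  have pair: "continuous_on UNIV (\<lambda>p::'a. (t, p))"
    by (intro continuous_on_Pair continuous_on_const continuous_on_id)
  have "range (\<lambda>p::'a. (t, p)) \<subseteq> {0<..<t0} \<times> UNIV" using assms(2,3) by auto
  from continuous_on_compose2[OF assms(1) pair this] show ?thesis by simp
qed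

lemma continuous_on_rescaled_time:
  fixes f :: "real \<Rightarrow> 'a \<Rightarrow> real"
  assumes f: "continuous_on ({0<..<t0} \<times> UNIV) (\<lambda>(t, p). f t p)"
    and "\<Lambda> > 1" "0 < s" "s * \<Lambda> < t0"
  shows "continuous_on ({inverse \<Lambda>..\<Lambda>} \<times> UNIV) (\<lambda>(u, p). f (s * u) p)"
proof -
  let ?T = "{inverse \<Lambda>..\<Lambda>} \<times> (UNIV :: 'a set)"
  have "continuous_on ?T (\<lambda>z. (s * fst z, snd z))" by (intro continuous_intros)
  moreover have "(\<lambda>z. (s * fst z, snd z)) ` ?T \<subseteq> {0<..<t0} \<times> UNIV"
    using rescaled_time_bounds[OF assms(2-4)] by auto
  ultimately have "continuous_on ?T (\<lambda>z. f (s * fst z) (snd z))"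
    using continuous_on_compose2[OF f] by fastforce
  then show ?thesis by (simp add: case_prod_unfold)
qed

section \<open>Mean curvature, norm of the second fundamental form and scalar curvature\<close>

lemma second_form_symmetric:
  assumes "t \<in> {0<..t0}" "c \<in> A" "p \<in> chart_dom c"
  shows "transpose (K t c p) = K t c p" "K t c p $ i $ j = K t c p $ j $ i"
proof -
  show *: "transpose (K t c p) = K t c p"
    using flow assms unfolding einstein_flow_def symmetric_tensor_field_def by blast
  from arg_cong[OF *, of "\<lambda>M. M $ i $ j"] show "K t c p $ i $ j = K t c p $ j $ i"
    by (simp add: transpose_def)
qed

lemma second_form_tensor_field: "t \<in> {0<..t0} \<Longrightarrow> tensor_field A (K t)"
  using flow unfolding einstein_flow_def symmetric_tensor_field_def by blast

lemma norm_sq_eq: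
  assumes "t \<in> {0<..t0}" "c \<in> A" "p \<in> chart_dom c"
  shows "norm_sq A (h t) (K t) p = metric_norm_sq (h t) (K t) c p"
  unfolding norm_sq_def
  by (rule riemannian_manifold.metric_norm_sq_chart_independent[OF riemannian[OF assms(1)]
      second_form_tensor_field[OF assms(1)] chart_at(1) assms(2) chart_at(2) assms(3)])

lemma trace_eq:
  assumes "t \<in> {0<..t0}" "c \<in> A" "p \<in> chart_dom c"
  shows "metric_trace (h t) (K t) c p = - 3 / t"
proof -
  have "metric_trace (h t) (K t) c p = mean_curvature A (h t) (K t) p"
    unfolding mean_curvature_def
    by (rule riemannian_manifold.metric_trace_chart_independent[OF riemannian[OF assms(1)]
        second_form_tensor_field[OF assms(1)] assms(2) chart_at(1) assms(3) chart_at(2)])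
  moreover have "mean_curvature A (h t) (K t) p = - 3 / t"
  proof -
    let ?m = "mean_curvature A (h t) (K t) p"
    have t: "t = - 3 / ?m" using hubble assms(1) unfolding hubble_time_def by simp
    have "t > 0" using assms(1) by simp
    \<comment> \<open>Division by zero gives 0, so a vanishing mean curvature would make the
      positive time \<open>t\<close> equal to 0.\<close>
    then have "?m \<noteq> 0" using t by (metis div_by_0 less_irrefl)
    then have "t * ?m = - 3" using t nonzero_eq_divide_eq by blast
    then show ?thesis using \<open>t > 0\<close> by (metis less_irrefl nonzero_mult_div_cancel_left)
  qed
  ultimately show ?thesis by simp
qed

text \<open>The Hamiltonian constraint in the form R = |K|^2 - H^2, with H = -3/t. The right-hand
  side is a function on the manifold, so the trace of the Ricci tensor does not depend on the
  chart.\<close>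

lemma scalar_eq:
  assumes t: "t \<in> {0<..t0}" and c: "c \<in> A" "p \<in> chart_dom c"
  shows "metric_trace (h t) (ricci (h t)) c p = norm_sq A (h t) (K t) p - 9 / t\<^sup>2"
proof -
  interpret riemannian_manifold A "h t" by (rule riemannian[OF t])
  have "metric_trace (h t) (ricci (h t)) c p - metric_norm_sq (h t) (trace_free_part (h t) (K t)) c p
       + (1 - 1 / real CARD(3)) * (metric_trace (h t) (K t) c p)\<^sup>2 = 0"
    using flow t c unfolding einstein_flow_def constraint_equations_def by blast
  moreover have "metric_norm_sq (h t) (trace_free_part (h t) (K t)) c p
      = metric_norm_sq (h t) (K t) c p - (metric_trace (h t) (K t) c p)\<^sup>2 / real CARD(3)"
    by (rule metric_norm_sq_trace_free_part[where g = "h t" and T = "K t" and c = c and p = p,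
        OF metric_det_nonzero[OF c] metric_symmetric[OF c] second_form_symmetric(1)[OF t c]])
  ultimately show ?thesis
    unfolding norm_sq_eq[OF t c] trace_eq[OF t c] by (simp add: power_divide)
qed

lemma scalar_curvature_eq:
  assumes t: "t \<in> {0<..t0}"
  shows "scalar_curvature A (h t) p = norm_sq A (h t) (K t) p - 9 / t\<^sup>2"
  unfolding scalar_curvature_def by (rule scalar_eq[OF t chart_at])

text \<open>\<open>norm_sq\<close> is computed in \<open>chart_at\<close>, which may jump from point
  to point; by chart independence a fixed chart can replace it locally.\<close>

lemma continuous_on_norm_sq: "continuous_on ({0<..<t0} \<times> UNIV) (\<lambda>(t, p). norm_sq A (h t) (K t) p)"
proof (rule continuous_on_all_charts)
  fix c assume c: "c \<in> A"
  let ?S = "{0<..<t0} \<times> chart_dom c"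
  have hc: "continuous_on ?S (\<lambda>z. h (fst z) c (snd z) $ i $ j)"
    and Kc: "continuous_on ?S (\<lambda>z. K (fst z) c (snd z) $ i $ j)" for i j
    using continuous_on_components[OF c] by (simp_all add: case_prod_unfold)
  have "continuous_on ?S (\<lambda>z. matrix_inv (h (fst z) c (snd z)) $ i $ j)" for i j
  proof (rule continuous_on_matrix_inv[OF hc])
    fix z assume "z \<in> ?S"
    then show "det (h (fst z) c (snd z)) \<noteq> 0"
      by (intro riemannian_manifold.metric_det_nonzero[OF riemannian] c) auto
  qed
  then have "continuous_on ?S (\<lambda>z. metric_norm_sq (h (fst z)) (K (fst z)) c (snd z))"
    unfolding metric_norm_sq_def by (intro continuous_on_sum continuous_on_mult Kc)
  then show "continuous_on ?S (\<lambda>(t, p). norm_sq A (h t) (K t) p)"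
    by (rule continuous_on_eq) (auto simp: norm_sq_eq[OF _ c])
qed

text \<open>The constraint reduces this to |K|^2, which involves no space derivatives of the
  metric.\<close>

lemma continuous_on_scalar_curvature:
  "continuous_on ({0<..<t0} \<times> UNIV) (\<lambda>(t, p). scalar_curvature A (h t) p)"
proof -
  have "continuous_on ({0<..<t0} \<times> UNIV) (\<lambda>z. (\<lambda>(t, p). norm_sq A (h t) (K t) p) z - 9 / (fst z)\<^sup>2)"
    by (intro continuous_on_diff continuous_on_norm_sq) (auto intro!: continuous_intros)
  then show ?thesis
    by (rule continuous_on_eq) (auto simp: scalar_curvature_eq)
qed

section \<open>The lapse equation and the growth of the volume density\<close>

lemma at_within_hubble:
  assumes "0 < t" "t < t0"
  shows "at t within {0<..t0} = at t"
proof -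
  have "{0<..t0} \<inter> {0<..<t0} - {t} = UNIV \<inter> {0<..<t0} - {t}" by auto
  from at_within_nhd[OF _ open_greaterThanLessThan this] show ?thesis using assms by simp
qed

lemma metric_derivative:
  assumes "0 < t" "t < t0" "c \<in> A" "p \<in> chart_dom c"
  shows "((\<lambda>\<tau>. h \<tau> c p $ i $ j) has_real_derivative - 2 * L t p * K t c p $ i $ j) (at t)"
proof -
  have "t \<in> {0<..t0}" using assms by simp
  then have "((\<lambda>\<tau>. h \<tau> c p $ i $ j) has_real_derivative - 2 * L t p * K t c p $ i $ j) (at t within {0<..t0})"
    using flow assms(3,4) unfolding einstein_flow_def evolution_equations_def by blast
  then show ?thesis unfolding at_within_hubble[OF assms(1,2)] .
qed

lemma second_form_derivative:
  assumes "0 < t" "t < t0" "c \<in> A" "p \<in> chart_dom c"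
  shows "((\<lambda>\<tau>. K \<tau> c p $ i $ j) has_real_derivative
        L t p * metric_trace (h t) (K t) c p * K t c p $ i $ j
        - 2 * L t p * (\<Sum>k\<in>UNIV. \<Sum>l\<in>UNIV.
            matrix_inv (h t c p) $ k $ l * K t c p $ i $ k * K t c p $ l $ j)
        - hessian (h t) (L t) c p $ i $ j
        + L t p * ricci (h t) c p $ i $ j) (at t)" (is "(_ has_real_derivative ?D) _")
proof -
  have "t \<in> {0<..t0}" using assms by simp
  then have "((\<lambda>\<tau>. K \<tau> c p $ i $ j) has_real_derivative ?D) (at t within {0<..t0})"
    using flow assms(3,4) unfolding einstein_flow_def evolution_equations_def by blast
  then show ?thesis unfolding at_within_hubble[OF assms(1,2)] .
qed

text \<open>The trace of \<open>K\<close> is differentiated in two ways: as -3/t it gives 3/t^2, and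
  by the evolution equations it gives L H^2 - \<Delta>L + L R.\<close>

lemma lapse_equation:
  assumes t: "0 < t" "t < t0" and c: "c \<in> A" "p \<in> chart_dom c"
  shows "metric_trace (h t) (hessian (h t) (L t)) c p
    = L t p * (9 / t\<^sup>2 + scalar_curvature A (h t) p) - 3 / t\<^sup>2"
proof -
  have tI: "t \<in> {0<..t0}" using t by simp
  interpret riemannian_manifold A "h t" by (rule riemannian[OF tI])
  let ?N = "\<lambda>\<tau> i j. matrix_inv (h \<tau> c p) $ i $ j" and ?K = "\<lambda>\<tau> i j. K \<tau> c p $ i $ j"
  have hD: "((\<lambda>\<tau>. h \<tau> c p $ i $ j) has_derivative (*) (- 2 * L t p * ?K t i j)) (at t)" for i j
    using metric_derivative[OF t c] unfolding has_field_derivative_def .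
  have ND: "((\<lambda>\<tau>. ?N \<tau> i j) has_real_derivative 2 * L t p * (\<Sum>k\<in>UNIV. \<Sum>l\<in>UNIV. ?N t i k * ?K t k l * ?N t l j)) (at t)" for i j
  proof -
    have "((\<lambda>\<tau>. ?N \<tau> i j) has_derivative
        (\<lambda>v. - (\<Sum>k\<in>UNIV. \<Sum>l\<in>UNIV. ?N t i k * (- 2 * L t p * ?K t k l * v) * ?N t l j))) (at t)"
      by (rule has_derivative_matrix_inv[where m = "\<lambda>\<tau>. h \<tau> c p" and D = "\<lambda>k l. (*) (- 2 * L t p * ?K t k l)",
          OF hD metric_det_nonzero[OF c] UNIV_I])
    moreover have "(\<lambda>v. - (\<Sum>k\<in>UNIV. \<Sum>l\<in>UNIV. ?N t i k * (- 2 * L t p * ?K t k l * v) * ?N t l j))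
        = (*) (2 * L t p * (\<Sum>k\<in>UNIV. \<Sum>l\<in>UNIV. ?N t i k * ?K t k l * ?N t l j))"
    proof
      fix v
      show "- (\<Sum>k\<in>UNIV. \<Sum>l\<in>UNIV. ?N t i k * (- 2 * L t p * ?K t k l * v) * ?N t l j)
        = 2 * L t p * (\<Sum>k\<in>UNIV. \<Sum>l\<in>UNIV. ?N t i k * ?K t k l * ?N t l j) * v"
        unfolding sum_distrib_left sum_distrib_right sum_negf[symmetric]
        by (intro sum.cong refl) simp
    qed
    ultimately show ?thesis unfolding has_field_derivative_def by (simp only:)
  qed
  let ?s = "\<lambda>i j. hessian (h t) (L t) c p $ i $ j" and ?r = "\<lambda>i j. ricci (h t) c p $ i $ j"
  have "((\<lambda>\<tau>. \<Sum>i\<in>UNIV. \<Sum>j\<in>UNIV. ?N \<tau> i j * ?K \<tau> i j) has_real_derivative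
      (\<Sum>i\<in>UNIV. \<Sum>j\<in>UNIV. (2 * L t p * (\<Sum>k\<in>UNIV. \<Sum>l\<in>UNIV. ?N t i k * ?K t k l * ?N t l j)) * ?K t i j
        + (L t p * metric_trace (h t) (K t) c p * ?K t i j
          - 2 * L t p * (\<Sum>k\<in>UNIV. \<Sum>l\<in>UNIV. ?N t k l * ?K t i k * ?K t l j) - ?s i j + L t p * ?r i j) * ?N t i j)) (at t)"
    by (intro DERIV_sum DERIV_mult ND second_form_derivative[OF t c])
  then have "((\<lambda>\<tau>. metric_trace (h \<tau>) (K \<tau>) c p) has_real_derivative
      (\<Sum>i\<in>UNIV. \<Sum>j\<in>UNIV. (2 * L t p * (\<Sum>k\<in>UNIV. \<Sum>l\<in>UNIV. ?N t i k * ?K t k l * ?N t l j)) * ?K t i j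
        + ?N t i j * (L t p * metric_trace (h t) (K t) c p * ?K t i j
          - 2 * L t p * (\<Sum>k\<in>UNIV. \<Sum>l\<in>UNIV. ?N t k l * ?K t i k * ?K t l j) - ?s i j + L t p * ?r i j))) (at t)"
    unfolding metric_trace_def[of "h _" "K _"] by (simp only: mult.commute)
  then have "((\<lambda>\<tau>. metric_trace (h \<tau>) (K \<tau>) c p) has_real_derivative
      L t p * metric_trace (h t) (K t) c p * metric_trace (h t) (K t) c p
      - metric_trace (h t) (hessian (h t) (L t)) c p + L t p * metric_trace (h t) (ricci (h t)) c p) (at t)"
    unfolding trace_evolution_algebra[of "?N t" "?K t", OF metric_inv_symmetric[OF c] second_form_symmetric(2)[OF tI c]]
    unfolding metric_trace_def .
  then have "((\<lambda>\<tau>. - 3 / \<tau>) has_real_derivative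
      L t p * metric_trace (h t) (K t) c p * metric_trace (h t) (K t) c p
      - metric_trace (h t) (hessian (h t) (L t)) c p + L t p * metric_trace (h t) (ricci (h t)) c p) (at t)"
    by (rule has_field_derivative_transform_within_open[where S = "{0<..<t0}"]) (use t c trace_eq in auto)
  moreover have "((\<lambda>\<tau>. - 3 / \<tau>) has_real_derivative 3 / t\<^sup>2) (at t)"
    using t by (auto intro!: derivative_eq_intros simp: power2_eq_square)
  ultimately have "L t p * metric_trace (h t) (K t) c p * metric_trace (h t) (K t) c p
      - metric_trace (h t) (hessian (h t) (L t)) c p + L t p * metric_trace (h t) (ricci (h t)) c p = 3 / t\<^sup>2"
    by (rule DERIV_unique)
  then show ?thesis
    \<comment> \<open>The trace of the Ricci tensor in the chart \<open>c\<close> and the scalar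
      curvature, computed in \<open>chart_at\<close>, are both replaced by |K|^2 - 9/t^2 and so
      identified.\<close>
    unfolding trace_eq[OF tI c] scalar_eq[OF tI c] scalar_curvature_eq[OF tI]
    by (simp add: power2_eq_square algebra_simps)
qed

lemma lapse_ge_third:
  assumes t: "0 < t" "t < t0"
  shows "1 / 3 \<le> L t p"
proof -
  have tI: "t \<in> {0<..t0}" using t by simp
  interpret riemannian_manifold A "h t" by (rule riemannian[OF tI])
  have "continuous_on UNIV (L t)" by (rule continuous_on_time_slice[OF continuous_on_lapse t])
  then obtain q where q: "\<And>p. L t q \<le> L t p"
    using continuous_attains_inf[OF compact_UNIV UNIV_not_empty] by blast
  obtain c where c: "c \<in> A" "q \<in> chart_dom c" using chart_exists by blast
  have "0 \<le> metric_trace (h t) (hessian (h t) (L t)) c q"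
    by (rule laplacian_nonneg_at_min[OF c lapse_C_k[OF c(1) tI] q])
  also have "\<dots> = L t q * (9 / t\<^sup>2 + scalar_curvature A (h t) q) - 3 / t\<^sup>2"
    by (rule lapse_equation[OF t c])
  \<comment> \<open>Positivity of the lapse and R \<le> 0 discard the curvature term; what remains
    bounds the minimum of the lapse from below.\<close>
  also have "\<dots> \<le> L t q * (9 / t\<^sup>2) - 3 / t\<^sup>2"
  proof -
    have "L t q > 0" using flow tI unfolding einstein_flow_def by blast
    then have "L t q * (9 / t\<^sup>2 + scalar_curvature A (h t) q) \<le> L t q * (9 / t\<^sup>2)"
      using scalar_curvature_nonpos[OF tI, of q] by (intro mult_left_mono) auto
    then show ?thesis by simp
  qed
  finally have "3 / t\<^sup>2 \<le> 9 * L t q / t\<^sup>2" by (simp add: mult.commute)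
  then have "3 \<le> 9 * L t q" using t by (simp add: divide_le_cancel)
  then show ?thesis using q[of p] by simp
qed

lemma integral_lapse_equation:
  assumes t: "0 < t" "t < t0"
  shows "integrable (dvol A (h t)) (\<lambda>p. L t p * (9 / t\<^sup>2 + scalar_curvature A (h t) p) - 3 / t\<^sup>2)"
    and "(\<integral>p. L t p * (9 / t\<^sup>2 + scalar_curvature A (h t) p) - 3 / t\<^sup>2 \<partial>dvol A (h t)) = 0"
proof -
  have tI: "t \<in> {0<..t0}" using t by simp
  interpret riemannian_manifold A "h t" by (rule riemannian[OF tI])
  show "integrable (dvol A (h t)) (\<lambda>p. L t p * (9 / t\<^sup>2 + scalar_curvature A (h t) p) - 3 / t\<^sup>2)"
    "(\<integral>p. L t p * (9 / t\<^sup>2 + scalar_curvature A (h t) p) - 3 / t\<^sup>2 \<partial>dvol A (h t)) = 0"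
    using laplacian_integral[OF lapse_C_k[OF _ tI] lapse_equation[OF t]] by blast+
qed

text \<open>By Jacobi's formula the logarithmic derivative of the density is -L tr K = 3L/t, and the
  normalisation by 1/t subtracts 1/t.\<close>

lemma vol_density_derivative:
  assumes t: "0 < t" "t < t0" and c: "c \<in> A" "y \<in> chart_img c"
  shows "((\<lambda>\<tau>. vol_density (h \<tau>) c y / \<tau>) has_real_derivative
      (3 * L t (param c y) - 1) / t * (vol_density (h t) c y / t)) (at t)"
proof -
  have tI: "t \<in> {0<..t0}" using t by simp
  interpret riemannian_manifold A "h t" by (rule riemannian[OF tI])
  let ?p = "param c y"
  have p: "?p \<in> chart_dom c" by (rule param_in_dom[OF c])
  have hD: "((\<lambda>\<tau>. h \<tau> c ?p $ i $ j) has_derivative (*) (- 2 * L t ?p * K t c ?p $ i $ j)) (at t)" for i j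
    using metric_derivative[OF t c(1) p] unfolding has_field_derivative_def .
  have "((\<lambda>\<tau>. det (h \<tau> c ?p)) has_derivative (\<lambda>v. det (h t c ?p) *
      (\<Sum>i\<in>UNIV. \<Sum>j\<in>UNIV. matrix_inv (h t c ?p) $ j $ i * (- 2 * L t ?p * K t c ?p $ i $ j * v)))) (at t)"
    by (rule has_derivative_det[where m = "\<lambda>\<tau>. h \<tau> c ?p" and D = "\<lambda>k l. (*) (- 2 * L t ?p * K t c ?p $ k $ l)",
        OF hD metric_det_nonzero[OF c(1) p]])
  moreover have "(\<lambda>v. det (h t c ?p) *
      (\<Sum>i\<in>UNIV. \<Sum>j\<in>UNIV. matrix_inv (h t c ?p) $ j $ i * (- 2 * L t ?p * K t c ?p $ i $ j * v)))
      = (*) (det (h t c ?p) * (6 * L t ?p / t))"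
  proof
    fix v
    have "(\<Sum>i\<in>UNIV. \<Sum>j\<in>UNIV. matrix_inv (h t c ?p) $ j $ i * (- 2 * L t ?p * K t c ?p $ i $ j * v))
        = - 2 * L t ?p * v * metric_trace (h t) (K t) c ?p"
      unfolding metric_trace_def sum_distrib_left
    proof (intro sum.cong refl)
      fix i j
      show "matrix_inv (h t c ?p) $ j $ i * (- 2 * L t ?p * K t c ?p $ i $ j * v)
          = - 2 * L t ?p * v * (matrix_inv (h t c ?p) $ i $ j * K t c ?p $ i $ j)"
        using metric_inv_symmetric[OF c(1) p, of i j] by simp
    qed
    also have "\<dots> = 6 * L t ?p / t * v" unfolding trace_eq[OF tI c(1) p] by simp
    finally show "det (h t c ?p) *
      (\<Sum>i\<in>UNIV. \<Sum>j\<in>UNIV. matrix_inv (h t c ?p) $ j $ i * (- 2 * L t ?p * K t c ?p $ i $ j * v))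
      = det (h t c ?p) * (6 * L t ?p / t) * v" by simp
  qed
  ultimately have d: "((\<lambda>\<tau>. det (h \<tau> c ?p)) has_real_derivative det (h t c ?p) * (6 * L t ?p / t)) (at t)"
    unfolding has_field_derivative_def by (simp only:)
  have pos: "det (h t c ?p) > 0" by (rule metric_det_pos[OF c(1) p])
  have "((\<lambda>\<tau>. sqrt (det (h \<tau> c ?p))) has_real_derivative
      inverse (sqrt (det (h t c ?p))) / 2 * (det (h t c ?p) * (6 * L t ?p / t))) (at t)"
    by (rule DERIV_chain2[OF DERIV_real_sqrt[OF pos] d])
  moreover have "inverse (sqrt (det (h t c ?p))) / 2 * (det (h t c ?p) * (6 * L t ?p / t))
      = sqrt (det (h t c ?p)) * (3 * L t ?p / t)"
  proof -
    have "inverse (sqrt (det (h t c ?p))) * det (h t c ?p) = sqrt (det (h t c ?p))"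
      using pos by (simp add: field_simps)
    moreover have "inverse r / 2 * (x * (6 * a / t)) = inverse r * x * (3 * a / t)" for r x a :: real by simp
    ultimately show ?thesis by (simp only:)
  qed
  ultimately have "((\<lambda>\<tau>. vol_density (h \<tau>) c y) has_real_derivative vol_density (h t) c y * (3 * L t ?p / t)) (at t)"
    unfolding vol_density_def by (simp only:)
  then have "((\<lambda>\<tau>. vol_density (h \<tau>) c y / \<tau>) has_real_derivative
      (vol_density (h t) c y * (3 * L t ?p / t) * t - vol_density (h t) c y * 1) / (t * t)) (at t)"
    using t by (intro DERIV_divide DERIV_ident) auto
  moreover have "(vol_density (h t) c y * (3 * L t ?p / t) * t - vol_density (h t) c y * 1) / (t * t)
      = (3 * L t ?p - 1) / t * (vol_density (h t) c y / t)"
    using t by (simp add: field_simps)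
  ultimately show ?thesis by (simp only:)
qed

section \<open>Evolution of the normalised volume\<close>

definition norm_vol :: "real \<Rightarrow> 'a measure" where
  "norm_vol t = scale_measure (ennreal (1 / t)) (dvol A (h t))"

lemma sets_norm_vol [simp]: "t \<in> {0<..t0} \<Longrightarrow> sets (norm_vol t) = sets borel"
  using riemannian_manifold.sets_dvol[OF riemannian] by (simp add: norm_vol_def)

lemma space_norm_vol [simp]: "t \<in> {0<..t0} \<Longrightarrow> space (norm_vol t) = UNIV"
  using riemannian_manifold.space_dvol[OF riemannian] by (simp add: norm_vol_def space_scale_measure)

lemma emeasure_norm_vol_finite:
  assumes "t \<in> {0<..t0}"
  shows "emeasure (norm_vol t) S < \<infinity>"
proof -
  interpret finite_measure "dvol A (h t)"
    by (rule riemannian_manifold.finite_measure_dvol[OF riemannian[OF assms]])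
  show ?thesis unfolding norm_vol_def 
    by (simp add: ennreal_mult_eq_top_iff less_top[symmetric] emeasure_finite)
qed

lemma nn_integral_norm_vol_chart:
  assumes t: "t \<in> {0<..t0}" and c: "c \<in> A" and f: "f \<in> borel_measurable borel"
    and S: "S \<in> sets borel" "S \<subseteq> chart_dom c"
  shows "(\<integral>\<^sup>+p\<in>S. f p \<partial>norm_vol t)
    = (\<integral>\<^sup>+y\<in>coords c ` S. f (param c y) * ennreal (vol_density (h t) c y / t) \<partial>lborel)"
proof -
  interpret riemannian_manifold A "h t" by (rule riemannian[OF t])
  have fm: "(\<lambda>p. f p * indicator S p) \<in> borel_measurable (dvol A (h t))"
    using f S(1) by (simp add: measurable_cong_sets[OF sets_dvol refl])
  have "(\<integral>\<^sup>+p\<in>S. f p \<partial>norm_vol t) = ennreal (1 / t) * (\<integral>\<^sup>+p\<in>S. f p \<partial>dvol A (h t))"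
    unfolding norm_vol_def by (rule nn_integral_scale_measure[OF fm])
  also have "\<dots> = (\<integral>\<^sup>+p. ennreal (1 / t) * (f p * indicator S p) \<partial>dvol A (h t))"
    by (rule nn_integral_cmult[symmetric, OF fm])
  also have "\<dots> = (\<integral>\<^sup>+p\<in>S. (ennreal (1 / t) * f p) \<partial>dvol A (h t))"
    by (simp add: mult.assoc)
  also have "\<dots> = (\<integral>\<^sup>+y\<in>coords c ` S. ennreal (1 / t) * f (param c y) * ennreal (vol_density (h t) c y) \<partial>lborel)"
    using f by (intro nn_integral_chart c S) simp
  also have "\<dots> = (\<integral>\<^sup>+y\<in>coords c ` S. f (param c y) * ennreal (vol_density (h t) c y / t) \<partial>lborel)"
  proof (rule nn_integral_cong)
    fix y
    have "ennreal (vol_density (h t) c y / t) = ennreal (1 / t) * ennreal (vol_density (h t) c y)" if "y \<in> coords c ` S"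
    proof -
      have "0 < vol_density (h t) c y" using that S(2) by (intro vol_density_pos c) auto
      then show ?thesis using t by (simp add: ennreal_mult[symmetric])
    qed
    then show "ennreal (1 / t) * f (param c y) * ennreal (vol_density (h t) c y) * indicator (coords c ` S) y
        = f (param c y) * ennreal (vol_density (h t) c y / t) * indicator (coords c ` S) y"
      by (auto simp: mult_ac split: split_indicator)
  qed
  finally show ?thesis .
qed

lemma emeasure_norm_vol_chart:
  assumes t: "t \<in> {0<..t0}" and c: "c \<in> A" and S: "S \<in> sets borel" "S \<subseteq> chart_dom c"
  shows "emeasure (norm_vol t) S = (\<integral>\<^sup>+y\<in>coords c ` S. ennreal (vol_density (h t) c y / t) \<partial>lborel)"
  using nn_integral_norm_vol_chart[OF t c _ S, of "\<lambda>p. 1"] S(1) t by simp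

lemma continuous_on_vol_density_family:
  assumes c: "c \<in> A"
  shows "continuous_on ({0<..<t0} \<times> chart_img c) (\<lambda>(t, y). vol_density (h t) c y)"
proof -
  have hc: "continuous_on ({0<..<t0} \<times> chart_dom c) (\<lambda>z. h (fst z) c (snd z) $ i $ j)" for i j
    using continuous_on_components(1)[OF c] by (simp add: case_prod_unfold)
  have "continuous_on ({0<..<t0} \<times> chart_img c) (\<lambda>z. h (fst z) c (param c (snd z)) $ i $ j)" for i j
  proof -
    have "continuous_on ({0<..<t0} \<times> chart_img c) (\<lambda>z. (fst z, param c (snd z)))"
      by (auto intro!: continuous_intros continuous_on_compose2[OF continuous_on_param[OF c]])
    moreover have "(\<lambda>z. (fst z, param c (snd z))) ` ({0<..<t0} \<times> chart_img c) \<subseteq> {0<..<t0} \<times> chart_dom c"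
    proof (intro image_subsetI)
      fix z assume "z \<in> {0<..<t0} \<times> chart_img c"
      then show "(fst z, param c (snd z)) \<in> {0<..<t0} \<times> chart_dom c"
        using param_in_dom[OF c, of "snd z"] unfolding mem_Times_iff by simp
    qed
    ultimately show ?thesis using continuous_on_compose2[OF hc] by force
  qed
  then have "continuous_on ({0<..<t0} \<times> chart_img c) (\<lambda>z. sqrt (det (h (fst z) c (param c (snd z)))))"
    by (intro continuous_on_real_sqrt continuous_on_det)
  then show ?thesis by (simp add: vol_density_def case_prod_unfold)
qed

lemma lapse_measurable:
  assumes "0 < t" "t < t0"
  shows "L t \<in> borel_measurable borel"
  by (intro borel_measurable_continuous_onI continuous_on_time_slice continuous_on_lapse assms)

text \<open>This is \<open>\<partial>\<^sub>t \<mu>\<^sub>t = ((3L - 1)/t) \<mu>\<^sub>t\<close> with \<open>\<mu>\<^sub>t = norm_vol t\<close>, integrated over the rescaled time \<open>u = t/s\<close>.\<close>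

lemma volume_evolution_chart:
  assumes s: "0 < s" and ab: "0 < a" "a \<le> b" "s * b < t0" and c: "c \<in> A"
    and S: "S \<in> sets borel" "S \<subseteq> chart_dom c"
  defines "I \<equiv> (\<lambda>u. \<integral>\<^sup>+p\<in>S. ennreal ((3 * L (s * u) p - 1) / u) \<partial>norm_vol (s * u))"
  shows "(\<lambda>u. I u * indicator {a..b} u) \<in> borel_measurable borel" (is ?M)
    and "emeasure (norm_vol (s * b)) S = emeasure (norm_vol (s * a)) S + (\<integral>\<^sup>+u\<in>{a..b}. I u \<partial>lborel)" (is ?E)
proof -
  define \<Phi> where "\<Phi> u y = (3 * L (s * u) (param c y) - 1) / u * (vol_density (h (s * u)) c y / (s * u))" for u y
  define r where "r u y = vol_density (h (s * u)) c y / (s * u)" for u y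
  let ?C = "coords c ` S"
  have C: "?C \<in> sets borel" "?C \<subseteq> chart_img c" using coords_image_borel[OF c S] S(2) by auto
  have u: "0 < u" "0 < s * u" "s * u < t0" if "u \<in> {a..b}" for u
  proof -
    show "0 < u" using that ab by simp
    then show "0 < s * u" using s by simp
    have "s * u \<le> s * b" using that s by simp
    then show "s * u < t0" using ab by simp
  qed
  have uI: "s * u \<in> {0<..t0}" if "u \<in> {a..b}" for u using u[OF that] by simp
  have dens: "0 < vol_density (h (s * u)) c y" if "u \<in> {a..b}" "y \<in> chart_img c" for u y
    by (rule riemannian_manifold.vol_density_pos[OF riemannian[OF uI[OF that(1)]] c that(2)])
  have W0: "0 \<le> (3 * L (s * u) p - 1) / u" if "u \<in> {a..b}" for u p
    using lapse_ge_third[OF u(2,3)[OF that], of p] u(1)[OF that] by simp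
  have \<Phi>0: "0 \<le> \<Phi> u y" if "u \<in> {a..b}" "y \<in> chart_img c" for u y
    unfolding \<Phi>_def using W0[OF that(1), of "param c y"] dens[OF that] u[OF that(1)]
    by (intro mult_nonneg_nonneg) auto
  \<comment> \<open>The integrand is continuous only over the time interval times the chart image;
    its extension by zero is measurable on the whole product, as Tonelli's theorem requires.\<close>
  define X where "X = (\<lambda>z. indicator ({a..b} \<times> chart_img c) z *\<^sub>R \<Phi> (fst z) (snd z))"
  have Xm: "X \<in> borel_measurable borel" unfolding X_def
  proof (rule borel_measurable_continuous_on_indicator)
    have "{a..b} \<times> chart_img c \<in> sets (borel \<Otimes>\<^sub>M borel)"
      using open_img[OF c] by (intro pair_measureI) auto
    then show "{a..b} \<times> chart_img c \<in> sets borel" unfolding borel_prod .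
    let ?T = "{a..b} \<times> chart_img c"
    have i1: "(\<lambda>z. (s * fst z, param c (snd z))) ` ?T \<subseteq> {0<..<t0} \<times> chart_dom c"
    proof (intro image_subsetI)
      fix z assume "z \<in> ?T"
      then show "(s * fst z, param c (snd z)) \<in> {0<..<t0} \<times> chart_dom c"
        using param_in_dom[OF c, of "snd z"] u[of "fst z"] unfolding mem_Times_iff by simp
    qed
    have i2: "(\<lambda>z. (s * fst z, snd z)) ` ?T \<subseteq> {0<..<t0} \<times> chart_img c"
      using u by auto
    have "continuous_on ?T (\<lambda>z. (s * fst z, param c (snd z)))"
      by (auto intro!: continuous_intros continuous_on_compose2[OF continuous_on_param[OF c]])
    from continuous_on_compose2[OF continuous_on_lapse this]
    have "continuous_on ?T (\<lambda>z. L (s * fst z) (param c (snd z)))" using i1 by auto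
    moreover have "continuous_on ?T (\<lambda>z. (s * fst z, snd z))"
      by (auto intro!: continuous_intros)
    from continuous_on_compose2[OF continuous_on_vol_density_family[OF c] this i2]
    have "continuous_on ?T (\<lambda>z. vol_density (h (s * fst z)) c (snd z))" by simp
    ultimately show "continuous_on ?T (\<lambda>z. \<Phi> (fst z) (snd z))"
      unfolding \<Phi>_def using u by (intro continuous_intros ballI) fastforce+
  qed
  define g where "g = (\<lambda>(u, y). ennreal (X (u, y)) * indicator ?C y)"
  have gm: "g \<in> borel_measurable (lborel \<Otimes>\<^sub>M lborel)"
  proof -
    have X': "X \<in> borel_measurable (lborel \<Otimes>\<^sub>M lborel)"
      using Xm by (simp add: lborel_prod)
    have "(\<lambda>z. ennreal (X z) * indicator ?C (snd z)) \<in> borel_measurable (lborel \<Otimes>\<^sub>M lborel)"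
    proof (intro borel_measurable_times_ennreal measurable_compose[OF X' measurable_ennreal])
      have "(\<lambda>y. indicator ?C y :: ennreal) \<in> borel_measurable lborel" using C(1) by simp
      then show "(\<lambda>z. indicator ?C (snd z) :: ennreal) \<in> borel_measurable (lborel \<Otimes>\<^sub>M lborel)"
        by (rule measurable_compose[OF measurable_snd])
    qed
    then show ?thesis by (simp add: g_def case_prod_unfold)
  qed
  have I_eq: "I u * indicator {a..b} u = (\<integral>\<^sup>+y. g (u, y) \<partial>lborel)" for u
  proof (cases "u \<in> {a..b}")
    case True
    have "(\<lambda>p. ennreal ((3 * L (s * u) p - 1) / u)) \<in> borel_measurable borel"
      using lapse_measurable[OF u(2,3)[OF True]] by measurable
    from nn_integral_norm_vol_chart[OF uI[OF True] c this S]
    have "I u = (\<integral>\<^sup>+y\<in>?C. ennreal ((3 * L (s * u) (param c y) - 1) / u) * ennreal (vol_density (h (s * u)) c y / (s * u)) \<partial>lborel)"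
      unfolding I_def .
    also have "\<dots> = (\<integral>\<^sup>+y. g (u, y) \<partial>lborel)"
    proof (rule nn_integral_cong)
      fix y
      show "ennreal ((3 * L (s * u) (param c y) - 1) / u) * ennreal (vol_density (h (s * u)) c y / (s * u)) * indicator ?C y = g (u, y)"
      proof (cases "y \<in> ?C")
        case y: True
        then have "y \<in> chart_img c" using C(2) by blast
        then have "X (u, y) = \<Phi> u y" using True by (simp add: X_def)
        moreover have "ennreal (\<Phi> u y) = ennreal ((3 * L (s * u) (param c y) - 1) / u) * ennreal (vol_density (h (s * u)) c y / (s * u))"
          unfolding \<Phi>_def using W0[OF True, of "param c y"] dens[OF True \<open>y \<in> chart_img c\<close>] u[OF True]
          by (intro ennreal_mult) auto
        ultimately show ?thesis using y by (simp add: g_def)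
      qed (simp add: g_def)
    qed
    finally show ?thesis using True by simp
  next
    case False
    then have "g (u, y) = 0" for y by (auto simp: g_def X_def indicator_def)
    then show ?thesis using False by simp
  qed
  have "(\<lambda>u. \<integral>\<^sup>+y. g (u, y) \<partial>lborel) \<in> borel_measurable lborel"
    using gm by (rule lborel.borel_measurable_nn_integral_fst)
  then show ?M unfolding I_eq by simp
  have r_deriv: "((\<lambda>u. r u y) has_real_derivative \<Phi> u y) (at u)" if "u \<in> {a..b}" "y \<in> chart_img c" for u y
  proof -
    have "((\<lambda>u. s * u) has_real_derivative s) (at u)" by (auto intro!: derivative_eq_intros)
    from DERIV_chain2[OF vol_density_derivative[OF u(2,3)[OF that(1)] c that(2)] this]
    have "((\<lambda>u. r u y) has_real_derivative
        (3 * L (s * u) (param c y) - 1) / (s * u) * (vol_density (h (s * u)) c y / (s * u)) * s) (at u)"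
      by (simp add: r_def)
    moreover have "(3 * L (s * u) (param c y) - 1) / (s * u) * (vol_density (h (s * u)) c y / (s * u)) * s = \<Phi> u y"
      using s by (simp add: \<Phi>_def)
    ultimately show ?thesis by simp
  qed
  \<comment> \<open>For fixed \<open>y\<close> this is the fundamental theorem of calculus in
    \<open>u\<close>; the sign of \<open>3 * L - 1\<close> makes the increment nonnegative, so it
    can be expressed in \<open>ennreal\<close>.\<close>
  have r_eq: "ennreal (r b y) * indicator ?C y = ennreal (r a y) * indicator ?C y + (\<integral>\<^sup>+u. g (u, y) \<partial>lborel)" for y
  proof (cases "y \<in> ?C")
    case True
    then have y: "y \<in> chart_img c" using C(2) by blast
    have int: "((\<lambda>u. \<Phi> u y) has_integral r b y - r a y) {a..b}"
      using r_deriv[OF _ y] ab(2)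
      by (intro fundamental_theorem_of_calculus)
        (auto simp: has_real_derivative_iff_has_vector_derivative[symmetric] intro: has_field_derivative_at_within)
    have mono: "0 \<le> r b y - r a y"
      by (rule has_integral_nonneg[OF int]) (use \<Phi>0 y in auto)
    have ra: "0 \<le> r a y"
      unfolding r_def using dens[of a y] ab s y by simp
    have "(\<integral>\<^sup>+u. g (u, y) \<partial>lborel) = (\<integral>\<^sup>+u. ennreal (\<Phi> u y) * indicator {a..b} u \<partial>lborel)"
      using True y by (intro nn_integral_cong) (auto simp: g_def X_def split: split_indicator)
    also have "\<dots> = ennreal (r b y - r a y)"
      by (rule nn_integral_has_integral_lebesgue'[OF _ int]) (use \<Phi>0 y in auto)
    finally have "(\<integral>\<^sup>+u. g (u, y) \<partial>lborel) = ennreal (r b y - r a y)" .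
    moreover have "ennreal (r a y) + ennreal (r b y - r a y) = ennreal (r b y)"
      using mono ra by (simp add: ennreal_plus[symmetric] del: ennreal_plus)
    ultimately show ?thesis using True by simp
  qed (simp add: g_def)
  have ra_m: "(\<lambda>y. ennreal (r a y) * indicator ?C y) \<in> borel_measurable lborel"
  proof -
    have aI: "a \<in> {a..b}" using ab by simp
    have "(\<lambda>y. ennreal (indicator (chart_img c) y * vol_density (h (s * a)) c y / (s * a)) * indicator ?C y) \<in> borel_measurable lborel"
      using riemannian_manifold.vol_density_measurable[OF riemannian[OF uI[OF aI]] c] C(1) by simp
    moreover have "(\<lambda>y. ennreal (indicator (chart_img c) y * vol_density (h (s * a)) c y / (s * a)) * indicator ?C y)
        = (\<lambda>y. ennreal (r a y) * indicator ?C y)"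
      using C(2) by (auto simp: r_def fun_eq_iff split: split_indicator)
    ultimately show ?thesis by simp
  qed
  have gm2: "(\<lambda>y. \<integral>\<^sup>+u. g (u, y) \<partial>lborel) \<in> borel_measurable lborel"
    using measurable_pair_swap[OF gm] lborel.borel_measurable_nn_integral_fst[of "\<lambda>z. g (snd z, fst z)" lborel]
    by (simp add: case_prod_unfold)
  have em: "emeasure (norm_vol (s * v)) S = (\<integral>\<^sup>+y. ennreal (r v y) * indicator ?C y \<partial>lborel)" if "v \<in> {a..b}" for v
    unfolding r_def by (rule emeasure_norm_vol_chart[OF uI[OF that] c S])
  have "emeasure (norm_vol (s * b)) S = (\<integral>\<^sup>+y. ennreal (r a y) * indicator ?C y + (\<integral>\<^sup>+u. g (u, y) \<partial>lborel) \<partial>lborel)"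
    using em[of b] ab unfolding r_eq by simp
  also have "\<dots> = emeasure (norm_vol (s * a)) S + (\<integral>\<^sup>+y. \<integral>\<^sup>+u. g (u, y) \<partial>lborel \<partial>lborel)"
    using em[of a] ab nn_integral_add[OF ra_m gm2] by simp
  also have "(\<integral>\<^sup>+y. \<integral>\<^sup>+u. g (u, y) \<partial>lborel \<partial>lborel) = (\<integral>\<^sup>+u. \<integral>\<^sup>+y. g (u, y) \<partial>lborel \<partial>lborel)"
    using lborel_pair.Fubini[OF gm] by simp
  finally show ?E unfolding I_eq .
qed

text \<open>The chart identity is applied to the parts of \<open>S\<close> cut out by a finite Borel
  partition and summed.\<close>

lemma volume_evolution:
  assumes s: "0 < s" and ab: "0 < a" "a \<le> b" "s * b < t0" and S: "S \<in> sets borel"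
  defines "I \<equiv> (\<lambda>u. \<integral>\<^sup>+p\<in>S. ennreal ((3 * L (s * u) p - 1) / u) \<partial>norm_vol (s * u))"
  shows "(\<lambda>u. I u * indicator {a..b} u) \<in> borel_measurable borel" (is ?M)
    and "emeasure (norm_vol (s * b)) S = emeasure (norm_vol (s * a)) S + (\<integral>\<^sup>+u\<in>{a..b}. I u \<partial>lborel)" (is ?E)
proof -
  obtain m :: nat and cs B where P: "\<And>i. i < m \<Longrightarrow> cs i \<in> A" "\<And>i. i < m \<Longrightarrow> B i \<in> sets borel"
    "\<And>i. i < m \<Longrightarrow> B i \<subseteq> chart_dom (cs i)" "disjoint_family_on B {..<m}" "(\<Union>i<m. B i) = UNIV"
    using finite_borel_partition by blast
  have u: "0 < u" "0 < s * u" "s * u < t0" if "u \<in> {a..b}" for u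
  proof -
    show "0 < u" using that ab by simp
    then show "0 < s * u" using s by simp
    have "s * u \<le> s * b" using that s by simp
    then show "s * u < t0" using ab by simp
  qed
  have uI: "s * u \<in> {0<..t0}" if "u \<in> {a..b}" for u using u[OF that] by simp
  have SB: "S \<inter> B i \<in> sets borel" "S \<inter> B i \<subseteq> chart_dom (cs i)" if "i < m" for i
    using S P(2,3)[OF that] by auto
  define J where "J i u = (\<integral>\<^sup>+p\<in>S \<inter> B i. ennreal ((3 * L (s * u) p - 1) / u) \<partial>norm_vol (s * u))" for i u
  have ind: "indicator S p = (\<Sum>i<m. indicator (S \<inter> B i) p :: ennreal)" for p
  proof -
    have "S = (\<Union>i<m. S \<inter> B i)" using P(5) by blast
    moreover have "disjoint_family_on (\<lambda>i. S \<inter> B i) {..<m}"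
      using P(4) by (auto simp: disjoint_family_on_def)
    ultimately show ?thesis using indicator_UN_disjoint[of "{..<m}" "\<lambda>i. S \<inter> B i" p] by simp
  qed
  have em: "emeasure (norm_vol (s * v)) S = (\<Sum>i<m. emeasure (norm_vol (s * v)) (S \<inter> B i))" if "v \<in> {a..b}" for v
  proof -
    have "(\<Sum>i<m. emeasure (norm_vol (s * v)) (S \<inter> B i)) = emeasure (norm_vol (s * v)) (\<Union>i<m. S \<inter> B i)"
      using SB(1) P(4) uI[OF that] by (intro sum_emeasure) (auto simp: disjoint_family_on_def)
    moreover have "(\<Union>i<m. S \<inter> B i) = S" using P(5) by blast
    ultimately show ?thesis by simp
  qed
  have I_eq: "I u * indicator {a..b} u = (\<Sum>i<m. J i u * indicator {a..b} u)" for u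
  proof (cases "u \<in> {a..b}")
    case True
    have "I u = (\<integral>\<^sup>+p. (\<Sum>i<m. ennreal ((3 * L (s * u) p - 1) / u) * indicator (S \<inter> B i) p) \<partial>norm_vol (s * u))"
      unfolding I_def ind by (simp add: sum_distrib_left)
    also have "\<dots> = (\<Sum>i<m. J i u)"
      unfolding J_def
    proof (rule nn_integral_sum)
      fix i assume "i \<in> {..<m}"
      then have "S \<inter> B i \<in> sets borel" using SB by blast
      moreover have "L (s * u) \<in> borel_measurable borel" using lapse_measurable u[OF True] by blast
      ultimately have "(\<lambda>p. ennreal ((3 * L (s * u) p - 1) / u) * indicator (S \<inter> B i) p) \<in> borel_measurable borel"
        by measurable
      then show "(\<lambda>p. ennreal ((3 * L (s * u) p - 1) / u) * indicator (S \<inter> B i) p) \<in> borel_measurable (norm_vol (s * u))"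
        using measurable_cong_sets[OF sets_norm_vol[OF uI[OF True]] refl] by blast
    qed
    finally show ?thesis using True by simp
  qed simp
  have ch: "(\<lambda>u. J i u * indicator {a..b} u) \<in> borel_measurable borel"
    "emeasure (norm_vol (s * b)) (S \<inter> B i) = emeasure (norm_vol (s * a)) (S \<inter> B i) + (\<integral>\<^sup>+u\<in>{a..b}. J i u \<partial>lborel)"
    if "i < m" for i
    unfolding J_def using volume_evolution_chart[OF s ab P(1)[OF that] SB[OF that]] by blast+
  show ?M unfolding I_eq using ch(1) by (intro borel_measurable_sum) auto
  have "emeasure (norm_vol (s * b)) S = (\<Sum>i<m. emeasure (norm_vol (s * a)) (S \<inter> B i)) + (\<Sum>i<m. \<integral>\<^sup>+u\<in>{a..b}. J i u \<partial>lborel)"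
    using em[of b] ab ch(2) by (simp add: sum.distrib)
  also have "(\<Sum>i<m. emeasure (norm_vol (s * a)) (S \<inter> B i)) = emeasure (norm_vol (s * a)) S"
    using em[of a] ab by simp
  also have "(\<Sum>i<m. \<integral>\<^sup>+u\<in>{a..b}. J i u \<partial>lborel) = (\<integral>\<^sup>+u\<in>{a..b}. I u \<partial>lborel)"
    unfolding I_eq using ch(1) by (intro nn_integral_sum[symmetric]) auto
  finally show ?E .
qed

lemma norm_vol_mono:
  assumes "0 < a" "a \<le> b" "b < t0" "S \<in> sets borel"
  shows "emeasure (norm_vol a) S \<le> emeasure (norm_vol b) S"
  using volume_evolution(2)[of 1 a b S] assms by simp

section \<open>Comparison with the limiting measure\<close>

lemma sets_dvol_0 [simp]: "sets (dvol_0 A h) = sets borel"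
  unfolding dvol_0_def limit_measure_def using sets.sets_measure_of_eq[of borel] by simp

text \<open>On a Borel set \<open>dvol_0\<close> takes either the limit of the monotone family
  \<open>norm_vol\<close>, which is its infimum, or the default 0 of \<open>measure_of\<close>; both
  lie below every member of the family.\<close>

lemma dvol_0_le:
  assumes "0 < t" "t < t0"
  shows "emeasure (dvol_0 A h) S \<le> emeasure (norm_vol t) S"
proof (cases "S \<in> sets borel")
  case True
  have "((\<lambda>t. emeasure (norm_vol t) S) \<longlongrightarrow> (INF t\<in>{0<..<t0}. emeasure (norm_vol t) S)) (at_right 0)"
    using assms norm_vol_mono True by (intro mono_tendsto_at_right_INF) auto
  then have "Lim (at_right 0) (\<lambda>t. emeasure (norm_vol t) S) = (INF t\<in>{0<..<t0}. emeasure (norm_vol t) S)"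
    by (intro tendsto_Lim) auto
  also have "\<dots> \<le> emeasure (norm_vol t) S" using assms by (intro INF_lower) simp
  finally show ?thesis
    unfolding dvol_0_def limit_measure_def emeasure_measure_of_conv norm_vol_def by auto
next
  case False
  then show ?thesis by (simp add: emeasure_notin_sets)
qed

lemma finite_measure_dvol_0: "t0 > 0 \<Longrightarrow> finite_measure (dvol_0 A h)"
proof
  assume "t0 > 0"
  then have "emeasure (dvol_0 A h) (space (dvol_0 A h)) \<le> emeasure (norm_vol (t0 / 2)) (space (dvol_0 A h))"
    by (intro dvol_0_le) auto
  also have "\<dots> < \<infinity>" using \<open>t0 > 0\<close> by (intro emeasure_norm_vol_finite) auto
  finally show "emeasure (dvol_0 A h) (space (dvol_0 A h)) \<noteq> \<infinity>" by simp
qed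

lemma nn_integral_dvol_0_le:
  assumes "0 < t" "t < t0"
  shows "integral\<^sup>N (dvol_0 A h) f \<le> integral\<^sup>N (norm_vol t) f"
proof (rule nn_integral_mono_measure)
  show *: "sets (dvol_0 A h) = sets (norm_vol t)" using assms by simp
  show "dvol_0 A h \<le> norm_vol t"
    using * dvol_0_le[OF assms] sets_eq_imp_space_eq[OF *] by (auto simp: le_measure_iff le_fun_def)
qed

section \<open>Convergence in L1\<close>

text \<open>The estimate common to all three limits. The bound is required on each slice separately
  because the curvature estimate holds only after integration over a slice, not pointwise.\<close>

lemma L1_convergence:
  fixes G :: "real \<Rightarrow> real \<Rightarrow> 'a \<Rightarrow> real"
  assumes t0: "t0 > 0" and \<Lambda>: "\<Lambda> > 1" and C: "0 \<le> C"
    and cont: "\<And>s. 0 < s \<Longrightarrow> s * \<Lambda> < t0 \<Longrightarrow> continuous_on ({inverse \<Lambda>..\<Lambda>} \<times> UNIV) (\<lambda>(u, p). G s u p)"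
    and bound: "\<And>s u. 0 < s \<Longrightarrow> s * \<Lambda> < t0 \<Longrightarrow> u \<in> {inverse \<Lambda>..\<Lambda>} \<Longrightarrow>
      (\<integral>\<^sup>+p. ennreal \<bar>G s u p\<bar> \<partial>norm_vol (s * u))
        \<le> ennreal C * (\<integral>\<^sup>+p. ennreal ((3 * L (s * u) p - 1) / u) \<partial>norm_vol (s * u))"
  shows "tendsto_zero_L1 (restrict_space lborel {inverse \<Lambda>..\<Lambda>} \<Otimes>\<^sub>M dvol_0 A h) (at_right 0) (\<lambda>s (u, p). G s u p)"
proof -
  let ?I = "{inverse \<Lambda>..\<Lambda>}"
  let ?R = "restrict_space lborel ?I"
  define M where "M = ?R \<Otimes>\<^sub>M dvol_0 A h"
  interpret N0: finite_measure "dvol_0 A h" by (rule finite_measure_dvol_0[OF t0])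
  define v where "v t = measure (norm_vol t) UNIV" for t
  have v: "emeasure (norm_vol t) UNIV = ennreal (v t)" if "0 < t" "t < t0" for t
    unfolding v_def using emeasure_norm_vol_finite[of t UNIV] that
    by (intro emeasure_eq_ennreal_measure) auto
  have v_mono: "v a \<le> v b" if "0 < a" "a \<le> b" "b < t0" for a b
    using norm_vol_mono[OF that, of UNIV] v[of a] v[of b] that
    by (simp add: ennreal_le_iff[OF measure_nonneg] v_def)
  have iL: "0 < inverse \<Lambda>" "inverse \<Lambda> \<le> \<Lambda>"
    using \<Lambda> by (auto simp: inverse_le_1_iff intro: order_trans[of _ 1])
  have main: "integrable M (\<lambda>(u, p). G s u p) \<and>
      (\<integral>z. \<bar>case z of (u, p) \<Rightarrow> G s u p\<bar> \<partial>M) \<le> C * (v (s * \<Lambda>) - v (s * inverse \<Lambda>))"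
    if s: "0 < s" "s * \<Lambda> < t0" for s
  proof -
    let ?f = "\<lambda>(u, p). G s u p"
    have s': "0 < s * inverse \<Lambda>" "s * inverse \<Lambda> \<le> s * \<Lambda>" using s iL by auto
    have fm: "?f \<in> borel_measurable M"
    proof -
      \<comment> \<open>Second countability identifies the product of the Borel sigma-algebras with
        the Borel sigma-algebra of the product, which makes the continuous integrand jointly
        measurable.\<close>
      have "?I \<times> (UNIV :: 'a set) \<in> sets (borel \<Otimes>\<^sub>M borel)" by (intro pair_measureI) auto
      then have B: "?I \<times> (UNIV :: 'a set) \<in> sets borel" unfolding borel_prod .
      have "(\<lambda>z. indicator (?I \<times> UNIV) z *\<^sub>R ?f z) \<in> borel_measurable (borel \<Otimes>\<^sub>M borel)"
        unfolding borel_prod by (rule borel_measurable_continuous_on_indicator[OF B cont[OF s]])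
      moreover have "(\<lambda>z. (fst z, snd z)) \<in> M \<rightarrow>\<^sub>M borel \<Otimes>\<^sub>M borel"
        unfolding M_def
      proof (intro measurable_Pair)
        have "(\<lambda>u. u) \<in> ?R \<rightarrow>\<^sub>M borel" by (intro measurable_restrict_space1) simp
        then show "fst \<in> ?R \<Otimes>\<^sub>M dvol_0 A h \<rightarrow>\<^sub>M borel"
          using measurable_compose[OF measurable_fst] by blast
        have "(\<lambda>p. p) \<in> dvol_0 A h \<rightarrow>\<^sub>M borel" by (simp add: measurable_ident_sets)
        then show "snd \<in> ?R \<Otimes>\<^sub>M dvol_0 A h \<rightarrow>\<^sub>M borel"
          using measurable_compose[OF measurable_snd] by blast
      qed
      ultimately have "(\<lambda>z. indicator (?I \<times> UNIV) z *\<^sub>R ?f z) \<in> borel_measurable M"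
        using measurable_compose by fastforce
      then show ?thesis
        by (rule measurable_cong[THEN iffD1, rotated])
          (auto simp: M_def space_pair_measure space_restrict_space)
    qed
    define W where "W u = (\<integral>\<^sup>+p. ennreal ((3 * L (s * u) p - 1) / u) \<partial>norm_vol (s * u))" for u
    have "(\<integral>\<^sup>+z. ennreal \<bar>?f z\<bar> \<partial>M) = (\<integral>\<^sup>+u. \<integral>\<^sup>+p. ennreal \<bar>G s u p\<bar> \<partial>dvol_0 A h \<partial>?R)"
      using N0.nn_integral_fst[of "\<lambda>z. ennreal \<bar>?f z\<bar>" ?R] fm unfolding M_def by simp
    also have "\<dots> = (\<integral>\<^sup>+u\<in>?I. (\<integral>\<^sup>+p. ennreal \<bar>G s u p\<bar> \<partial>dvol_0 A h) \<partial>lborel)"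
      by (rule nn_integral_restrict_space) simp
    also have "\<dots> \<le> (\<integral>\<^sup>+u. ennreal C * (W u * indicator ?I u) \<partial>lborel)"
    proof (rule nn_integral_mono)
      fix u
      show "(\<integral>\<^sup>+p. ennreal \<bar>G s u p\<bar> \<partial>dvol_0 A h) * indicator ?I u \<le> ennreal C * (W u * indicator ?I u)"
      proof (cases "u \<in> ?I")
        case True
        \<comment> \<open>For fixed \<open>u\<close> the limiting measure is exchanged for the slice
          measure at time \<open>s * u\<close>, the one for which \<open>bound\<close> and the
          volume evolution hold.\<close>
        from nn_integral_dvol_0_le[OF rescaled_time_bounds(2,3)[OF \<Lambda> s True]] bound[OF s True] True
        show ?thesis unfolding W_def by (auto intro: order_trans)
      qed simp
    qed
    also have "\<dots> = ennreal C * (\<integral>\<^sup>+u\<in>?I. W u \<partial>lborel)"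
      using volume_evolution(1)[OF s(1) iL s(2), of UNIV] unfolding W_def by (intro nn_integral_cmult) simp
    also have "(\<integral>\<^sup>+u\<in>?I. W u \<partial>lborel) = ennreal (v (s * \<Lambda>) - v (s * inverse \<Lambda>))"
    proof -
      have "ennreal (v (s * \<Lambda>)) = ennreal (v (s * inverse \<Lambda>)) + (\<integral>\<^sup>+u\<in>?I. W u \<partial>lborel)"
        using volume_evolution(2)[OF s(1) iL s(2), of UNIV] v[of "s * \<Lambda>"] v[of "s * inverse \<Lambda>"] s s'
        unfolding W_def by simp
      then have "(\<integral>\<^sup>+u\<in>?I. W u \<partial>lborel) = ennreal (v (s * \<Lambda>)) - ennreal (v (s * inverse \<Lambda>))"
        by (simp add: ennreal_add_diff_cancel_left)
      then show ?thesis by (simp add: ennreal_minus v_def)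
    qed
    also have "ennreal C * \<dots> = ennreal (C * (v (s * \<Lambda>) - v (s * inverse \<Lambda>)))"
      using C v_mono[OF s' s(2)] by (simp add: ennreal_mult)
    finally have le: "(\<integral>\<^sup>+z. ennreal \<bar>?f z\<bar> \<partial>M) \<le> ennreal (C * (v (s * \<Lambda>) - v (s * inverse \<Lambda>)))" .
    then have int: "integrable M ?f"
      using fm by (intro integrableI_bounded) (auto intro: le_less_trans)
    have "ennreal (\<integral>z. \<bar>?f z\<bar> \<partial>M) = (\<integral>\<^sup>+z. ennreal \<bar>?f z\<bar> \<partial>M)"
      using int by (intro nn_integral_eq_integral[symmetric] integrable_abs) auto
    then have le': "ennreal (\<integral>z. \<bar>?f z\<bar> \<partial>M) \<le> ennreal (C * (v (s * \<Lambda>) - v (s * inverse \<Lambda>)))"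
      using le by (simp only:)
    \<comment> \<open>This sign permits the inequality to be read back from \<open>ennreal\<close>
      to the reals.\<close>
    have "0 \<le> C * (v (s * \<Lambda>) - v (s * inverse \<Lambda>))"
      using C v_mono[OF s' s(2)] by simp
    from iffD1[OF ennreal_le_iff[OF this] le'] int show ?thesis by blast
  qed
  have ev: "\<forall>\<^sub>F s in at_right 0. 0 < s \<and> s * \<Lambda> < t0"
    using t0 \<Lambda> by (auto simp: eventually_at_right_field field_simps intro!: exI[of _ "t0 / \<Lambda>"])
  have vlim: "(v \<longlongrightarrow> enn2real (INF t\<in>{0<..<t0}. emeasure (norm_vol t) UNIV)) (at_right 0)"
  proof -
    let ?l = "INF t\<in>{0<..<t0}. emeasure (norm_vol t) UNIV"
    have "((\<lambda>t. emeasure (norm_vol t) UNIV) \<longlongrightarrow> ?l) (at_right 0)"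
      using norm_vol_mono t0 by (intro mono_tendsto_at_right_INF) auto
    moreover have "?l < top"
    proof -
      have "?l \<le> emeasure (norm_vol (t0 / 2)) UNIV" using t0 by (intro INF_lower) auto
      also have "\<dots> < top" using emeasure_norm_vol_finite[of "t0 / 2" UNIV] t0 by auto
      finally show ?thesis .
    qed
    ultimately show ?thesis
      unfolding v_def measure_def by (intro tendsto_enn2real) auto
  qed
  have sc: "filterlim (\<lambda>s. s * r) (at_right 0) (at_right 0)" if "r > 0" for r :: real
  proof -
    have "((\<lambda>s. s * r) \<longlongrightarrow> 0 * r) (at_right 0)" by (intro tendsto_intros)
    moreover have "\<forall>\<^sub>F s in at_right 0. s * r \<in> {0<..} \<and> s * r \<noteq> 0"
      using that by (auto simp: eventually_at_right_field intro!: exI[of _ 1])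
    ultimately show ?thesis unfolding filterlim_at by simp
  qed
  \<comment> \<open>Both volumes tend to the same finite limit; whether that limit is zero does not
    matter.\<close>
  have "((\<lambda>s. C * (v (s * \<Lambda>) - v (s * inverse \<Lambda>))) \<longlongrightarrow>
      C * (enn2real (INF t\<in>{0<..<t0}. emeasure (norm_vol t) UNIV) - enn2real (INF t\<in>{0<..<t0}. emeasure (norm_vol t) UNIV))) (at_right 0)"
    using \<Lambda> iL by (intro tendsto_intros filterlim_compose[OF vlim sc]) auto
  then have lim: "((\<lambda>s. C * (v (s * \<Lambda>) - v (s * inverse \<Lambda>))) \<longlongrightarrow> 0) (at_right 0)" by simp
  have "((\<lambda>s. \<integral>z. \<bar>case z of (u, p) \<Rightarrow> G s u p\<bar> \<partial>M) \<longlongrightarrow> 0) (at_right 0)"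
  proof (rule tendsto_sandwich[OF _ _ tendsto_const lim])
    show "\<forall>\<^sub>F s in at_right 0. 0 \<le> (\<integral>z. \<bar>case z of (u, p) \<Rightarrow> G s u p\<bar> \<partial>M)"
      by (intro always_eventually allI Bochner_Integration.integral_nonneg) simp
    show "\<forall>\<^sub>F s in at_right 0. (\<integral>z. \<bar>case z of (u, p) \<Rightarrow> G s u p\<bar> \<partial>M) \<le> C * (v (s * \<Lambda>) - v (s * inverse \<Lambda>))"
      using ev by eventually_elim (use main in blast)
  qed
  moreover have "\<forall>\<^sub>F s in at_right 0. integrable M (\<lambda>(u, p). G s u p)"
    using ev by eventually_elim (use main in blast)
  ultimately show ?thesis unfolding tendsto_zero_L1_def M_def by blast
qed

text \<open>R \<le> 0 and L \<ge> 1/3 give -R \<le> -3LR pointwise, and the integrated lapse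
  equation then trades -3LR for 9(3L - 1)/t^2.\<close>

lemma nn_integral_scalar_curvature_le:
  assumes t: "0 < t" "t < t0"
  shows "(\<integral>\<^sup>+p. ennreal \<bar>scalar_curvature A (h t) p\<bar> \<partial>norm_vol t)
    \<le> (\<integral>\<^sup>+p. ennreal (9 / t\<^sup>2 * (3 * L t p - 1)) \<partial>norm_vol t)"
proof -
  have tI: "t \<in> {0<..t0}" using t by simp
  interpret riemannian_manifold A "h t" by (rule riemannian[OF tI])
  interpret V: finite_measure "dvol A (h t)" by (rule finite_measure_dvol)
  have cont: "continuous_on UNIV (L t)" "continuous_on UNIV (scalar_curvature A (h t))"
    by (intro continuous_on_time_slice continuous_on_lapse continuous_on_scalar_curvature t)+
  have int: "integrable (dvol A (h t)) f" if "continuous_on UNIV f" for f :: "'a \<Rightarrow> real"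
  proof -
    have "bounded (range f)" using compact_continuous_image[OF that compact_UNIV] compact_imp_bounded by blast
    then obtain b where b: "\<And>p. norm (f p) \<le> b" unfolding bounded_iff by blast
    have "f \<in> borel_measurable (dvol A (h t))"
      using borel_measurable_continuous_onI[OF that] measurable_cong_sets[OF sets_dvol refl] by blast
    then show ?thesis using b by (intro V.integrable_const_bound[of _ b]) auto
  qed
  let ?R = "scalar_curvature A (h t)"
  have R0: "?R p \<le> 0" for p by (rule scalar_curvature_nonpos[OF tI])
  have L3: "1 / 3 \<le> L t p" for p by (rule lapse_ge_third[OF t])
  have I1: "integrable (dvol A (h t)) (\<lambda>p. - ?R p)" "integrable (dvol A (h t)) (\<lambda>p. 9 / t\<^sup>2 * (3 * L t p - 1))"
    "integrable (dvol A (h t)) (\<lambda>p. - 3 * (L t p * ?R p))"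
    by (intro int continuous_intros cont)+
  have "(\<integral>p. - ?R p \<partial>dvol A (h t)) \<le> (\<integral>p. - 3 * (L t p * ?R p) \<partial>dvol A (h t))"
  proof (rule integral_mono[OF I1(1,3)])
    show "- ?R p \<le> - 3 * (L t p * ?R p)" for p
      using mult_right_mono_neg[OF L3[of p] R0[of p]] by simp
  qed
  \<comment> \<open>The subtracted term is three times the Laplacian of the lapse, written by means
    of the lapse equation so that its integral is known to vanish.\<close>
  also have "\<dots> = (\<integral>p. 9 / t\<^sup>2 * (3 * L t p - 1) - 3 * (L t p * (9 / t\<^sup>2 + ?R p) - 3 / t\<^sup>2) \<partial>dvol A (h t))"
    by (intro Bochner_Integration.integral_cong refl)
      (simp add: algebra_simps add_divide_distrib diff_divide_distrib)
  also have "\<dots> = (\<integral>p. 9 / t\<^sup>2 * (3 * L t p - 1) \<partial>dvol A (h t))"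
  proof -
    have "integrable (dvol A (h t)) (\<lambda>p. 3 * (L t p * (9 / t\<^sup>2 + ?R p) - 3 / t\<^sup>2))"
      by (intro integrable_mult_right integral_lapse_equation t)
    from Bochner_Integration.integral_diff[OF I1(2) this] show ?thesis
      unfolding integral_mult_right_zero integral_lapse_equation(2)[OF t] by simp
  qed
  finally have le: "(\<integral>p. - ?R p \<partial>dvol A (h t)) \<le> (\<integral>p. 9 / t\<^sup>2 * (3 * L t p - 1) \<partial>dvol A (h t))" .
  have "(\<integral>\<^sup>+p. ennreal \<bar>?R p\<bar> \<partial>dvol A (h t)) = ennreal (\<integral>p. - ?R p \<partial>dvol A (h t))"
    using nn_integral_eq_integral[OF I1(1)] R0 by (simp add: abs_of_nonpos)
  also have "\<dots> \<le> ennreal (\<integral>p. 9 / t\<^sup>2 * (3 * L t p - 1) \<partial>dvol A (h t))"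
    by (rule ennreal_leI[OF le])
  also have "\<dots> = (\<integral>\<^sup>+p. ennreal (9 / t\<^sup>2 * (3 * L t p - 1)) \<partial>dvol A (h t))"
  proof (rule nn_integral_eq_integral[OF I1(2), symmetric])
    have "0 \<le> 9 / t\<^sup>2 * (3 * L t p - 1)" for p using L3[of p] by simp
    then show "AE p in dvol A (h t). 0 \<le> 9 / t\<^sup>2 * (3 * L t p - 1)" by simp
  qed
  finally have *: "(\<integral>\<^sup>+p. ennreal \<bar>?R p\<bar> \<partial>dvol A (h t)) \<le> (\<integral>\<^sup>+p. ennreal (9 / t\<^sup>2 * (3 * L t p - 1)) \<partial>dvol A (h t))" .
  have m: "(\<lambda>p. ennreal \<bar>?R p\<bar>) \<in> borel_measurable (dvol A (h t))"
    "(\<lambda>p. ennreal (9 / t\<^sup>2 * (3 * L t p - 1))) \<in> borel_measurable (dvol A (h t))"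
    using I1 by auto
  show ?thesis
    unfolding norm_vol_def nn_integral_scale_measure[OF m(1)] nn_integral_scale_measure[OF m(2)]
    by (rule mult_left_mono[OF *]) simp
qed

text \<open>Stated for an abstract \<open>G\<close> so as to serve both the rescaled scalar
  curvature and the deviation of |K|^2, which have the same absolute value.\<close>

lemma curvature_L1_convergence:
  assumes t0: "t0 > 0" and \<Lambda>: "\<Lambda> > 1"
    and G: "\<And>s u p. 0 < s \<Longrightarrow> s * \<Lambda> < t0 \<Longrightarrow> u \<in> {inverse \<Lambda>..\<Lambda>} \<Longrightarrow>
      G s u p = s\<^sup>2 * \<bar>scalar_curvature A (h (s * u)) p\<bar>"
  shows "tendsto_zero_L1 (restrict_space lborel {inverse \<Lambda>..\<Lambda>} \<Otimes>\<^sub>M dvol_0 A h) (at_right 0) (\<lambda>s (u, p). G s u p)"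
proof (rule L1_convergence[OF t0 \<Lambda>, of "9 * \<Lambda>"])
  fix s assume s: "0 < s" "s * \<Lambda> < t0"
  let ?I = "{inverse \<Lambda>..\<Lambda>}"
  note u = rescaled_time_bounds[OF \<Lambda> s]
  show "continuous_on (?I \<times> UNIV) (\<lambda>(u, p). G s u p)"
  proof -
    have "continuous_on (?I \<times> UNIV) (\<lambda>z. s\<^sup>2 * \<bar>case z of (u, p) \<Rightarrow> scalar_curvature A (h (s * u)) p\<bar>)"
      by (intro continuous_intros continuous_on_rescaled_time[OF continuous_on_scalar_curvature \<Lambda> s])
    then show ?thesis by (rule continuous_on_eq) (auto simp: G[OF s])
  qed
  fix u assume uI: "u \<in> ?I"
  have sI: "s * u \<in> {0<..t0}" using u[OF uI] by simp
  interpret riemannian_manifold A "h (s * u)" by (rule riemannian[OF sI])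
  have [measurable]: "L (s * u) \<in> borel_measurable (norm_vol (s * u))"
    using lapse_measurable[OF u(2,3)[OF uI]] measurable_cong_sets[OF sets_norm_vol[OF sI] refl] by blast
  have [measurable]: "scalar_curvature A (h (s * u)) \<in> borel_measurable (norm_vol (s * u))"
  proof -
    have "scalar_curvature A (h (s * u)) \<in> borel_measurable borel"
      using u[OF uI]
      by (intro borel_measurable_continuous_onI continuous_on_time_slice continuous_on_scalar_curvature)
    then show ?thesis using measurable_cong_sets[OF sets_norm_vol[OF sI] refl] by blast
  qed
  have "(\<integral>\<^sup>+p. ennreal \<bar>G s u p\<bar> \<partial>norm_vol (s * u))
      = (\<integral>\<^sup>+p. ennreal (s\<^sup>2) * ennreal \<bar>scalar_curvature A (h (s * u)) p\<bar> \<partial>norm_vol (s * u))"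
    by (intro nn_integral_cong) (simp add: G[OF s uI] ennreal_mult abs_mult)
  also have "\<dots> = ennreal (s\<^sup>2) * (\<integral>\<^sup>+p. ennreal \<bar>scalar_curvature A (h (s * u)) p\<bar> \<partial>norm_vol (s * u))"
    by (intro nn_integral_cmult) measurable
  also have "\<dots> \<le> ennreal (s\<^sup>2) * (\<integral>\<^sup>+p. ennreal (9 / (s * u)\<^sup>2 * (3 * L (s * u) p - 1)) \<partial>norm_vol (s * u))"
    by (intro mult_left_mono nn_integral_scalar_curvature_le u uI) simp
  also have "\<dots> = (\<integral>\<^sup>+p. ennreal (s\<^sup>2) * ennreal (9 / (s * u)\<^sup>2 * (3 * L (s * u) p - 1)) \<partial>norm_vol (s * u))"
    by (intro nn_integral_cmult[symmetric]) measurable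
  also have "\<dots> \<le> (\<integral>\<^sup>+p. ennreal (9 * \<Lambda>) * ennreal ((3 * L (s * u) p - 1) / u) \<partial>norm_vol (s * u))"
  proof (rule nn_integral_mono)
    fix p
    have L3: "0 \<le> 3 * L (s * u) p - 1" using lapse_ge_third[OF u(2,3)[OF uI], of p] by simp
    \<comment> \<open>The factor s^2 cancels against 9/(su)^2 and leaves 9/u^2. One power of 1/u is
      bounded by \<Lambda>, the other is kept for the volume evolution; hence the constant 9
      \<Lambda>.\<close>
    have "1 / u \<le> \<Lambda>"
      using uI u(1)[OF uI] \<Lambda> by (simp add: field_simps)
    then have "9 * (1 / u) * ((3 * L (s * u) p - 1) / u) \<le> 9 * \<Lambda> * ((3 * L (s * u) p - 1) / u)"
      using L3 u(1)[OF uI] by (intro mult_right_mono) auto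
    moreover have "s\<^sup>2 * (9 / (s * u)\<^sup>2 * (3 * L (s * u) p - 1)) = 9 * (1 / u) * ((3 * L (s * u) p - 1) / u)"
      using s u(1)[OF uI] by (simp add: field_simps power2_eq_square)
    ultimately have "ennreal (s\<^sup>2 * (9 / (s * u)\<^sup>2 * (3 * L (s * u) p - 1))) \<le> ennreal (9 * \<Lambda> * ((3 * L (s * u) p - 1) / u))"
      by (simp only: ennreal_leI)
    then show "ennreal (s\<^sup>2) * ennreal (9 / (s * u)\<^sup>2 * (3 * L (s * u) p - 1)) \<le> ennreal (9 * \<Lambda>) * ennreal ((3 * L (s * u) p - 1) / u)"
      using L3 u(1)[OF uI] \<Lambda> by (simp add: ennreal_mult[symmetric])
  qed
  also have "\<dots> = ennreal (9 * \<Lambda>) * (\<integral>\<^sup>+p. ennreal ((3 * L (s * u) p - 1) / u) \<partial>norm_vol (s * u))"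
    by (intro nn_integral_cmult) measurable
  finally show "(\<integral>\<^sup>+p. ennreal \<bar>G s u p\<bar> \<partial>norm_vol (s * u))
      \<le> ennreal (9 * \<Lambda>) * (\<integral>\<^sup>+p. ennreal ((3 * L (s * u) p - 1) / u) \<partial>norm_vol (s * u))" .
qed (use \<Lambda> in simp)

lemma lapse_L1_convergence:
  assumes t0: "t0 > 0" and \<Lambda>: "\<Lambda> > 1"
  shows "tendsto_zero_L1 (restrict_space lborel {inverse \<Lambda>..\<Lambda>} \<Otimes>\<^sub>M dvol_0 A h) (at_right 0)
    (\<lambda>s (u, p). \<bar>rescaled_lapse L s u p - 1 / 3\<bar>)"
proof (rule L1_convergence[OF t0 \<Lambda>, of "\<Lambda>"])
  fix s assume s: "0 < s" "s * \<Lambda> < t0"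
  let ?I = "{inverse \<Lambda>..\<Lambda>}"
  note u = rescaled_time_bounds[OF \<Lambda> s]
  show "continuous_on (?I \<times> UNIV) (\<lambda>(u, p). \<bar>rescaled_lapse L s u p - 1 / 3\<bar>)"
  proof -
    have "continuous_on (?I \<times> UNIV) (\<lambda>z. \<bar>(case z of (u, p) \<Rightarrow> L (s * u) p) - 1 / 3\<bar>)"
      by (intro continuous_intros continuous_on_rescaled_time[OF continuous_on_lapse \<Lambda> s])
    then show ?thesis by (simp add: rescaled_lapse_def case_prod_unfold)
  qed
  fix u assume uI: "u \<in> ?I"
  have sI: "s * u \<in> {0<..t0}" using u[OF uI] by simp
  have [measurable]: "L (s * u) \<in> borel_measurable (norm_vol (s * u))"
    using lapse_measurable[OF u(2,3)[OF uI]] measurable_cong_sets[OF sets_norm_vol[OF sI] refl] by blast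
  have "(\<integral>\<^sup>+p. ennreal \<bar>\<bar>rescaled_lapse L s u p - 1 / 3\<bar>\<bar> \<partial>norm_vol (s * u))
      \<le> (\<integral>\<^sup>+p. ennreal \<Lambda> * ennreal ((3 * L (s * u) p - 1) / u) \<partial>norm_vol (s * u))"
  proof (rule nn_integral_mono)
    fix p
    have L3: "1 / 3 \<le> L (s * u) p" by (rule lapse_ge_third[OF u(2,3)[OF uI]])
    \<comment> \<open>The factor 1 is then replaced by \<open>\<Lambda> / u\<close>, which is at
      least 1 on the interval, to create the weight 1/u of the volume evolution.\<close>
    have "L (s * u) p - 1 / 3 \<le> 1 * (3 * L (s * u) p - 1)" using L3 by simp
    also have "\<dots> \<le> \<Lambda> / u * (3 * L (s * u) p - 1)"
      using L3 uI u(1)[OF uI] by (intro mult_right_mono) auto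
    finally have "ennreal (L (s * u) p - 1 / 3) \<le> ennreal (\<Lambda> * ((3 * L (s * u) p - 1) / u))"
      by (intro ennreal_leI) simp
    then show "ennreal \<bar>\<bar>rescaled_lapse L s u p - 1 / 3\<bar>\<bar> \<le> ennreal \<Lambda> * ennreal ((3 * L (s * u) p - 1) / u)"
      using L3 u(1)[OF uI] \<Lambda> by (simp add: rescaled_lapse_def ennreal_mult[symmetric])
  qed
  also have "\<dots> = ennreal \<Lambda> * (\<integral>\<^sup>+p. ennreal ((3 * L (s * u) p - 1) / u) \<partial>norm_vol (s * u))"
    by (intro nn_integral_cmult) measurable
  finally show "(\<integral>\<^sup>+p. ennreal \<bar>\<bar>rescaled_lapse L s u p - 1 / 3\<bar>\<bar> \<partial>norm_vol (s * u))
      \<le> ennreal \<Lambda> * (\<integral>\<^sup>+p. ennreal ((3 * L (s * u) p - 1) / u) \<partial>norm_vol (s * u))" .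
qed (use \<Lambda> in simp)

lemma rescaled_scalar_curvature:
  assumes s: "0 < s" and t: "s * u \<in> {0<..t0}"
  shows "scalar_curvature A (rescaled_metric h s u) p = s\<^sup>2 * scalar_curvature A (h (s * u)) p"
proof -
  interpret riemannian_manifold A "h (s * u)" by (rule riemannian[OF t])
  show ?thesis
    unfolding rescaled_metric_def using scalar_curvature_scale[of "1 / s\<^sup>2" p] s by simp
qed

text \<open>The factors 1/s^2 for the metric and 1/s for the second form multiply |K|^2 by s^2, and
  9/u^2 is s^2 times 9/(su)^2; the Hamiltonian constraint at time \<open>s * u\<close> gives the
  difference.\<close>

lemma rescaled_norm_sq:
  assumes s: "0 < s" and u: "0 < u" and t: "s * u \<in> {0<..t0}"
  shows "norm_sq A (rescaled_metric h s u) (rescaled_second_form K s u) p - 9 / u\<^sup>2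
    = s\<^sup>2 * scalar_curvature A (h (s * u)) p"
proof -
  interpret riemannian_manifold A "h (s * u)" by (rule riemannian[OF t])
  have "norm_sq A (rescaled_metric h s u) (rescaled_second_form K s u) p = s\<^sup>2 * norm_sq A (h (s * u)) (K (s * u)) p"
    unfolding rescaled_metric_def rescaled_second_form_def
    using norm_sq_scale[of "1 / s\<^sup>2" "1 / s" "K (s * u)" p] s by (simp add: power2_eq_square field_simps)
  moreover have "s\<^sup>2 * (9 / (s * u)\<^sup>2) = 9 / u\<^sup>2" using s by (simp add: field_simps power2_eq_square)
  ultimately show ?thesis
    unfolding scalar_curvature_eq[OF t] by (simp add: right_diff_distrib)
qed

end

theorem theorem1p13:
  fixes A :: "('a::{t2_space, second_countable_topology}, 3) atlas"
    and L :: "real \<Rightarrow> 'a \<Rightarrow> real"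
    and h K :: "real \<Rightarrow> ('a, 3) tensor2"
    and t0 \<Lambda> :: real
  assumes "compact (UNIV :: 'a set)"
    and "connected (UNIV :: 'a set)"
    and "smooth_atlas A"
    and "t0 > 0"
    and "einstein_flow A {0<..t0} L h K"
    and "CMC A {0<..t0} h K"
    and "crushing_singularity A {0<..t0} h K"
    and "hubble_time A {0<..t0} h K"
    and "\<forall>t\<in>{0<..t0}. \<forall>p. scalar_curvature A (h t) p \<le> 0"
    and "\<Lambda> > 1"
  defines "M \<equiv> restrict_space lborel {inverse \<Lambda>..\<Lambda>} \<Otimes>\<^sub>M dvol_0 A h"
  shows "tendsto_zero_L1 M (at_right 0) (\<lambda>s (u, p). \<bar>rescaled_lapse L s u p - 1 / 3\<bar>) \<and>
    tendsto_zero_L1 M (at_right 0) (\<lambda>s (u, p).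
      \<bar>norm_sq A (rescaled_metric h s u) (rescaled_second_form K s u) p - 9 / u\<^sup>2\<bar>) \<and>
    tendsto_zero_L1 M (at_right 0) (\<lambda>s (u, p).
      \<bar>scalar_curvature A (rescaled_metric h s u) p\<bar>)"
proof -
  interpret hubble_flow A L h K t0
    by unfold_locales (use assms in auto)
  have su: "0 < u" "s * u \<in> {0<..t0}"
    if "0 < s" "s * \<Lambda> < t0" "u \<in> {inverse \<Lambda>..\<Lambda>}" for s u
    using rescaled_time_bounds[OF \<open>\<Lambda> > 1\<close> that] by auto
  show ?thesis
    unfolding M_def
  proof (intro conjI lapse_L1_convergence curvature_L1_convergence \<open>t0 > 0\<close> \<open>\<Lambda> > 1\<close>)
    \<comment> \<open>The last two limits are both instances of
      \<open>curvature_L1_convergence\<close>; what remains is to bring their integrands to its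
      form.\<close>
    fix s u :: real and p
    assume s: "0 < s" "s * \<Lambda> < t0" "u \<in> {inverse \<Lambda>..\<Lambda>}"
    show "\<bar>norm_sq A (rescaled_metric h s u) (rescaled_second_form K s u) p - 9 / u\<^sup>2\<bar>
        = s\<^sup>2 * \<bar>scalar_curvature A (h (s * u)) p\<bar>"
      unfolding rescaled_norm_sq[OF s(1) su[OF s]] by (simp add: abs_mult)
    show "\<bar>scalar_curvature A (rescaled_metric h s u) p\<bar> = s\<^sup>2 * \<bar>scalar_curvature A (h (s * u)) p\<bar>"
      unfolding rescaled_scalar_curvature[OF s(1) su(2)[OF s]] by (simp add: abs_mult)
  qed
qed

end
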